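(* There exists a computably random real $x\in[0,1]$ that is a density-one point and is not Martin-Löf random.
   Context: Reals are identified with binary expansions. $x$ is computably random if $\limsup_nd(x\restriction n)<\infty$ for every computable martingale $d$ (a martingale is $d\colon2^{<\omega}\to[0,\infty)$ with $d(\sigma)=(d(\sigma0)+d(\sigma1))/2$). $x$ is Martin-Löf random if $x\notin\bigcap_nU_n$ for every uniformly c.e. sequence of open classes with $\lambda(U_n)\le2^{-n}$. Effectively closed class: complement is the union of an effective sequence of rational open intervals. $\varrho(\mathcal{C}\mid x)=\liminf_{\gamma,\delta\to0^+}\frac{\lambda([x-\gamma,x+\delta]\cap\mathcal{C})}{\gamma+\delta}$; $x$ is a density-one point if $\varrho(\mathcal{C}\mid x)=1$ for every effectively closed $\mathcal{C}$ containing $x$. *)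

theory Defs
  imports "HOL-Analysis.Analysis" "HOL-Library.Nat_Bijection"
begin

section \<open>Computable functions on the natural numbers\<close>

text \<open>
  Kleene's partial recursive functions, as programs with a big-step semantics on argument
  lists. The relation \<open>rec_eval f xs y\<close> means that \<open>f\<close> halts on \<open>xs\<close> with value \<open>y\<close>. Arities are
  implicit in the length of the argument list. The recursion variable of \<open>Prec\<close> and the
  search variable of \<open>Mu\<close> are the first argument.
\<close>

datatype recf =
  Zero | Succ | Proj nat | Comp recf "recf list" | Prec recf recf | Mu recf

inductive rec_eval :: "recf \<Rightarrow> nat list \<Rightarrow> nat \<Rightarrow> bool" where
  zero: "rec_eval Zero xs 0"
| succ: "rec_eval Succ [x] (Suc x)"
| proj: "i < length xs \<Longrightarrow> rec_eval (Proj i) xs (xs ! i)"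
| comp: "list_all2 (\<lambda>g y. rec_eval g xs y) gs ys \<Longrightarrow> rec_eval f ys z
          \<Longrightarrow> rec_eval (Comp f gs) xs z"
| prec_0: "rec_eval f xs y \<Longrightarrow> rec_eval (Prec f g) (0 # xs) y"
| prec_Suc: "rec_eval (Prec f g) (n # xs) r \<Longrightarrow> rec_eval g (n # r # xs) y
          \<Longrightarrow> rec_eval (Prec f g) (Suc n # xs) y"
| mu: "rec_eval f (n # xs) 0 \<Longrightarrow> \<forall>m<n. \<exists>k. rec_eval f (m # xs) (Suc k)
          \<Longrightarrow> rec_eval (Mu f) xs n"

inductive_cases rec_evalE:
  "rec_eval Zero xs y" "rec_eval Succ xs y" "rec_eval (Proj i) xs y" "rec_eval (Comp f gs) xs y"
  "rec_eval (Prec f g) (0 # xs) y" "rec_eval (Prec f g) (Suc n # xs) y" "rec_eval (Mu f) xs y"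

lemma rec_eval_deterministic:
  "rec_eval f xs y \<Longrightarrow> rec_eval f xs y' \<Longrightarrow> y = y'"
proof (induction arbitrary: y' rule: rec_eval.induct)
  case (zero xs)
  then show ?case by (rule rec_evalE(1)) simp
next
  case (succ x)
  then show ?case by (rule rec_evalE(2)) simp
next
  case (proj i xs)
  from proj.prems show ?case by (rule rec_evalE(3)) simp
next
  case (comp xs gs ys f z)
  from comp.prems show ?case
  proof (rule rec_evalE(4))
    fix ys' assume ys': "list_all2 (\<lambda>g y. rec_eval g xs y) gs ys'" and z: "rec_eval f ys' y'"
    have "ys = ys'"
    proof (rule nth_equalityI)
      show "length ys = length ys'"
        using list_all2_lengthD[OF comp.IH(1)] list_all2_lengthD[OF ys'] by simp
      show "ys ! i = ys' ! i" if "i < length ys" for i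
      proof -
        have "i < length gs" using that list_all2_lengthD[OF comp.IH(1)] by simp
        then have "rec_eval (gs ! i) xs (ys' ! i)" by (rule list_all2_nthD[OF ys'])
        with list_all2_nthD2[OF comp.IH(1) that] show ?thesis by simp
      qed
    qed
    with z show ?thesis by (simp add: comp.IH(2))
  qed
next
  case (prec_0 f xs y g)
  from prec_0.prems show ?case by (rule rec_evalE(5)) (rule prec_0.IH)
next
  case (prec_Suc f g n xs r y)
  from prec_Suc.prems show ?case
  proof (rule rec_evalE(6))
    fix r' assume "rec_eval (Prec f g) (n # xs) r'" and "rec_eval g (n # r' # xs) y'"
    moreover from this(1) have "r = r'" by (rule prec_Suc.IH(1))
    ultimately show ?thesis by (simp add: prec_Suc.IH(2))
  qed
next
  case (mu f n xs)
  from mu.prems show ?case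
  proof (rule rec_evalE(7))
    assume z: "rec_eval f (y' # xs) 0" and l: "\<forall>m<y'. \<exists>k. rec_eval f (m # xs) (Suc k)"
    show ?thesis
    proof (cases n y' rule: linorder_cases)
      case less
      with l obtain k where "rec_eval f (n # xs) (Suc k)" by auto
      then have "0 = Suc k" by (rule mu.IH(1))
      then show ?thesis by simp
    next
      case greater
      with mu.IH(2) obtain k where "\<forall>w. rec_eval f (y' # xs) w \<longrightarrow> Suc k = w" by auto
      with z have "Suc k = 0" by simp
      then show ?thesis by simp
    qed
  qed
qed

definition computable :: "(nat \<Rightarrow> nat) \<Rightarrow> bool" where
  "computable h \<longleftrightarrow> (\<exists>f. \<forall>n. rec_eval f [n] (h n))"

definition computable_rat_seq :: "(nat \<Rightarrow> rat) \<Rightarrow> bool" where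
  "computable_rat_seq q \<longleftrightarrow> (\<exists>num den. computable num \<and> computable den \<and>
     (\<forall>n. q n = of_int (int_decode (num n)) / of_nat (Suc (den n))))"


section \<open>Effectively open and effectively closed classes of reals\<close>

text \<open>
  An interval whose left end point is not below its right end point is empty, so unions of
  finitely many intervals, and the empty class, are covered.
\<close>

definition uniformly_ce_open :: "(nat \<Rightarrow> real set) \<Rightarrow> bool" where
  "uniformly_ce_open U \<longleftrightarrow> (\<exists>a b. computable_rat_seq a \<and> computable_rat_seq b \<and>
     (\<forall>n. U n = (\<Union>k. {of_rat (a (prod_encode (n, k))) <..< of_rat (b (prod_encode (n, k)))})))"

definition effectively_closed :: "real set \<Rightarrow> bool" where
  "effectively_closed C \<longleftrightarrow> (\<exists>a b. computable_rat_seq a \<and> computable_rat_seq b \<and>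
     - C = (\<Union>k. {of_rat (a k) <..< of_rat (b k)}))"


section \<open>Martingales and randomness\<close>

definition martingale :: "(bool list \<Rightarrow> real) \<Rightarrow> bool" where
  "martingale d \<longleftrightarrow>
     (\<forall>\<sigma>. 0 \<le> d \<sigma>) \<and> (\<forall>\<sigma>. d \<sigma> = (d (\<sigma> @ [False]) + d (\<sigma> @ [True])) / 2)"

definition string_encode :: "bool list \<Rightarrow> nat" where
  "string_encode \<sigma> = list_encode (map of_bool \<sigma>)"

text \<open>
  The values of a computable martingale are uniformly computable reals: from a string and a
  precision \<open>n\<close> one can compute a rational approximation with error at most \<open>2\<^sup>-\<^sup>n\<close>.
\<close>

definition computable_martingale :: "(bool list \<Rightarrow> real) \<Rightarrow> bool" where
  "computable_martingale d \<longleftrightarrow> martingale d \<and>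
     (\<exists>q. computable_rat_seq q \<and>
       (\<forall>\<sigma> n. \<bar>d \<sigma> - of_rat (q (prod_encode (string_encode \<sigma>, n)))\<bar> \<le> (1/2) ^ n))"

definition binary_expansion :: "(nat \<Rightarrow> bool) \<Rightarrow> real \<Rightarrow> bool" where
  "binary_expansion Z x \<longleftrightarrow> (\<lambda>n. of_bool (Z n) / 2 ^ Suc n) sums x"

text \<open>
  Dyadic rationals have two expansions, but both are computable sequences, so a computable
  martingale succeeds on each of them and the choice of the expansion is irrelevant. Numbers
  outside the unit interval have no expansion and hence are not computably random.
\<close>

definition computably_random :: "real \<Rightarrow> bool" where
  "computably_random x \<longleftrightarrow> (\<exists>Z. binary_expansion Z x \<and>
     (\<forall>d. computable_martingale d \<longrightarrow> limsup (\<lambda>n. ereal (d (map Z [0..<n]))) < \<infinity>))"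

definition martin_loef_random :: "real \<Rightarrow> bool" where
  "martin_loef_random x \<longleftrightarrow>
     (\<forall>U. uniformly_ce_open U \<and> (\<forall>n. emeasure lborel (U n) \<le> ennreal ((1/2) ^ n))
        \<longrightarrow> x \<notin> (\<Inter>n. U n))"


section \<open>Density\<close>

definition lower_density :: "real set \<Rightarrow> real \<Rightarrow> ereal" where
  "lower_density C x =
     Liminf (at_right 0 \<times>\<^sub>F at_right 0)
       (\<lambda>(\<gamma>, \<delta>). ereal (measure lborel ({x - \<gamma> .. x + \<delta>} \<inter> C) / (\<gamma> + \<delta>)))"

definition density_one_point :: "real \<Rightarrow> bool" where
  "density_one_point x \<longleftrightarrow> (\<forall>C. effectively_closed C \<and> x \<in> C \<longrightarrow> lower_density C x = 1)"

end

theory Submission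
  imports Defs
begin

text \<open>
  The point is generic for a forcing notion whose conditions \<open>(\<tau>, d)\<close> consist of a string and a
  computable martingale with \<open>d [] < 1\<close>; a condition allows the sequences that extend \<open>\<tau>\<close> and on
  which \<open>d\<close> stays below \<open>1\<close>. Adding a small multiple of a computable martingale to \<open>d\<close> bounds it on
  all allowed sequences, which gives computable randomness. Every condition allows a computable
  sequence, hence it can be strengthened into each component of a test that covers, by means of a
  universal function, an interval around one guess for every program.

  For density, let \<open>C\<close> be closed. If some allowed string has an interval that misses \<open>C\<close>, go there.
  Otherwise all allowed points are in \<open>C\<close>. Move to a string where \<open>d\<close> is close to the infimum \<open>L\<close> of
  its values on allowed strings, and stop \<open>d\<close> when it gets close to \<open>1\<close>. A multiple \<open>f\<close> of the
  stopped martingale minus \<open>L\<close> is then at least \<open>1\<close> on stopped strings although it starts with a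
  tiny capital. Dyadic intervals are not enough to control arbitrary intervals around the point.
  Therefore let \<open>F\<close> be the distribution function of \<open>f\<close> and \<open>G y = (SUP z\<ge>y. F z - \<epsilon> * (z - y))\<close> the
  function from the rising sun lemma. The slopes of \<open>G\<close> form a computable martingale of no larger
  capital, and where they are below \<open>\<epsilon>\<close> the function \<open>F\<close> has slope at most about \<open>\<epsilon>\<close> over all
  intervals to the right. Together with its mirror image this bounds the measure of the stopped
  intervals near the point.
\<close>

section \<open>Closure properties of the computable functions\<close>

text \<open>The obstacle behind the density argument: the complement of an effectively closed C is
  only effectively open, so the martingale that follows its conditional measure is in general not
  computable and cannot be put into a condition. The substitute is the martingale d of the condition
  itself. Once the cells of all allowed strings meet C, what C misses is covered by cells where d
  was stopped near 1. The infimum L enters because a martingale that starts just above L and never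
  falls below L has almost nothing to lose; by fairness it can gain about 1 - L only on a set of
  tiny measure. Neither L nor the comparison with 1 is available to a computation, hence the dyadic
  lower bound for L and the tolerance in the stopping rule.

  The two randomness notions come apart because a test may wait until a program halts and pays a
  fixed amount of measure for each program, halting or not. A computable martingale would have to
  know in advance which programs halt.\<close>

definition ncomp :: "nat \<Rightarrow> (nat list \<Rightarrow> nat) \<Rightarrow> bool" where
  "ncomp n F \<longleftrightarrow> (\<exists>r. \<forall>xs. length xs = n \<longrightarrow> rec_eval r xs (F xs))"

lemma ncomp_proj: "i < n \<Longrightarrow> ncomp n (\<lambda>xs. xs ! i)"
  unfolding ncomp_def by (metis rec_eval.proj)

lemma ncomp_zero: "ncomp n (\<lambda>xs. 0)"
  unfolding ncomp_def by (metis rec_eval.zero)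

lemma ncomp_Suc:
  assumes "ncomp n F" shows "ncomp n (\<lambda>xs. Suc (F xs))"
proof -
  obtain r where r: "\<And>xs. length xs = n \<Longrightarrow> rec_eval r xs (F xs)"
    using assms by (auto simp: ncomp_def)
  have "rec_eval (Comp Succ [r]) xs (Suc (F xs))" if "length xs = n" for xs
    by (rule rec_eval.comp[where ys = "[F xs]"]) (simp_all add: r that rec_eval.succ)
  then show ?thesis by (auto simp: ncomp_def)
qed

lemma ncomp_const: "ncomp n (\<lambda>xs. c)"
  by (induction c) (auto intro: ncomp_zero ncomp_Suc)

lemma ncomp_comp1:
  assumes "ncomp 1 (\<lambda>xs. f (xs ! 0))" "ncomp n F"
  shows "ncomp n (\<lambda>xs. f (F xs))"
proof -
  obtain r where r: "\<And>xs. length xs = 1 \<Longrightarrow> rec_eval r xs (f (xs ! 0))"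
    using assms by (auto simp: ncomp_def)
  obtain s where s: "\<And>xs. length xs = n \<Longrightarrow> rec_eval s xs (F xs)"
    using assms by (auto simp: ncomp_def)
  have "rec_eval (Comp r [s]) xs (f (F xs))" if "length xs = n" for xs
    using r[of "[F xs]"] by (intro rec_eval.comp[where ys = "[F xs]"]) (simp_all add: s that)
  then show ?thesis by (auto simp: ncomp_def)
qed

lemma ncomp_comp2:
  assumes "ncomp 2 (\<lambda>xs. f (xs ! 0) (xs ! 1))" "ncomp n F" "ncomp n G"
  shows "ncomp n (\<lambda>xs. f (F xs) (G xs))"
proof -
  obtain r where r: "\<And>xs. length xs = 2 \<Longrightarrow> rec_eval r xs (f (xs ! 0) (xs ! 1))"
    using assms by (auto simp: ncomp_def)
  obtain s where s: "\<And>xs. length xs = n \<Longrightarrow> rec_eval s xs (F xs)"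
    using assms by (auto simp: ncomp_def)
  obtain t where t: "\<And>xs. length xs = n \<Longrightarrow> rec_eval t xs (G xs)"
    using assms by (auto simp: ncomp_def)
  have "rec_eval (Comp r [s, t]) xs (f (F xs) (G xs))" if "length xs = n" for xs
    using r[of "[F xs, G xs]"]
    by (intro rec_eval.comp[where ys = "[F xs, G xs]"]) (simp_all add: s t that)
  then show ?thesis by (auto simp: ncomp_def)
qed

lemma ncomp_rec:
  assumes "ncomp n F" "ncomp (Suc (Suc n)) (\<lambda>xs. g (xs ! 0) (xs ! 1) (tl (tl xs)))"
  shows "ncomp (Suc n) (\<lambda>xs. rec_nat (F (tl xs)) (\<lambda>i r. g i r (tl xs)) (xs ! 0))"
proof -
  obtain r where r: "\<And>xs. length xs = n \<Longrightarrow> rec_eval r xs (F xs)"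
    using assms by (auto simp: ncomp_def)
  obtain s where s: "\<And>xs. length xs = Suc (Suc n) \<Longrightarrow>
      rec_eval s xs (g (xs ! 0) (xs ! 1) (tl (tl xs)))"
    using assms by (auto simp: ncomp_def)
  have *: "rec_eval (Prec r s) (k # xs) (rec_nat (F xs) (\<lambda>i r. g i r xs) k)"
    if "length xs = n" for k xs
  proof (induction k)
    case 0
    then show ?case by (simp add: r that rec_eval.prec_0)
  next
    case (Suc k)
    show ?case
      using s[of "k # rec_nat (F xs) (\<lambda>i r. g i r xs) k # xs"] that
      by (auto intro: rec_eval.prec_Suc[OF Suc])
  qed
  have "rec_eval (Prec r s) xs (rec_nat (F (tl xs)) (\<lambda>i r. g i r (tl xs)) (xs ! 0))"
    if "length xs = Suc n" for xs
    using that * by (cases xs) auto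
  then show ?thesis by (auto simp: ncomp_def)
qed

lemma ncomp_rec2:
  assumes "ncomp 1 (\<lambda>xs. f (xs ! 0))" "ncomp 3 (\<lambda>xs. g (xs ! 0) (xs ! 1) (xs ! 2))"
  shows "ncomp 2 (\<lambda>xs. rec_nat (f (xs ! 1)) (\<lambda>i r. g i r (xs ! 1)) (xs ! 0))"
proof -
  have "ncomp (Suc (Suc 1)) (\<lambda>xs. g (xs ! 0) (xs ! 1) (tl (tl xs) ! 0))"
  proof -
    obtain r where r: "\<And>xs. length xs = 3 \<Longrightarrow> rec_eval r xs (g (xs ! 0) (xs ! 1) (xs ! 2))"
      using assms(2) by (auto simp: ncomp_def)
    have "rec_eval r xs (g (xs ! 0) (xs ! 1) (tl (tl xs) ! 0))" if "length xs = Suc (Suc 1)" for xs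
      using r[of xs] that by (auto simp: length_Suc_conv)
    then show ?thesis by (auto simp: ncomp_def)
  qed
  from ncomp_rec[OF assms(1) this]
  obtain r where r: "\<And>xs. length xs = 2 \<Longrightarrow> rec_eval r xs
      (rec_nat (f (tl xs ! 0)) (\<lambda>i r. g i r (tl xs ! 0)) (xs ! 0))"
    by (auto simp: ncomp_def numeral_2_eq_2)
  have "rec_eval r xs (rec_nat (f (xs ! 1)) (\<lambda>i r. g i r (xs ! 1)) (xs ! 0))" if "length xs = 2" for xs
  proof -
    have "tl xs ! 0 = xs ! 1" using that by (cases xs) auto
    with r[OF that] show ?thesis by simp
  qed
  then show ?thesis by (auto simp: ncomp_def)
qed

lemma ncomp_add2: "ncomp 2 (\<lambda>xs. xs ! 0 + xs ! 1)"
proof -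
  have "ncomp 2 (\<lambda>xs. rec_nat (xs ! 1) (\<lambda>i r. Suc r) (xs ! 0))"
    by (rule ncomp_rec2) (auto intro!: ncomp_proj ncomp_Suc)
  moreover have "rec_nat x (\<lambda>i r. Suc r) n = n + x" for x n :: nat by (induction n) auto
  ultimately show ?thesis by simp
qed

lemma ncomp_mult2: "ncomp 2 (\<lambda>xs. xs ! 0 * xs ! 1)"
proof -
  have "ncomp 2 (\<lambda>xs. rec_nat 0 (\<lambda>i r. r + xs ! 1) (xs ! 0))"
    by (rule ncomp_rec2) (auto intro!: ncomp_proj ncomp_zero ncomp_comp2[OF ncomp_add2])
  moreover have "rec_nat 0 (\<lambda>i r. r + x) n = n * x" for x n :: nat by (induction n) auto
  ultimately show ?thesis by simp
qed

lemma ncomp_pred: "ncomp 1 (\<lambda>xs. xs ! 0 - 1)"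
proof -
  have "ncomp 2 (\<lambda>xs. rec_nat 0 (\<lambda>i r. i) (xs ! 0))"
    by (rule ncomp_rec2[of "\<lambda>_. 0"]) (auto intro!: ncomp_proj ncomp_zero)
  moreover have "rec_nat 0 (\<lambda>i r. i) n = n - 1" for n :: nat by (induction n) auto
  ultimately have "ncomp 2 (\<lambda>xs. xs ! 0 - 1)" by simp
  from ncomp_comp2[OF this, where F = "\<lambda>xs. xs ! 0" and G = "\<lambda>xs. xs ! 0" and n = 1]
  show ?thesis by (auto intro!: ncomp_proj)
qed

lemma ncomp_diff2: "ncomp 2 (\<lambda>xs. xs ! 0 - xs ! 1)"
proof -
  have "ncomp 2 (\<lambda>xs. rec_nat (xs ! 1) (\<lambda>i r. r - 1) (xs ! 0))"
    by (rule ncomp_rec2) (intro ncomp_proj ncomp_comp1[OF ncomp_pred]; simp)+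
  moreover have "rec_nat x (\<lambda>i r. r - 1) n = x - n" for x n :: nat by (induction n) auto
  ultimately have "ncomp 2 (\<lambda>xs. xs ! 1 - xs ! 0)" by simp
  from ncomp_comp2[of "\<lambda>x y. y - x", OF this, where F = "\<lambda>xs. xs ! 1" and G = "\<lambda>xs. xs ! 0" and n = 2]
  show ?thesis by (simp add: ncomp_proj)
qed

lemma ncomp_triangle: "ncomp 1 (\<lambda>xs. triangle (xs ! 0))"
proof -
  have "ncomp 2 (\<lambda>xs. rec_nat 0 (\<lambda>i r. r + Suc i) (xs ! 0))"
    by (rule ncomp_rec2) (auto intro!: ncomp_proj ncomp_zero ncomp_comp2[OF ncomp_add2] ncomp_Suc)
  moreover have "rec_nat 0 (\<lambda>i r. r + Suc i) n = triangle n" for n :: nat by (induction n) auto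
  ultimately have "ncomp 2 (\<lambda>xs. triangle (xs ! 0))" by simp
  from ncomp_comp2[OF this, where F = "\<lambda>xs. xs ! 0" and G = "\<lambda>xs. xs ! 0" and n = 1]
  show ?thesis by (auto intro!: ncomp_proj)
qed

lemma ncomp_Least:
  assumes "ncomp 2 (\<lambda>xs. f (xs ! 0) (xs ! 1))" "\<And>x. \<exists>n. f n x = 0"
  shows "ncomp 1 (\<lambda>xs. LEAST n. f n (xs ! 0) = 0)"
proof -
  obtain r where r: "\<And>xs. length xs = 2 \<Longrightarrow> rec_eval r xs (f (xs ! 0) (xs ! 1))"
    using assms by (auto simp: ncomp_def)
  have "rec_eval (Mu r) [x] (LEAST n. f n x = 0)" for x
  proof (rule rec_eval.mu)
    show "rec_eval r [LEAST n. f n x = 0, x] 0"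
      using r[of "[LEAST n. f n x = 0, x]"] LeastI_ex[OF assms(2)] by auto
    have "f m x \<noteq> 0" if "m < (LEAST n. f n x = 0)" for m
      using not_less_Least that by blast
    then show "\<forall>m<LEAST n. f n x = 0. \<exists>k. rec_eval r [m, x] (Suc k)"
      using r[of "[_, x]"] by (auto simp: gr0_conv_Suc) (metis not0_implies_Suc)
  qed
  then show ?thesis by (auto simp: ncomp_def length_Suc_conv intro!: exI[of _ "Mu r"])
qed

section \<open>The pairing function and its projections\<close>

abbreviation pr :: "nat \<Rightarrow> nat \<Rightarrow> nat" where "pr a b \<equiv> prod_encode (a, b)"

definition p1 :: "nat \<Rightarrow> nat" where "p1 z = fst (prod_decode z)"
definition p2 :: "nat \<Rightarrow> nat" where "p2 z = snd (prod_decode z)"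

lemma p1_pr [simp]: "p1 (pr a b) = a" and p2_pr [simp]: "p2 (pr a b) = b"
  by (simp_all add: p1_def p2_def)

lemma pr_p1_p2 [simp]: "pr (p1 z) (p2 z) = z"
  by (simp add: p1_def p2_def)

lemma ncomp_pr: "ncomp 2 (\<lambda>xs. pr (xs ! 0) (xs ! 1))"
  unfolding prod_encode_def
  by (auto intro!: ncomp_comp2[OF ncomp_add2] ncomp_comp1[OF ncomp_triangle] ncomp_proj)

lemma triangle_mono: "m \<le> n \<Longrightarrow> triangle m \<le> triangle n"
  by (induction rule: dec_induct) auto

text \<open>Inverts the pairing: \<open>pr a c\<close> is \<open>triangle (a + c) + a\<close>, so
  the diagonal \<open>b = a + c\<close> is the least s with the code below
  \<open>triangle (Suc s)\<close>. Truncated subtraction gives this comparison the form required by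
  \<open>ncomp_Least\<close>.\<close>

lemma triangle_root: "(LEAST s. Suc (a + triangle b) - triangle (Suc s) = 0) = b" if "a \<le> b"
proof (rule Least_equality)
  show "Suc (a + triangle b) - triangle (Suc b) = 0" using that by simp
next
  fix s assume "Suc (a + triangle b) - triangle (Suc s) = 0"
  then have "triangle b < triangle (Suc s)" by linarith
  then have "\<not> Suc s \<le> b" using triangle_mono[of "Suc s" b] by linarith
  then show "b \<le> s" by simp
qed

lemma le_triangle: "n \<le> triangle n"
  by (induction n) auto

lemma ncomp_p1_p2: "ncomp 1 (\<lambda>xs. p1 (xs ! 0))" "ncomp 1 (\<lambda>xs. p2 (xs ! 0))"
proof -
  define w where "w z = (LEAST s. Suc z - triangle (Suc s) = 0)" for z
  have "ncomp 1 (\<lambda>xs. LEAST s. Suc (xs ! 0) - triangle (Suc s) = 0)"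
  proof (rule ncomp_Least)
    show "\<exists>s. Suc x - triangle (Suc s) = 0" for x
      using le_triangle[of "Suc x"] by (auto intro!: exI[of _ x])
  qed (auto intro!: ncomp_comp2[OF ncomp_diff2] ncomp_proj ncomp_comp1[OF ncomp_triangle] ncomp_Suc
      simp del: triangle_Suc)
  then have w: "ncomp 1 (\<lambda>xs. w (xs ! 0))" unfolding w_def .
  have wz: "w z = p1 z + p2 z" for z
  proof -
    obtain a b where z: "z = pr a b" by (metis pr_p1_p2)
    have e: "pr a b = a + triangle (a + b)" by (simp add: prod_encode_def)
    show ?thesis using triangle_root[of a "a + b"] by (simp only: w_def z e p1_pr p2_pr le_add1) (simp add: e[symmetric])
  qed
  have 1: "p1 z = z - triangle (w z)" for z
    unfolding wz using arg_cong[OF pr_p1_p2[of z], of "\<lambda>y. y - triangle (p1 z + p2 z)"]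
    by (simp add: prod_encode_def)
  have 2: "p2 z = w z - p1 z" for z by (simp add: wz)
  show "ncomp 1 (\<lambda>xs. p1 (xs ! 0))"
    unfolding 1 by (intro ncomp_comp2[OF ncomp_diff2] ncomp_proj ncomp_comp1[OF ncomp_triangle] w) auto
  then show "ncomp 1 (\<lambda>xs. p2 (xs ! 0))"
    unfolding 2 by (intro ncomp_comp2[OF ncomp_diff2] w)
qed

text \<open>Arities matter only up to this point: from here on several arguments are paired into one
  and functions are unary.\<close>

lemma computable_iff_ncomp: "computable f \<longleftrightarrow> ncomp 1 (\<lambda>xs. f (xs ! 0))"
proof
  assume "computable f"
  then obtain r where r: "\<And>n. rec_eval r [n] (f n)" by (auto simp: computable_def)
  show "ncomp 1 (\<lambda>xs. f (xs ! 0))"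
    unfolding ncomp_def by (rule exI[of _ r]) (auto simp: length_Suc_conv r)
next
  assume "ncomp 1 (\<lambda>xs. f (xs ! 0))"
  then obtain r where r: "\<And>xs. length xs = 1 \<Longrightarrow> rec_eval r xs (f (xs ! 0))" by (auto simp: ncomp_def)
  show "computable f"
    unfolding computable_def using r[of "[_]"] by auto
qed

section \<open>Unary computable functions\<close>

named_theorems cpt

lemma computable_comp: "computable f \<Longrightarrow> computable g \<Longrightarrow> computable (\<lambda>x. f (g x))"
  unfolding computable_iff_ncomp by (rule ncomp_comp1)

lemma computable_id [cpt]: "computable (\<lambda>x. x)"
  unfolding computable_iff_ncomp by (rule ncomp_proj) simp

lemma computable_const [cpt]: "computable (\<lambda>x. c)"
  unfolding computable_iff_ncomp by (rule ncomp_const)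

lemma computable_Suc [cpt]: "computable f \<Longrightarrow> computable (\<lambda>x. Suc (f x))"
  unfolding computable_iff_ncomp by (rule ncomp_Suc)

lemma computable_add [cpt]: "computable f \<Longrightarrow> computable g \<Longrightarrow> computable (\<lambda>x. f x + g x)"
  unfolding computable_iff_ncomp by (rule ncomp_comp2[OF ncomp_add2])

lemma computable_mult [cpt]: "computable f \<Longrightarrow> computable g \<Longrightarrow> computable (\<lambda>x. f x * g x)"
  unfolding computable_iff_ncomp by (rule ncomp_comp2[OF ncomp_mult2])

lemma computable_diff [cpt]: "computable f \<Longrightarrow> computable g \<Longrightarrow> computable (\<lambda>x. f x - g x)"
  unfolding computable_iff_ncomp by (rule ncomp_comp2[OF ncomp_diff2])

lemma computable_pr [cpt]: "computable f \<Longrightarrow> computable g \<Longrightarrow> computable (\<lambda>x. pr (f x) (g x))"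
  unfolding computable_iff_ncomp by (rule ncomp_comp2[OF ncomp_pr])

lemma computable_p1 [cpt]: "computable f \<Longrightarrow> computable (\<lambda>x. p1 (f x))"
  unfolding computable_iff_ncomp by (rule ncomp_comp1[OF ncomp_p1_p2(1)])

lemma computable_p2 [cpt]: "computable f \<Longrightarrow> computable (\<lambda>x. p2 (f x))"
  unfolding computable_iff_ncomp by (rule ncomp_comp1[OF ncomp_p1_p2(2)])

text \<open>The variables bound by the recursion are paired with x, so that \<open>intro cpt\<close>
  can follow the syntax of a term below binders. Sums and bounded quantifiers are treated in the
  same way.\<close>

lemma computable_rec [cpt]:
  assumes f: "computable f" and g: "computable (\<lambda>z. g (p1 z) (p1 (p2 z)) (p2 (p2 z)))" and n: "computable n"
  shows "computable (\<lambda>x. rec_nat (f x) (\<lambda>i r. g i r x) (n x))"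
proof -
  define h where "h z = g (p1 z) (p1 (p2 z)) (p2 (p2 z))" for z
  have h: "ncomp 1 (\<lambda>xs. h (xs ! 0))" using g by (simp add: computable_iff_ncomp h_def)
  have "ncomp 3 (\<lambda>xs. h (pr (xs ! 0) (pr (xs ! 1) (xs ! 2))))"
    by (intro ncomp_comp1[OF h] ncomp_comp2[OF ncomp_pr] ncomp_proj) auto
  from ncomp_rec2[OF f[unfolded computable_iff_ncomp], of "\<lambda>i r x. h (pr i (pr r x))", OF this]
  have "ncomp 2 (\<lambda>xs. rec_nat (f (xs ! 1)) (\<lambda>i r. g i r (xs ! 1)) (xs ! 0))"
    by (simp add: h_def)
  from ncomp_comp2[OF this n[unfolded computable_iff_ncomp] ncomp_proj[of 0 1]]
  show ?thesis by (simp add: computable_iff_ncomp)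
qed

lemma computable_Least0:
  assumes "computable (\<lambda>z. f (p1 z) (p2 z))" "\<And>x. \<exists>n. f x n = 0"
  shows "computable (\<lambda>x. LEAST n. f x n = 0)"
proof -
  define h where "h z = f (p1 z) (p2 z)" for z
  have h: "ncomp 1 (\<lambda>xs. h (xs ! 0))" using assms by (simp add: computable_iff_ncomp h_def)
  have "ncomp 2 (\<lambda>xs. h (pr (xs ! 1) (xs ! 0)))"
    by (intro ncomp_comp1[OF h] ncomp_comp2[OF ncomp_pr] ncomp_proj) auto
  from ncomp_Least[of "\<lambda>n x. h (pr x n)", OF this] assms(2) show ?thesis
    by (simp add: h_def computable_iff_ncomp)
qed

section \<open>Decidable predicates\<close>

definition dec :: "(nat \<Rightarrow> bool) \<Rightarrow> bool" where
  "dec P \<longleftrightarrow> computable (\<lambda>x. of_bool (P x))"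

lemma dec_comp: "dec P \<Longrightarrow> computable g \<Longrightarrow> dec (\<lambda>x. P (g x))"
  unfolding dec_def by (rule computable_comp)

lemma dec_not [cpt]: "dec P \<Longrightarrow> dec (\<lambda>x. \<not> P x)"
proof -
  assume "dec P"
  then have "computable (\<lambda>x. 1 - of_bool (P x))"
    unfolding dec_def by (rule computable_diff[OF computable_const])
  moreover have "(\<lambda>x. 1 - of_bool (P x)) = (\<lambda>x. of_bool (\<not> P x) :: nat)" by auto
  ultimately show ?thesis by (simp only: dec_def)
qed

lemma dec_conj [cpt]: "dec P \<Longrightarrow> dec Q \<Longrightarrow> dec (\<lambda>x. P x \<and> Q x)"
  using computable_mult[of "\<lambda>x. of_bool (P x)" "\<lambda>x. of_bool (Q x)"] by (simp add: dec_def of_bool_conj)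

lemma dec_disj [cpt]: "dec P \<Longrightarrow> dec Q \<Longrightarrow> dec (\<lambda>x. P x \<or> Q x)"
  using dec_not[OF dec_conj[OF dec_not[of P] dec_not[of Q]]] by simp

lemma dec_eq0: "computable f \<Longrightarrow> dec (\<lambda>x. f x = 0)"
proof -
  assume "computable f"
  then have "computable (\<lambda>x. 1 - f x)" by (rule computable_diff[OF computable_const])
  moreover have "1 - f x = of_bool (f x = 0)" for x by (cases "f x") simp_all
  ultimately show ?thesis by (simp only: dec_def)
qed

lemma dec_le [cpt]: "computable f \<Longrightarrow> computable g \<Longrightarrow> dec (\<lambda>x. f x \<le> g x)"
  using dec_eq0[OF computable_diff[of f g]] by simp

lemma dec_less [cpt]: "computable f \<Longrightarrow> computable g \<Longrightarrow> dec (\<lambda>x. f x < g x)"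
  using dec_not[OF dec_le[of g f]] by (simp add: not_le)

lemma dec_eq [cpt]: "computable f \<Longrightarrow> computable g \<Longrightarrow> dec (\<lambda>x. f x = g x)"
  using dec_conj[OF dec_le[of f g] dec_le[of g f]] by (simp add: order_eq_iff)

lemma computable_if [cpt]:
  assumes "dec P" "computable f" "computable g"
  shows "computable (\<lambda>x. if P x then f x else g x)"
proof -
  have "computable (\<lambda>x. of_bool (P x) * f x + of_bool (\<not> P x) * g x)"
    by (intro computable_add computable_mult assms(2,3) assms(1)[unfolded dec_def]
        dec_not[OF assms(1), unfolded dec_def])
  moreover have "(\<lambda>x. of_bool (P x) * f x + of_bool (\<not> P x) * g x) = (\<lambda>x. if P x then f x else g x)"
    by auto
  ultimately show ?thesis by simp
qed

lemma computable_of_bool [cpt]: "dec P \<Longrightarrow> computable (\<lambda>x. of_bool (P x))"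
  by (simp add: dec_def)

lemma computable_Least:
  assumes "dec (\<lambda>z. P (p1 z) (p2 z))" "\<And>x. \<exists>n. P x n"
  shows "computable (\<lambda>x. LEAST n. P x n)"
proof -
  have "computable (\<lambda>x. LEAST n. of_bool (\<not> P x n) = (0::nat))"
    by (rule computable_Least0) (use assms dec_not[OF assms(1), unfolded dec_def] in auto)
  then show ?thesis by simp
qed

lemma computable_sum [cpt]:
  assumes "computable (\<lambda>z. f (p1 z) (p2 z))" "computable n"
  shows "computable (\<lambda>x. \<Sum>i<n x. f i x)"
proof -
  have "computable (\<lambda>z. f (p1 (pr (p1 z) (p2 (p2 z)))) (p2 (pr (p1 z) (p2 (p2 z)))))"
    by (intro computable_comp[OF assms(1)] cpt)
  then have "computable (\<lambda>x. rec_nat 0 (\<lambda>i r. r + f i x) (n x))"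
    by (intro cpt assms) simp
  moreover have "rec_nat 0 (\<lambda>i r. r + f i x) k = (\<Sum>i<k. f i x)" for k x
    by (induction k) auto
  ultimately show ?thesis by simp
qed

lemma dec_bex [cpt]:
  assumes "dec (\<lambda>z. P (p1 z) (p2 z))" "computable n"
  shows "dec (\<lambda>x. \<exists>i<n x. P i x)"
proof -
  have "dec (\<lambda>x. (\<Sum>i<n x. of_bool (P i x)) > (0::nat))"
    by (intro cpt assms) 
  moreover have "(\<Sum>i<k. of_bool (P i x)) > (0::nat) \<longleftrightarrow> (\<exists>i<k. P i x)" for k x
    by (induction k) (auto simp: less_Suc_eq)
  ultimately show ?thesis by simp
qed

lemma dec_ball [cpt]:
  assumes "dec (\<lambda>z. P (p1 z) (p2 z))" "computable n"
  shows "dec (\<lambda>x. \<forall>i<n x. P i x)"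
  using dec_not[OF dec_bex[OF dec_not[OF assms(1)] assms(2)]] by simp

lemma computable_power [cpt]:
  assumes "computable f" "computable g"
  shows "computable (\<lambda>x. f x ^ g x)"
proof -
  have "computable (\<lambda>x. rec_nat 1 (\<lambda>i r. f x * r) (g x))"
    by (intro cpt assms computable_comp[OF assms(1)])
  moreover have "rec_nat 1 (\<lambda>i r. f x * r) k = f x ^ k" for k x by (induction k) auto
  ultimately show ?thesis by simp
qed

text \<open>A successor as divisor makes the search for the quotient terminate;
  \<open>computable_div\<close> adds the divisor 0, for which HOL gives the value 0.\<close>

lemma div_eq_Least: "(a::nat) div Suc b = (LEAST q. a < Suc q * Suc b)"
proof (rule Least_equality[symmetric])
  show "a < Suc (a div Suc b) * Suc b"
    using dividend_less_div_times[of "Suc b" a] by (simp only: mult_Suc zero_less_Suc)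
  show "a div Suc b \<le> q" if "a < Suc q * Suc b" for q
    using less_mult_imp_div_less[OF that] by simp
qed

lemma computable_div_Suc [cpt]:
  assumes "computable f" "computable g"
  shows "computable (\<lambda>x. f x div Suc (g x))"
proof -
  have "computable (\<lambda>x. LEAST q. f x < Suc q * Suc (g x))"
  proof (rule computable_Least)
    show "\<exists>q. f x < Suc q * Suc (g x)" for x by (intro exI[of _ "f x"]) simp
  qed (intro cpt computable_comp[OF assms(1)] computable_comp[OF assms(2)])
  then show ?thesis by (simp only: div_eq_Least)
qed

lemma computable_div [cpt]:
  assumes "computable f" "computable g"
  shows "computable (\<lambda>x. f x div g x)"
proof -
  have "computable (\<lambda>x. if g x = 0 then 0 else f x div Suc (g x - 1))"
    by (intro cpt assms)
  moreover have "(if g x = 0 then 0 else f x div Suc (g x - 1)) = f x div g x" for x by simp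
  ultimately show ?thesis by simp
qed

lemma computable_mod [cpt]: "computable f \<Longrightarrow> computable g \<Longrightarrow> computable (\<lambda>x. f x mod g x)"
  unfolding modulo_nat_def by (intro cpt)

lemma dec_even [cpt]: "computable f \<Longrightarrow> dec (\<lambda>x. even (f x))"
  unfolding even_iff_mod_2_eq_zero by (intro cpt)

section \<open>Computably enumerable predicates\<close>

definition ce :: "(nat \<Rightarrow> bool) \<Rightarrow> bool" where
  "ce P \<longleftrightarrow> (\<exists>Q. dec Q \<and> (\<forall>x. P x \<longleftrightarrow> (\<exists>w. Q (pr x w))))"

lemma ce_dec [cpt]: "dec P \<Longrightarrow> ce P"
  unfolding ce_def by (rule exI[of _ "\<lambda>z. P (p1 z)"]) (auto intro!: dec_comp[of P] cpt)

lemma ce_ex: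
  assumes "ce (\<lambda>z. P (p1 z) (p2 z))" shows "ce (\<lambda>x. \<exists>y. P x y)"
proof -
  obtain Q where Q: "dec Q" "\<And>z. P (p1 z) (p2 z) \<longleftrightarrow> (\<exists>w. Q (pr z w))"
    using assms unfolding ce_def by auto
  have P: "P x y \<longleftrightarrow> (\<exists>w. Q (pr (pr x y) w))" for x y using Q(2)[of "pr x y"] by simp
  show ?thesis unfolding ce_def P
    by (intro exI[of _ "\<lambda>z. Q (pr (pr (p1 z) (p1 (p2 z))) (p2 (p2 z)))"] conjI
        dec_comp[OF Q(1)] cpt) (simp, metis p1_pr p2_pr)
qed

lemma ce_conj:
  assumes "ce P" "ce Q" shows "ce (\<lambda>x. P x \<and> Q x)"
proof -
  obtain P' where P: "dec P'" "\<And>x. P x \<longleftrightarrow> (\<exists>w. P' (pr x w))" using assms unfolding ce_def by auto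
  obtain Q' where Q: "dec Q'" "\<And>x. Q x \<longleftrightarrow> (\<exists>w. Q' (pr x w))" using assms unfolding ce_def by auto
  show ?thesis unfolding ce_def P Q
    by (intro exI[of _ "\<lambda>z. P' (pr (p1 z) (p1 (p2 z))) \<and> Q' (pr (p1 z) (p2 (p2 z)))"] conjI
        dec_comp[OF Q(1)] dec_comp[OF P(1)] dec_conj cpt) (simp, metis p1_pr p2_pr)
qed

lemma ce_disj:
  assumes "ce P" "ce Q" shows "ce (\<lambda>x. P x \<or> Q x)"
proof -
  obtain P' where P: "dec P'" "\<And>x. P x \<longleftrightarrow> (\<exists>w. P' (pr x w))" using assms unfolding ce_def by auto
  obtain Q' where Q: "dec Q'" "\<And>x. Q x \<longleftrightarrow> (\<exists>w. Q' (pr x w))" using assms unfolding ce_def by auto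
  show ?thesis unfolding ce_def P Q
    by (rule exI[of _ "\<lambda>z. P' z \<or> Q' z"]) (auto intro!: P Q dec_disj)
qed

text \<open>Finitely many witnesses have a common strict bound W; searching for W leaves only
  bounded quantifiers to decide.\<close>

lemma ce_ball:
  assumes "ce (\<lambda>z. P (p1 z) (p2 z))" "computable n"
  shows "ce (\<lambda>x. \<forall>i<n x. P i x)"
proof -
  obtain Q where Q: "dec Q" "\<And>z. P (p1 z) (p2 z) \<longleftrightarrow> (\<exists>w. Q (pr z w))"
    using assms unfolding ce_def by auto
  have P: "P i x \<longleftrightarrow> (\<exists>w. Q (pr (pr i x) w))" for x i using Q(2)[of "pr i x"] by simp
  have *: "(\<forall>i<n x. P i x) \<longleftrightarrow> (\<exists>W. \<forall>i<n x. \<exists>w<W. Q (pr (pr i x) w))" for x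
  proof
    assume "\<forall>i<n x. P i x"
    then have "\<forall>i. \<exists>w. i < n x \<longrightarrow> Q (pr (pr i x) w)" unfolding P by auto
    then obtain w where w: "\<And>i. i < n x \<Longrightarrow> Q (pr (pr i x) (w i))" by metis
    show "\<exists>W. \<forall>i<n x. \<exists>w<W. Q (pr (pr i x) w)"
    proof (intro exI allI impI conjI)
      fix i assume i: "i < n x"
      show "Q (pr (pr i x) (w i))" using w[OF i] .
      show "w i < Suc (\<Sum>i<n x. w i)" using i by (simp add: less_Suc_eq_le member_le_sum)
    qed
  qed (auto simp: P)
  have "dec (\<lambda>z. \<forall>i<n (p1 z). \<exists>w<p2 z. Q (pr (pr i (p1 z)) w))"
    by (intro cpt dec_comp[OF Q(1)] computable_comp[OF assms(2)])
  then show ?thesis unfolding ce_def *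
    by (intro exI[of _ "\<lambda>z. \<forall>i<n (p1 z). \<exists>w<p2 z. Q (pr (pr i (p1 z)) w)"]) auto
qed

lemma ce_comp: 
  assumes "ce P" "computable g" shows "ce (\<lambda>x. P (g x))"
proof -
  obtain P' where P: "dec P'" "\<And>x. P x \<longleftrightarrow> (\<exists>w. P' (pr x w))" using assms unfolding ce_def by auto
  show ?thesis unfolding ce_def P
    by (rule exI[of _ "\<lambda>z. P' (pr (g (p1 z)) (p2 z))"])
      (auto intro!: dec_comp[OF P(1)] cpt computable_comp[OF assms(2)])
qed

section \<open>A universal partial computable function\<close>

text \<open>Codes are those of \<open>list_encode\<close>: 0 for the empty list and
  \<open>Suc (pr x c)\<close> for a cons. Since \<open>p2 0 = 0\<close>, dropping from the empty
  list gives the empty list, as with \<open>drop\<close>.\<close>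

definition cdrop :: "nat \<Rightarrow> nat \<Rightarrow> nat" where
  "cdrop i c = rec_nat c (\<lambda>_ r. p2 (r - 1)) i"

definition chd :: "nat \<Rightarrow> nat" where
  "chd c = p1 (c - 1)"

text \<open>The bound on i is enough because the code of a list is at least its length.\<close>

definition cmem :: "nat \<Rightarrow> nat \<Rightarrow> bool" where
  "cmem c s \<longleftrightarrow> (\<exists>i<s. cdrop i s \<noteq> 0 \<and> chd (cdrop i s) = c)"

lemma computable_cdrop [cpt]: "computable f \<Longrightarrow> computable g \<Longrightarrow> computable (\<lambda>x. cdrop (f x) (g x))"
  unfolding cdrop_def by (intro cpt)

lemma computable_chd [cpt]: "computable f \<Longrightarrow> computable (\<lambda>x. chd (f x))"
  unfolding chd_def by (intro cpt)

lemma dec_cmem [cpt]: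
  assumes "computable f" "computable g"
  shows "dec (\<lambda>x. cmem (f x) (g x))"
  unfolding cmem_def by (intro cpt assms computable_comp[OF assms(1)] computable_comp[OF assms(2)])

lemma prod_decode_0: "prod_decode 0 = (0, 0)"
  using prod_encode_inverse[of "(0, 0)"] by (simp add: prod_encode_def)

lemma cdrop_0 [simp]: "cdrop 0 c = c" by (simp add: cdrop_def)

lemma cdrop_Suc: "cdrop (Suc i) c = p2 (cdrop i c - 1)" by (simp add: cdrop_def)

lemma cdrop_list_encode [simp]: "cdrop i (list_encode xs) = list_encode (drop i xs)"
proof (induction i)
  case (Suc i)
  have "drop (Suc i) xs = tl (drop i xs)" by (simp add: drop_Suc tl_drop)
  then show ?case
    by (cases "drop i xs") (simp_all add: cdrop_Suc Suc p2_def prod_decode_0)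
qed simp

lemma chd_Cons [simp]: "chd (Suc (pr x c)) = x" by (simp add: chd_def)

lemma list_encode_eq_0 [simp]: "list_encode xs = 0 \<longleftrightarrow> xs = []" by (cases xs) auto

lemma list_encode_gr_0 [simp]: "0 < list_encode xs \<longleftrightarrow> xs \<noteq> []" by (cases xs) auto

lemma chd_list_encode: "xs \<noteq> [] \<Longrightarrow> chd (list_encode xs) = hd xs" by (cases xs) auto

lemma length_le_list_encode: "length xs \<le> list_encode xs"
proof (induction xs)
  case (Cons x xs)
  then show ?case using le_prod_encode_2[of "list_encode xs" x] by simp
qed simp

lemma cmem_list_encode [simp]: "cmem c (list_encode xs) \<longleftrightarrow> c \<in> set xs"
proof
  assume "cmem c (list_encode xs)"
  then obtain i where "i < length xs" "hd (drop i xs) = c"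
    by (auto simp: cmem_def chd_list_encode) (metis not_le)
  then show "c \<in> set xs" by (auto simp: hd_drop_conv_nth)
next
  assume "c \<in> set xs"
  then obtain i where "i < length xs" "xs ! i = c" by (auto simp: in_set_conv_nth)
  then show "cmem c (list_encode xs)"
    using length_le_list_encode[of xs] unfolding cmem_def
    by (intro exI[of _ i]) (auto simp: chd_list_encode hd_drop_conv_nth)
qed

text \<open>
  A judgement \<open>rec_eval f xs y\<close> is coded by \<open>pr F (pr X y)\<close>, with \<open>F\<close> and \<open>X\<close> codes of \<open>f\<close> and \<open>xs\<close>.
  Here \<open>c\<close> follows by one rule from the judgements in the list coded by \<open>s\<close>.
\<close>

definition deriv_step :: "nat \<Rightarrow> nat \<Rightarrow> bool" where
  "deriv_step s c \<longleftrightarrow> (let F = p1 c; X = p1 (p2 c); y = p2 (p2 c); a = p1 (p2 F); b = p2 (p2 F) in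
     p1 F = 0 \<and> y = 0
   \<or> p1 F = 1 \<and> X \<noteq> 0 \<and> cdrop 1 X = 0 \<and> y = Suc (chd X)
   \<or> p1 F = 2 \<and> cdrop (p2 F) X \<noteq> 0 \<and> y = chd (cdrop (p2 F) X)
   \<or> p1 F = 3 \<and> (\<exists>Y. cmem (pr a (pr Y y)) s \<and>
        (\<forall>i<b + Y. (cdrop i b = 0 \<and> cdrop i Y = 0) \<or> (cdrop i b \<noteq> 0 \<and> cdrop i Y \<noteq> 0 \<and>
            cmem (pr (chd (cdrop i b)) (pr X (chd (cdrop i Y)))) s)))
   \<or> p1 F = 4 \<and> X \<noteq> 0 \<and> chd X = 0 \<and> cmem (pr a (pr (cdrop 1 X) y)) s
   \<or> p1 F = 4 \<and> X \<noteq> 0 \<and> chd X \<noteq> 0 \<and>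
        (\<exists>r. cmem (pr F (pr (Suc (pr (chd X - 1) (cdrop 1 X))) r)) s \<and>
             cmem (pr b (pr (Suc (pr (chd X - 1) (Suc (pr r (cdrop 1 X))))) y)) s)
   \<or> p1 F = 5 \<and> cmem (pr (p2 F) (pr (Suc (pr y X)) 0)) s \<and>
        (\<forall>m<y. \<exists>k. cmem (pr (p2 F) (pr (Suc (pr m X)) (Suc k))) s))"

text \<open>Derivations grow at the head, so each entry has to follow from the entries behind
  it.\<close>

definition valid_deriv :: "nat \<Rightarrow> bool" where
  "valid_deriv s \<longleftrightarrow> (\<forall>i<s. cdrop i s = 0 \<or> deriv_step (cdrop (Suc i) s) (chd (cdrop i s)))"

text \<open>The quantifiers over Y, r and k are unbounded, which gives enumerability instead of
  decidability. That is enough: \<open>universal_computable\<close> passes to the decidable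
  matrix.\<close>

lemma ce_deriv_step: "ce (\<lambda>z. deriv_step (p1 z) (p2 z))"
  unfolding deriv_step_def Let_def
  by (intro ce_disj ce_conj ce_ex ce_ball cpt)

lemma ce_valid_deriv: "ce valid_deriv"
proof -
  have "ce (\<lambda>z. deriv_step (p1 (pr (cdrop (Suc (p1 z)) (p2 z)) (chd (cdrop (p1 z) (p2 z)))))
     (p2 (pr (cdrop (Suc (p1 z)) (p2 z)) (chd (cdrop (p1 z) (p2 z))))))"
    by (intro ce_comp[OF ce_deriv_step] cpt)
  then have *: "ce (\<lambda>z. deriv_step (cdrop (Suc (p1 z)) (p2 z)) (chd (cdrop (p1 z) (p2 z))))"
    by simp
  have "dec (\<lambda>z. cdrop (p1 z) (p2 z) = 0)" by (intro cpt)
  from ce_disj[OF ce_dec[OF this] *] show ?thesis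
    unfolding valid_deriv_def by (rule ce_ball) (rule computable_id)
qed

fun valid_list :: "nat list \<Rightarrow> bool" where
  "valid_list [] \<longleftrightarrow> True"
| "valid_list (c # xs) \<longleftrightarrow> deriv_step (list_encode xs) c \<and> valid_list xs"

lemma valid_list_iff_nth:
  "valid_list xs \<longleftrightarrow> (\<forall>i<length xs. deriv_step (list_encode (drop (Suc i) xs)) (xs ! i))"
  by (induction xs) (auto simp: All_less_Suc2)

lemma valid_deriv_list_encode: "valid_deriv (list_encode xs) \<longleftrightarrow> valid_list xs"
proof
  assume v: "valid_deriv (list_encode xs)"
  show "valid_list xs" unfolding valid_list_iff_nth
  proof (intro allI impI)
    fix i assume i: "i < length xs"
    with length_le_list_encode[of xs] have "i < list_encode xs" by simp
    with v i show "deriv_step (list_encode (drop (Suc i) xs)) (xs ! i)"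
      by (auto simp: valid_deriv_def chd_list_encode hd_drop_conv_nth)
  qed
next
  assume v: "valid_list xs"
  show "valid_deriv (list_encode xs)" unfolding valid_deriv_def
  proof (intro allI impI)
    fix i
    show "cdrop i (list_encode xs) = 0 \<or>
         deriv_step (cdrop (Suc i) (list_encode xs)) (chd (cdrop i (list_encode xs)))"
      using v by (cases "i < length xs")
        (auto simp: valid_list_iff_nth chd_list_encode hd_drop_conv_nth)
  qed
qed

text \<open>\<open>cmem\<close> occurs only positively in \<open>deriv_step\<close>. This lets
  derivations of several premises be concatenated.\<close>

lemma deriv_step_mono:
  assumes "deriv_step (list_encode xs) c" "set xs \<subseteq> set ys"
  shows "deriv_step (list_encode ys) c"
proof -
  have sub: "c \<in> set xs \<longrightarrow> c \<in> set ys" for c using assms(2) by blast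
  have "deriv_step (list_encode xs) c \<longrightarrow> deriv_step (list_encode ys) c"
    unfolding deriv_step_def Let_def cmem_list_encode
    by (intro disj_mono conj_mono ex_mono all_mono imp_mono sub imp_refl)
  with assms(1) show ?thesis by blast
qed

lemma valid_list_append: "valid_list xs \<Longrightarrow> valid_list ys \<Longrightarrow> valid_list (xs @ ys)"
  by (induction xs) (auto elim: deriv_step_mono)

lemma valid_list_finite_union:
  assumes "finite A" "\<And>c. c \<in> A \<Longrightarrow> \<exists>xs. valid_list xs \<and> c \<in> set xs"
  shows "\<exists>xs. valid_list xs \<and> A \<subseteq> set xs"
  using assms
proof (induction A rule: finite_induct)
  case empty
  then show ?case by (intro exI[of _ "[]"]) simp
next
  case (insert c A)
  then obtain xs ys where "valid_list xs" "c \<in> set xs" "valid_list ys" "A \<subseteq> set ys"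
    by (metis insertCI)
  then show ?case by (intro exI[of _ "xs @ ys"]) (auto intro: valid_list_append)
qed

section \<open>Completeness of coded derivations\<close>

primrec recf_code :: "recf \<Rightarrow> nat" where
  "recf_code Zero = pr 0 0"
| "recf_code Succ = pr 1 0"
| "recf_code (Proj i) = pr 2 i"
| "recf_code (Comp f gs) = pr 3 (pr (recf_code f) (list_encode (map recf_code gs)))"
| "recf_code (Prec f g) = pr 4 (pr (recf_code f) (recf_code g))"
| "recf_code (Mu f) = pr 5 (recf_code f)"

abbreviation judgement :: "recf \<Rightarrow> nat list \<Rightarrow> nat \<Rightarrow> nat" where
  "judgement f xs y \<equiv> pr (recf_code f) (pr (list_encode xs) y)"

text \<open>Concatenate the derivations of the premises and put the conclusion at the head.\<close>

lemma valid_list_complete: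
  "rec_eval f xs y \<Longrightarrow> \<exists>ds. valid_list ds \<and> judgement f xs y \<in> set ds"
proof (induction rule: rec_eval.induct)
  case (zero xs)
  show ?case by (intro exI[of _ "[judgement Zero xs 0]"]) (simp add: deriv_step_def)
next
  case (succ x)
  have "cdrop 1 (list_encode [x]) = 0" by (subst cdrop_list_encode) simp
  then show ?case by (intro exI[of _ "[judgement Succ [x] (Suc x)]"]) (simp add: deriv_step_def)
next
  case (proj i xs)
  then show ?case
    by (intro exI[of _ "[judgement (Proj i) xs (xs ! i)]"])
      (simp add: deriv_step_def chd_list_encode hd_drop_conv_nth)
next
  case (comp xs gs ys f z)
  let ?A = "insert (judgement f ys z) (set (map2 (\<lambda>g y. judgement g xs y) gs ys))"
  have "\<exists>ds. valid_list ds \<and> ?A \<subseteq> set ds"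
  proof (rule valid_list_finite_union)
    fix c assume "c \<in> ?A"
    then show "\<exists>ds. valid_list ds \<and> c \<in> set ds"
      using comp.IH by (auto simp: list_all2_iff)
  qed simp
  then obtain ds where ds: "valid_list ds" "?A \<subseteq> set ds" by auto
  have len: "length gs = length ys" using comp.IH(1) by (rule list_all2_lengthD)
  have nth: "judgement (gs ! i) xs (ys ! i) \<in> set ds" if "i < length ys" for i
    using that ds(2) len by (force simp: set_zip)
  have "deriv_step (list_encode ds) (judgement (Comp f gs) xs z)"
    unfolding deriv_step_def Let_def
    using ds(2) nth len
    by (auto intro!: exI[of _ "list_encode ys"] simp: chd_list_encode hd_drop_conv_nth)
  with ds show ?case
    by (intro exI[of _ "judgement (Comp f gs) xs z # ds"]) simp
next
  case (prec_0 f xs y g)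
  then obtain ds where ds: "valid_list ds" "judgement f xs y \<in> set ds" by auto
  have "cdrop 1 (list_encode (0 # xs)) = list_encode xs" by (subst cdrop_list_encode) simp
  then have "deriv_step (list_encode ds) (judgement (Prec f g) (0 # xs) y)"
    using ds(2) by (simp add: deriv_step_def)
  with ds show ?case
    by (intro exI[of _ "judgement (Prec f g) (0 # xs) y # ds"]) simp
next
  case (prec_Suc f g n xs r y)
  then obtain ds es where ds: "valid_list ds" "judgement (Prec f g) (n # xs) r \<in> set ds"
    "valid_list es" "judgement g (n # r # xs) y \<in> set es" by auto
  have "cdrop 1 (list_encode (Suc n # xs)) = list_encode xs" by (subst cdrop_list_encode) simp
  then have "deriv_step (list_encode (ds @ es)) (judgement (Prec f g) (Suc n # xs) y)"
    using ds(2,4) by (auto simp: deriv_step_def Let_def)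
  with ds show ?case
    by (intro exI[of _ "judgement (Prec f g) (Suc n # xs) y # ds @ es"])
      (simp add: valid_list_append)
next
  case (mu f n xs)
  then obtain k where k: "\<And>m. m < n \<Longrightarrow> \<exists>ds. valid_list ds \<and> judgement f (m # xs) (Suc (k m)) \<in> set ds"
    by metis
  let ?A = "insert (judgement f (n # xs) 0) ((\<lambda>m. judgement f (m # xs) (Suc (k m))) ` {..<n})"
  have "\<exists>ds. valid_list ds \<and> ?A \<subseteq> set ds"
    by (rule valid_list_finite_union) (use k mu.IH(1) in auto)
  then obtain ds where ds: "valid_list ds" "?A \<subseteq> set ds" by auto
  then have "deriv_step (list_encode ds) (judgement (Mu f) xs n)"
    by (auto simp: deriv_step_def)
  with ds show ?case
    by (intro exI[of _ "judgement (Mu f) xs n # ds"]) simp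
qed

section \<open>Soundness of coded derivations\<close>

lemma p1_le: "p1 z \<le> z" and p2_le: "p2 z \<le> z"
  using le_prod_encode_1[of "p1 z" "p2 z"] le_prod_encode_2[of "p2 z" "p1 z"] by simp_all

lemma p2_less: "p1 z \<noteq> 0 \<Longrightarrow> p2 z < z"
  using le_triangle[of "p1 z + p2 z"] arg_cong[OF pr_p1_p2[of z], of "\<lambda>x. x"]
  by (simp add: prod_encode_def del: pr_p1_p2)

lemma list_decode_less: "x \<in> set (list_decode c) \<Longrightarrow> x < c"
proof (induction c rule: list_decode.induct)
  case (2 n)
  obtain a b where ab: "prod_decode n = (a, b)" by force
  then have n: "n = pr a b" by (metis prod_decode_inverse)
  then have "a \<le> n" "b \<le> n" using le_prod_encode_1 le_prod_encode_2 by auto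
  with 2 ab show ?case by (auto split: prod.splits)
qed simp

text \<open>Soundness is stated through a decoding because entries of a valid derivation need not be
  codes made by \<open>judgement\<close>. A tag above 5 decodes to \<open>Mu\<close>, but no rule of
  \<open>deriv_step\<close> applies to it.\<close>

function decode_recf :: "nat \<Rightarrow> recf" where
  "decode_recf F = (if p1 F = 0 then Zero else if p1 F = 1 then Succ
     else if p1 F = 2 then Proj (p2 F)
     else if p1 F = 3 then Comp (decode_recf (p1 (p2 F))) (map decode_recf (list_decode (p2 (p2 F))))
     else if p1 F = 4 then Prec (decode_recf (p1 (p2 F))) (decode_recf (p2 (p2 F)))
     else Mu (decode_recf (p2 F)))"
  by auto
termination
proof (relation "Wellfounded.measure id")
  have *: "p1 (p2 F) < F" "p2 (p2 F) < F" "p2 F < F" if "p1 F \<noteq> 0" for F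
    using p2_less[OF that] p1_le[of "p2 F"] p2_le[of "p2 F"] by auto
  fix F
  show "p1 F \<noteq> 0 \<Longrightarrow> (p1 (p2 F), F) \<in> Wellfounded.measure id"
    and "p1 F \<noteq> 0 \<Longrightarrow> (p1 (p2 F), F) \<in> Wellfounded.measure id"
    and "p1 F \<noteq> 0 \<Longrightarrow> (p2 (p2 F), F) \<in> Wellfounded.measure id"
    and "p1 F \<noteq> 0 \<Longrightarrow> (p2 F, F) \<in> Wellfounded.measure id"
    using * by auto
  fix z assume "p1 F \<noteq> 0" "z \<in> set (list_decode (p2 (p2 F)))"
  then show "(z, F) \<in> Wellfounded.measure id" using *[of F] list_decode_less[of z "p2 (p2 F)"] by auto
qed auto

declare decode_recf.simps [simp del]

lemma list_decode_neq_Nil: "X \<noteq> 0 \<Longrightarrow> list_decode X = chd X # list_decode (cdrop 1 X)"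
  by (cases X) (auto simp: chd_def cdrop_Suc p1_def p2_def split: prod.splits)

lemma deriv_step_sound:
  assumes "deriv_step (list_encode xs) (pr F (pr X y))"
    and IH: "\<And>F X y. pr F (pr X y) \<in> set xs \<Longrightarrow> rec_eval (decode_recf F) (list_decode X) y"
  shows "rec_eval (decode_recf F) (list_decode X) y"
proof -
  define a where "a = p1 (p2 F)"
  define b where "b = p2 (p2 F)"
  consider (zero) "p1 F = 0" "y = 0"
    | (succ) "p1 F = 1" "X \<noteq> 0" "cdrop 1 X = 0" "y = Suc (chd X)"
    | (proj) "p1 F = 2" "cdrop (p2 F) X \<noteq> 0" "y = chd (cdrop (p2 F) X)"
    | (comp) Y where "p1 F = 3" "pr a (pr Y y) \<in> set xs"
        "\<And>i. i < b + Y \<Longrightarrow> (cdrop i b = 0 \<and> cdrop i Y = 0) \<or> (cdrop i b \<noteq> 0 \<and> cdrop i Y \<noteq> 0 \<and>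
            pr (chd (cdrop i b)) (pr X (chd (cdrop i Y))) \<in> set xs)"
    | (prec_0) "p1 F = 4" "X \<noteq> 0" "chd X = 0" "pr a (pr (cdrop 1 X) y) \<in> set xs"
    | (prec_Suc) r where "p1 F = 4" "X \<noteq> 0" "chd X \<noteq> 0"
        "pr F (pr (Suc (pr (chd X - 1) (cdrop 1 X))) r) \<in> set xs"
        "pr b (pr (Suc (pr (chd X - 1) (Suc (pr r (cdrop 1 X))))) y) \<in> set xs"
    | (mu) "p1 F = 5" "pr (p2 F) (pr (Suc (pr y X)) 0) \<in> set xs"
        "\<And>m. m < y \<Longrightarrow> \<exists>k. pr (p2 F) (pr (Suc (pr m X)) (Suc k)) \<in> set xs"
    using assms(1) unfolding deriv_step_def Let_def p1_pr p2_pr cmem_list_encode a_def[symmetric] b_def[symmetric]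
    by (elim disjE exE conjE) blast+
  then show ?thesis
  proof cases
    case zero
    then show ?thesis by (simp add: decode_recf.simps[of F] rec_eval.zero)
  next
    case succ
    then have "list_decode X = [chd X]" by (simp add: list_decode_neq_Nil)
    with succ show ?thesis by (simp add: decode_recf.simps[of F] rec_eval.succ)
  next
    case proj
    define zs where "zs = list_decode X"
    have X: "X = list_encode zs" by (simp add: zs_def)
    have "p2 F < length zs" "y = zs ! p2 F"
      using proj by (auto simp: X chd_list_encode hd_drop_conv_nth)
    then have "rec_eval (Proj (p2 F)) zs y" using rec_eval.proj by simp
    with proj show ?thesis by (simp add: decode_recf.simps[of F] X)
  next
    case comp
    define ys where "ys = list_decode Y"
    have Y: "Y = list_encode ys" by (simp add: ys_def)
    define gs where "gs = list_decode b"
    have b: "b = list_encode gs" by (simp add: gs_def)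
    have nth: "i < length gs \<and> i < length ys \<and> pr (gs ! i) (pr X (ys ! i)) \<in> set xs"
      if "i < length gs \<or> i < length ys" for i
    proof -
      have "i < b + Y" using that length_le_list_encode[of gs] length_le_list_encode[of ys]
        by (auto simp: b Y)
      from comp(3)[OF this] that show ?thesis
        by (auto simp: b Y chd_list_encode hd_drop_conv_nth)
    qed
    \<comment> \<open>At an index inside exactly one of the two lists the rule would fail, and the
      range \<open>b + Y\<close> of its quantifier covers both lists.\<close>
    have "length gs = length ys"
      using nth[of "length gs"] nth[of "length ys"] by (meson less_irrefl linorder_neqE_nat)
    then have "list_all2 (\<lambda>g y. rec_eval g (list_decode X) y) (map decode_recf gs) ys"
      using nth by (auto simp: list_all2_conv_all_nth intro!: IH)
    then have "rec_eval (Comp (decode_recf a) (map decode_recf gs)) (list_decode X) y"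
      using IH[OF comp(2)] by (auto simp: Y intro: rec_eval.comp)
    with comp(1) show ?thesis by (simp add: decode_recf.simps[of F] gs_def a_def b_def)
  next
    case prec_0
    then show ?thesis using IH[OF prec_0(4)]
      by (simp add: decode_recf.simps[of F] list_decode_neq_Nil a_def rec_eval.prec_0)
  next
    case prec_Suc
    have D: "decode_recf F = Prec (decode_recf a) (decode_recf b)"
      using prec_Suc(1) by (simp add: decode_recf.simps[of F] a_def b_def)
    have "rec_eval (Prec (decode_recf a) (decode_recf b)) (Suc (chd X - 1) # list_decode (cdrop 1 X)) y"
      using IH[OF prec_Suc(4)] IH[OF prec_Suc(5)] by (intro rec_eval.prec_Suc) (simp_all add: D)
    then show ?thesis using prec_Suc(2,3) by (simp add: D list_decode_neq_Nil)
  next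
    case mu
    have "rec_eval (Mu (decode_recf (p2 F))) (list_decode X) y"
    proof (rule rec_eval.mu)
      show "rec_eval (decode_recf (p2 F)) (y # list_decode X) 0" using IH[OF mu(2)] by simp
      show "\<forall>m<y. \<exists>k. rec_eval (decode_recf (p2 F)) (m # list_decode X) (Suc k)"
        using mu(3) IH[of "p2 F"] by fastforce
    qed
    with mu(1) show ?thesis by (simp add: decode_recf.simps[of F])
  qed
qed

lemma valid_list_sound:
  "valid_list xs \<Longrightarrow> pr F (pr X y) \<in> set xs \<Longrightarrow> rec_eval (decode_recf F) (list_decode X) y"
proof (induction xs arbitrary: F X y)
  case (Cons c xs)
  then show ?case by (auto intro: deriv_step_sound)
qed simp

text \<open>A normal form theorem: e is the code of a program and w certifies that a derivation of
  the value y exists. \<open>Q\<close> is decidable so that it can steer a computable sequence of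
  intervals; uniqueness of y, from \<open>rec_eval_deterministic\<close>, later limits each program
  to one interval per component of the test.\<close>

lemma universal_computable:
  obtains Q where "dec Q"
    and "\<And>e n y w y' w'. Q (pr e (pr n (pr y w))) \<Longrightarrow> Q (pr e (pr n (pr y' w'))) \<Longrightarrow> y = y'"
    and "\<And>h. computable h \<Longrightarrow> \<exists>e. \<forall>n. \<exists>w. Q (pr e (pr n (pr (h n) w)))"
proof -
  let ?P = "\<lambda>e n y s. valid_deriv s \<and> cmem (pr e (pr (Suc (pr n 0)) y)) s"
  have "ce (\<lambda>z. \<exists>s. ?P (p1 z) (p1 (p2 z)) (p2 (p2 z)) s)"
    by (intro ce_ex ce_conj ce_comp[OF ce_valid_deriv] cpt)
  then obtain R where R: "dec R"
    "\<And>z. (\<exists>s. ?P (p1 z) (p1 (p2 z)) (p2 (p2 z)) s) \<longleftrightarrow> (\<exists>w. R (pr z w))"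
    unfolding ce_def by blast
  have R': "(\<exists>s. ?P e n y s) \<longleftrightarrow> (\<exists>w. R (pr (pr e (pr n y)) w))" for e n y
    using R(2)[of "pr e (pr n y)"] by simp
  define Q where "Q z = R (pr (pr (p1 z) (pr (p1 (p2 z)) (p1 (p2 (p2 z))))) (p2 (p2 (p2 z))))" for z
  have ev: "rec_eval (decode_recf e) [n] y" if "R (pr (pr e (pr n y)) w)" for e n y w
  proof -
    have "\<exists>s. ?P e n y s" unfolding R' using that by (rule exI)
    then obtain s where s: "?P e n y s" by (elim exE)
    then show ?thesis
      using valid_list_sound[of "list_decode s" e "list_encode [n]" y]
        valid_deriv_list_encode[of "list_decode s"] cmem_list_encode[of _ "list_decode s"]
      by simp
  qed
  show thesis
  proof (rule that[of Q])
    show "dec Q" unfolding Q_def by (intro dec_comp[OF R(1)] cpt)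
  next
    fix e n y w y' w' assume "Q (pr e (pr n (pr y w)))" "Q (pr e (pr n (pr y' w')))"
    then show "y = y'" unfolding Q_def using ev rec_eval_deterministic by simp blast
  next
    fix h assume "computable h"
    then obtain f where f: "\<And>n. rec_eval f [n] (h n)" by (auto simp: computable_def)
    have "\<exists>w. R (pr (pr (recf_code f) (pr n (h n))) w)" for n
    proof -
      obtain ds where "valid_list ds" "judgement f [n] (h n) \<in> set ds"
        using valid_list_complete[OF f] by blast
      then have "?P (recf_code f) n (h n) (list_encode ds)"
        by (simp add: valid_deriv_list_encode)
      then show ?thesis using R' by blast
    qed
    then show "\<exists>e. \<forall>n. \<exists>w. Q (pr e (pr n (pr (h n) w)))"
      unfolding Q_def by (intro exI[of _ "recf_code f"]) simp
  qed
qed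

section \<open>Uniformly computable sequences of reals\<close>

text \<open>Dyadic approximations keep sums and scaling by powers of 2 simple; their integer
  numerators are differences of naturals, so that only functions on naturals occur.\<close>

definition creal :: "(nat \<Rightarrow> real) \<Rightarrow> bool" where
  "creal r \<longleftrightarrow> (\<exists>A B. computable A \<and> computable B \<and>
     (\<forall>x n. \<bar>r x - (real (A (pr x n)) - real (B (pr x n))) / 2 ^ n\<bar> \<le> 1 / 2 ^ n))"

text \<open>Adding half of the divisor first turns the floor into rounding to the nearest
  integer.\<close>

lemma round_div_power2:
  "\<bar>real ((a + 2 ^ c) div 2 ^ Suc c) - real a / 2 ^ Suc c\<bar> \<le> 1 / 2"
proof -
  define q where "q = (a + 2 ^ c) div 2 ^ Suc c"
  have "q * 2 ^ Suc c \<le> a + 2 ^ c" "a + 2 ^ c < 2 ^ Suc c + q * 2 ^ Suc c"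
    unfolding q_def using dividend_less_div_times[of "2 ^ Suc c" "a + 2 ^ c"] by simp_all
  then have "real (q * 2 ^ Suc c) \<le> real (a + 2 ^ c)" "real (a + 2 ^ c) < real (2 ^ Suc c + q * 2 ^ Suc c)"
    by (simp_all only: of_nat_le_iff of_nat_less_iff)
  then have "\<bar>real q * 2 ^ Suc c - real a\<bar> \<le> 2 ^ c" by simp
  then have "\<bar>real q * 2 ^ Suc c - real a\<bar> / 2 ^ Suc c \<le> 2 ^ c / 2 ^ Suc c"
    by (rule divide_right_mono) simp
  moreover have "\<bar>real q * 2 ^ Suc c - real a\<bar> / 2 ^ Suc c = \<bar>real q - real a / 2 ^ Suc c\<bar>"
    by (simp add: abs_if field_simps)
  moreover have "2 ^ c / 2 ^ Suc c = (1 / 2 :: real)" by simp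
  ultimately show ?thesis by (simp only: q_def)
qed

lemma abs_diff_dyadic_rescale:
  fixes r a :: real
  shows "\<bar>r - a / 2 ^ Suc c\<bar> / 2 ^ n = \<bar>r / 2 ^ n - a / 2 ^ (Suc n + c)\<bar>"
    and "\<bar>2 ^ c * r - a / 2 ^ n\<bar> = 2 ^ c * \<bar>r - a / 2 ^ (n + c)\<bar>"
    and "\<bar>r / 2 ^ c - a / 2 ^ (n + c)\<bar> = \<bar>r - a / 2 ^ n\<bar> / 2 ^ c"
proof -
  have "r / 2 ^ n - a / 2 ^ (Suc n + c) = (r - a / 2 ^ Suc c) / 2 ^ n"
    by (simp add: diff_divide_distrib power_add mult_ac)
  then show "\<bar>r - a / 2 ^ Suc c\<bar> / 2 ^ n = \<bar>r / 2 ^ n - a / 2 ^ (Suc n + c)\<bar>"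
    by (simp only: abs_divide) simp
  have "2 ^ c * r - a / 2 ^ n = 2 ^ c * (r - a / 2 ^ (n + c))"
    by (simp add: right_diff_distrib power_add)
  then show "\<bar>2 ^ c * r - a / 2 ^ n\<bar> = 2 ^ c * \<bar>r - a / 2 ^ (n + c)\<bar>"
    by (simp only: abs_mult) simp
  have "r / 2 ^ c - a / 2 ^ (n + c) = (r - a / 2 ^ n) / 2 ^ c"
    by (simp add: diff_divide_distrib power_add)
  then show "\<bar>r / 2 ^ c - a / 2 ^ (n + c)\<bar> = \<bar>r - a / 2 ^ n\<bar> / 2 ^ c"
    by (simp only: abs_divide) simp
qed

text \<open>Approximations on a finer grid can be rounded to the grid of mesh 2^-n: the given error
  and the rounding error are at most 2^-(n+1) each. The closure properties for sums, scaling, maxima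
  and limits rest on this.\<close>

lemma creal_I:
  assumes A: "computable A" and B: "computable B" and c: "computable c"
    and err: "\<And>x n. \<bar>r x - (real (A (pr x n)) - real (B (pr x n))) / 2 ^ (Suc n + c (pr x n))\<bar> \<le> 1 / 2 ^ Suc n"
  shows "creal r"
proof -
  define A' where "A' z = (A z - B z + 2 ^ c z) div 2 ^ Suc (c z)" for z
  define B' where "B' z = (B z - A z + 2 ^ c z) div 2 ^ Suc (c z)" for z
  have "\<bar>r x - (real (A' (pr x n)) - real (B' (pr x n))) / 2 ^ n\<bar> \<le> 1 / 2 ^ n" for x n
  proof -
    let ?z = "pr x n"
    let ?a = "real (A ?z) - real (B ?z)"
    \<comment> \<open>Truncated subtraction makes one of the two differences 0, and it is rounded to
      0, so only one rounding error occurs.\<close>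
    have z: "(2 ^ c ?z :: nat) div 2 ^ Suc (c ?z) = 0" by simp
    have "\<bar>(real (A' ?z) - real (B' ?z)) - ?a / 2 ^ Suc (c ?z)\<bar> \<le> 1 / 2"
    proof (cases "B ?z \<le> A ?z")
      case True
      then have "B' ?z = 0" by (simp add: B'_def z)
      with True show ?thesis
        using round_div_power2[of "A ?z - B ?z" "c ?z"] by (simp add: A'_def of_nat_diff)
    next
      case False
      then have "A' ?z = 0" by (simp add: A'_def z)
      moreover have "\<bar>real (B' ?z) - (- ?a) / 2 ^ Suc (c ?z)\<bar> \<le> 1 / 2"
        using False round_div_power2[of "B ?z - A ?z" "c ?z"] by (simp add: B'_def of_nat_diff)
      ultimately show ?thesis by (simp add: abs_if field_simps split: if_splits)
    qed
    then have "\<bar>(real (A' ?z) - real (B' ?z)) - ?a / 2 ^ Suc (c ?z)\<bar> / 2 ^ n \<le> (1 / 2) / 2 ^ n"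
      by (rule divide_right_mono) simp
    moreover have "\<bar>(real (A' ?z) - real (B' ?z)) - ?a / 2 ^ Suc (c ?z)\<bar> / 2 ^ n
        = \<bar>(real (A' ?z) - real (B' ?z)) / 2 ^ n - ?a / 2 ^ (Suc n + c ?z)\<bar>"
      by (rule abs_diff_dyadic_rescale)
    ultimately show ?thesis using err[of x n] by simp
  qed
  moreover have "computable A'" "computable B'"
    unfolding A'_def B'_def by (intro cpt A B c)+
  ultimately show ?thesis unfolding creal_def by blast
qed

lemma creal_E:
  assumes "creal r"
  obtains A B where "computable A" "computable B"
    "\<And>x n. \<bar>r x - (real (A (pr x n)) - real (B (pr x n))) / 2 ^ n\<bar> \<le> 1 / 2 ^ n"
  using assms unfolding creal_def by blast

named_theorems crl

lemma creal_comp: 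
  assumes "creal r" "computable f" shows "creal (\<lambda>x. r (f x))"
proof -
  obtain A B where AB: "computable A" "computable B"
    "\<And>x n. \<bar>r x - (real (A (pr x n)) - real (B (pr x n))) / 2 ^ n\<bar> \<le> 1 / 2 ^ n"
    using creal_E[OF assms(1)] by blast
  have "computable (\<lambda>z. A (pr (f (p1 z)) (p2 z)))" "computable (\<lambda>z. B (pr (f (p1 z)) (p2 z)))"
    by (intro computable_comp[OF AB(1)] computable_comp[OF AB(2)] computable_comp[OF assms(2)] cpt)+
  then show ?thesis
    unfolding creal_def
    by (intro exI[of _ "\<lambda>z. A (pr (f (p1 z)) (p2 z))"] exI[of _ "\<lambda>z. B (pr (f (p1 z)) (p2 z))"])
      (simp add: AB(3))
qed

lemma creal_of_nat [crl]: assumes "computable f" shows "creal (\<lambda>x. real (f x))"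
proof (rule creal_I[of "\<lambda>z. f (p1 z) * 2 ^ Suc (p2 z)" "\<lambda>_. 0" "\<lambda>_. 0"])
  show "computable (\<lambda>z. f (p1 z) * 2 ^ Suc (p2 z))"
    by (intro cpt computable_comp[OF assms])
qed (intro cpt | simp)+

lemma creal_add [crl]:
  assumes "creal r" "creal s" shows "creal (\<lambda>x. r x + s x)"
proof -
  obtain A B where AB: "computable A" "computable B"
    "\<And>x n. \<bar>r x - (real (A (pr x n)) - real (B (pr x n))) / 2 ^ n\<bar> \<le> 1 / 2 ^ n"
    using creal_E[OF assms(1)] by blast
  obtain C D where CD: "computable C" "computable D"
    "\<And>x n. \<bar>s x - (real (C (pr x n)) - real (D (pr x n))) / 2 ^ n\<bar> \<le> 1 / 2 ^ n"
    using creal_E[OF assms(2)] by blast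
  let ?f = "\<lambda>z. pr (p1 z) (Suc (Suc (p2 z)))"
  show ?thesis
  proof (rule creal_I[of "\<lambda>z. A (?f z) + C (?f z)" "\<lambda>z. B (?f z) + D (?f z)" "\<lambda>_. 1"])
    fix x n
    show "\<bar>r x + s x - (real (A (?f (pr x n)) + C (?f (pr x n))) - real (B (?f (pr x n)) + D (?f (pr x n)))) /
        2 ^ (Suc n + 1)\<bar> \<le> 1 / 2 ^ Suc n"
      using AB(3)[of x "Suc (Suc n)"] CD(3)[of x "Suc (Suc n)"]
      by (simp add: diff_divide_distrib add_divide_distrib)
  qed (intro cpt computable_comp[OF AB(1)] computable_comp[OF AB(2)]
      computable_comp[OF CD(1)] computable_comp[OF CD(2)])+
qed

lemma creal_uminus [crl]:
  assumes "creal r" shows "creal (\<lambda>x. - r x)"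
proof -
  obtain A B where AB: "computable A" "computable B"
    "\<And>x n. \<bar>r x - (real (A (pr x n)) - real (B (pr x n))) / 2 ^ n\<bar> \<le> 1 / 2 ^ n"
    using creal_E[OF assms(1)] by blast
  have "\<bar>- r x - (real (B (pr x n)) - real (A (pr x n))) / 2 ^ n\<bar> \<le> 1 / 2 ^ n" for x n
    using AB(3)[of x n] by (simp add: diff_divide_distrib)
  with AB show ?thesis unfolding creal_def by blast
qed

lemma creal_diff [crl]: "creal r \<Longrightarrow> creal s \<Longrightarrow> creal (\<lambda>x. r x - s x)"
  using creal_add[of r "\<lambda>x. - s x"] creal_uminus[of s] by simp

lemma creal_mult_power2 [crl]:
  assumes "creal r" "computable g" shows "creal (\<lambda>x. 2 ^ g x * r x)"
proof -
  obtain A B where AB: "computable A" "computable B"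
    "\<And>x n. \<bar>r x - (real (A (pr x n)) - real (B (pr x n))) / 2 ^ n\<bar> \<le> 1 / 2 ^ n"
    using creal_E[OF assms(1)] by blast
  let ?f = "\<lambda>z. pr (p1 z) (Suc (p2 z) + g (p1 z))"
  show ?thesis
  proof (rule creal_I[of "\<lambda>z. A (?f z)" "\<lambda>z. B (?f z)" "\<lambda>_. 0"])
    fix x n
    let ?a = "real (A (?f (pr x n))) - real (B (?f (pr x n)))"
    have "\<bar>2 ^ g x * r x - ?a / 2 ^ (Suc n + 0)\<bar> = 2 ^ g x * \<bar>r x - ?a / 2 ^ (Suc n + g x)\<bar>"
      by (simp only: abs_diff_dyadic_rescale(2) add_0_right)
    also have "\<dots> \<le> 2 ^ g x * (1 / 2 ^ (Suc n + g x))"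
      using AB(3)[of x "Suc n + g x"] by (intro mult_left_mono) simp_all
    also have "\<dots> = 1 / 2 ^ Suc n" by (simp add: power_add)
    finally show "\<bar>2 ^ g x * r x - ?a / 2 ^ (Suc n + 0)\<bar> \<le> 1 / 2 ^ Suc n" .
  qed (intro cpt computable_comp[OF AB(1)] computable_comp[OF AB(2)] computable_comp[OF assms(2)])+
qed

lemma creal_divide_power2 [crl]:
  assumes "creal r" "computable g" shows "creal (\<lambda>x. r x / 2 ^ g x)"
proof -
  obtain A B where AB: "computable A" "computable B"
    "\<And>x n. \<bar>r x - (real (A (pr x n)) - real (B (pr x n))) / 2 ^ n\<bar> \<le> 1 / 2 ^ n"
    using creal_E[OF assms(1)] by blast
  let ?f = "\<lambda>z. pr (p1 z) (Suc (p2 z))"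
  show ?thesis
  proof (rule creal_I[of "\<lambda>z. A (?f z)" "\<lambda>z. B (?f z)" "\<lambda>z. g (p1 z)"])
    fix x n
    let ?a = "real (A (?f (pr x n))) - real (B (?f (pr x n)))"
    have "\<bar>r x / 2 ^ g x - ?a / 2 ^ (Suc n + g (p1 (pr x n)))\<bar> = \<bar>r x - ?a / 2 ^ Suc n\<bar> / 2 ^ g x"
      using abs_diff_dyadic_rescale(3) by (simp only: p1_pr)
    also have "\<dots> \<le> (1 / 2 ^ Suc n) / 1"
      using AB(3)[of x "Suc n"] by (intro frac_le) simp_all
    finally show "\<bar>r x / 2 ^ g x - ?a / 2 ^ (Suc n + g (p1 (pr x n)))\<bar> \<le> 1 / 2 ^ Suc n" by simp
  qed (intro cpt computable_comp[OF AB(1)] computable_comp[OF AB(2)] computable_comp[OF assms(2)])+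
qed

lemma creal_sum [crl]:
  assumes "creal (\<lambda>z. r (p1 z) (p2 z))" "computable g"
  shows "creal (\<lambda>x. \<Sum>i<g x. r i x)"
proof -
  obtain A B where AB: "computable A" "computable B"
    "\<And>x n. \<bar>r (p1 x) (p2 x) - (real (A (pr x n)) - real (B (pr x n))) / 2 ^ n\<bar> \<le> 1 / 2 ^ n"
    using creal_E[OF assms(1)] by blast
  \<comment> \<open>The additional \<open>g x\<close> bits of precision absorb the number of
    summands, since \<open>g x < 2 ^ g x\<close>.\<close>
  let ?f = "\<lambda>i z. pr (pr i (p1 z)) (Suc (p2 z) + g (p1 z))"
  show ?thesis
  proof (rule creal_I[of "\<lambda>z. \<Sum>i<g (p1 z). A (?f i z)" "\<lambda>z. \<Sum>i<g (p1 z). B (?f i z)" "\<lambda>z. g (p1 z)"])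
    fix x n
    define a where "a i = real (A (?f i (pr x n))) - real (B (?f i (pr x n)))" for i
    let ?a = a
    have "\<bar>(\<Sum>i<g x. r i x) - (\<Sum>i<g x. ?a i) / 2 ^ (Suc n + g x)\<bar>
        = \<bar>\<Sum>i<g x. r i x - ?a i / 2 ^ (Suc n + g x)\<bar>"
      by (simp only: sum_subtractf sum_divide_distrib)
    also have "\<dots> \<le> (\<Sum>i<g x. \<bar>r i x - ?a i / 2 ^ (Suc n + g x)\<bar>)" by (rule sum_abs)
    also have "\<dots> \<le> (\<Sum>i<g x. 1 / 2 ^ (Suc n + g x))"
      using AB(3)[of "pr _ x" "Suc n + g x"] by (intro sum_mono) (simp add: a_def)
    also have "\<dots> = (real (g x) / 2 ^ g x) / 2 ^ Suc n" by (simp add: power_add)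
    also have "\<dots> \<le> 1 / 2 ^ Suc n"
      using of_nat_less_two_power[of "g x", where 'a = real] by (intro divide_right_mono) (simp_all add: less_imp_le)
    finally show "\<bar>(\<Sum>i<g x. r i x) - (real (\<Sum>i<g (p1 (pr x n)). A (?f i (pr x n))) -
        real (\<Sum>i<g (p1 (pr x n)). B (?f i (pr x n)))) / 2 ^ (Suc n + g (p1 (pr x n)))\<bar> \<le> 1 / 2 ^ Suc n"
      by (simp add: sum_subtractf a_def)
  qed (intro cpt computable_comp[OF AB(1)] computable_comp[OF AB(2)] computable_comp[OF assms(2)])+
qed

section \<open>Maxima of finitely many computable reals\<close>

lemma Max_image_atMost_Suc: "Max (f ` {..Suc n}) = max (Max (f ` {..n})) (f (Suc n))"
  for f :: "nat \<Rightarrow> 'a::linorder"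
  by (simp add: atMost_Suc max.commute)

lemma computable_Max:
  assumes "computable (\<lambda>z. f (p1 z) (p2 z))" "computable g"
  shows "computable (\<lambda>x. Max ((\<lambda>i. f i x) ` {..g x}))"
proof -
  have f: "computable (\<lambda>z. f (h z) (k z))" if "computable h" "computable k" for h k
    using computable_comp[OF assms(1) computable_pr[OF that]] by simp
  have "computable (\<lambda>x. rec_nat (f 0 x) (\<lambda>i r. if r \<le> f (Suc i) x then f (Suc i) x else r) (g x))"
    by (intro cpt f assms(2))
  moreover have "rec_nat (f 0 x) (\<lambda>i r. if r \<le> f (Suc i) x then f (Suc i) x else r) k = Max ((\<lambda>i. f i x) ` {..k})"
    for k x by (induction k) (simp_all add: Max_image_atMost_Suc max_def)
  ultimately show ?thesis by simp
qed

lemma Max_diff_le: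
  fixes f g :: "nat \<Rightarrow> real"
  assumes "\<And>i. i \<le> n \<Longrightarrow> \<bar>f i - g i\<bar> \<le> e"
  shows "\<bar>Max (f ` {..n}) - Max (g ` {..n})\<bar> \<le> e"
  using assms by (induction n) (auto simp: Max_image_atMost_Suc, fastforce)

lemma Max_add_const:
  fixes f :: "nat \<Rightarrow> real"
  shows "Max ((\<lambda>i. f i + c) ` {..n}) = Max (f ` {..n}) + c"
  by (induction n) (simp_all add: Max_image_atMost_Suc)

lemma Max_divide_const:
  fixes f :: "nat \<Rightarrow> real"
  shows "c > 0 \<Longrightarrow> Max ((\<lambda>i. f i / c) ` {..n}) = Max (f ` {..n}) / c"
  by (induction n) (simp_all add: Max_image_atMost_Suc max_divide_distrib_right)

lemma Max_of_nat: "Max ((\<lambda>i. real (f i)) ` {..n::nat}) = real (Max (f ` {..n}))"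
  by (induction n) (simp_all add: Max_image_atMost_Suc)

lemma creal_Max [crl]:
  assumes "creal (\<lambda>z. r (p1 z) (p2 z))" "computable g"
  shows "creal (\<lambda>x. Max ((\<lambda>i. r i x) ` {..g x}))"
proof -
  obtain A B where AB: "computable A" "computable B"
    "\<And>x n. \<bar>r (p1 x) (p2 x) - (real (A (pr x n)) - real (B (pr x n))) / 2 ^ n\<bar> \<le> 1 / 2 ^ n"
    using creal_E[OF assms(1)] by blast
  let ?f = "\<lambda>i z. pr (pr i (p1 z)) (Suc (p2 z))"
  \<comment> \<open>The maximum has to be taken over naturals, but the differences
    \<open>A - B\<close> may be negative; \<open>?S\<close> exceeds or equals every B involved and
    shifts all differences alike.\<close>
  let ?S = "\<lambda>z. \<Sum>i<Suc (g (p1 z)). B (?f i z)"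
  show ?thesis
  proof (rule creal_I[of "\<lambda>z. Max ((\<lambda>i. A (?f i z) + (?S z - B (?f i z))) ` {..g (p1 z)})" ?S "\<lambda>z. 0"])
    fix x n
    let ?z = "pr x n"
    let ?a = "\<lambda>i. real (A (?f i ?z)) - real (B (?f i ?z))"
    have le: "B (?f i ?z) \<le> ?S ?z" if "i \<le> g x" for i
      using that by (intro member_le_sum) auto
    have "real (Max ((\<lambda>i. A (?f i ?z) + (?S ?z - B (?f i ?z))) ` {..g x}))
        = Max ((\<lambda>i. real (A (?f i ?z) + (?S ?z - B (?f i ?z)))) ` {..g x})"
      by (rule Max_of_nat[symmetric])
    also have "(\<lambda>i. real (A (?f i ?z) + (?S ?z - B (?f i ?z)))) ` {..g x} = (\<lambda>i. ?a i + real (?S ?z)) ` {..g x}"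
      using le by (intro image_cong) (simp_all only: of_nat_add of_nat_diff atMost_iff)
    also have "Max \<dots> = Max (?a ` {..g x}) + real (?S ?z)" by (rule Max_add_const)
    finally have e: "(real (Max ((\<lambda>i. A (?f i ?z) + (?S ?z - B (?f i ?z))) ` {..g x})) - real (?S ?z)) / 2 ^ (Suc n + 0)
        = Max ((\<lambda>i. ?a i / 2 ^ Suc n) ` {..g x})"
      by (simp add: Max_divide_const del: sum.lessThan_Suc power_Suc)
    have "\<bar>Max ((\<lambda>i. r i x) ` {..g x}) - Max ((\<lambda>i. ?a i / 2 ^ Suc n) ` {..g x})\<bar> \<le> 1 / 2 ^ Suc n"
      using AB(3)[of "pr _ x" "Suc n"] by (intro Max_diff_le) simp
    then show "\<bar>Max ((\<lambda>i. r i x) ` {..g x}) - (real (Max ((\<lambda>i. A (?f i ?z) + (?S ?z - B (?f i ?z))) ` {..g (p1 ?z)})) - real (?S ?z)) / 2 ^ (Suc n + 0)\<bar> \<le> 1 / 2 ^ Suc n"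
      using e by simp
  qed (intro computable_Max cpt computable_comp[OF AB(1)] computable_comp[OF AB(2)] computable_comp[OF assms(2)])+
qed

text \<open>Limits with a known rate of convergence; the rising sun transform is computed as such a
  limit of maxima over grids.\<close>

lemma creal_limit:
  assumes "creal s" "\<And>x n. \<bar>r x - s (pr x n)\<bar> \<le> 1 / 2 ^ n"
  shows "creal r"
proof -
  obtain A B where AB: "computable A" "computable B"
    "\<And>x n. \<bar>s x - (real (A (pr x n)) - real (B (pr x n))) / 2 ^ n\<bar> \<le> 1 / 2 ^ n"
    using creal_E[OF assms(1)] by blast
  let ?f = "\<lambda>z. pr (pr (p1 z) (Suc (Suc (p2 z)))) (Suc (Suc (p2 z)))"
  show ?thesis
  proof (rule creal_I[of "\<lambda>z. A (?f z)" "\<lambda>z. B (?f z)" "\<lambda>_. 1"])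
    fix x n
    show "\<bar>r x - (real (A (?f (pr x n))) - real (B (?f (pr x n)))) / 2 ^ (Suc n + 1)\<bar> \<le> 1 / 2 ^ Suc n"
      using AB(3)[of "pr x (Suc (Suc n))" "Suc (Suc n)"] assms(2)[of x "Suc (Suc n)"] by simp
  qed (intro cpt computable_comp[OF AB(1)] computable_comp[OF AB(2)])+
qed

section \<open>Binary strings\<close>

text \<open>The most significant bit comes first; only the last \<open>n\<close> binary digits of \<open>k\<close> matter.\<close>

primrec bits :: "nat \<Rightarrow> nat \<Rightarrow> bool list" where
  "bits 0 k = []"
| "bits (Suc n) k = bits n (k div 2) @ [odd k]"

definition bval :: "bool list \<Rightarrow> nat" where
  "bval \<sigma> = foldl (\<lambda>v b. 2 * v + of_bool b) 0 \<sigma>"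

lemma length_bits [simp]: "length (bits n k) = n"
  by (induction n arbitrary: k) auto

lemma bval_Nil [simp]: "bval [] = 0" and bval_snoc [simp]: "bval (\<sigma> @ [b]) = 2 * bval \<sigma> + of_bool b"
  by (simp_all add: bval_def)

lemma bval_less: "bval \<sigma> < 2 ^ length \<sigma>"
  by (induction \<sigma> rule: rev_induct) auto

lemma bits_bval [simp]: "bits (length \<sigma>) (bval \<sigma>) = \<sigma>"
  by (induction \<sigma> rule: rev_induct) auto

lemma bval_bits [simp]: "bval (bits n k) = k mod 2 ^ n"
proof (induction n arbitrary: k)
  case (Suc n)
  have "2 * (k div 2 mod 2 ^ n) + k mod 2 = k mod 2 ^ Suc n"
    by (simp add: mod_mult2_eq)
  then show ?case by (simp add: Suc mod_2_eq_odd)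
qed simp

lemma bits_add: "bits (m + n) k = bits m (k div 2 ^ n) @ bits n k"
  by (induction n arbitrary: k) (simp_all add: div_mult2_eq)

lemma take_bits: "j \<le> n \<Longrightarrow> take j (bits n k) = bits j (k div 2 ^ (n - j))"
  using bits_add[of j "n - j" k] by simp

lemma bits_mod [simp]: "bits n (k mod 2 ^ n) = bits n k"
  using bits_bval[of "bits n k"] by simp

lemma append_bits: "\<sigma> @ bits n k = bits (length \<sigma> + n) (bval \<sigma> * 2 ^ n + k mod 2 ^ n)"
proof -
  have "bits n (bval \<sigma> * 2 ^ n + k mod 2 ^ n) = bits n k"
    using bits_mod[of n "bval \<sigma> * 2 ^ n + k mod 2 ^ n"] by simp
  then show ?thesis by (simp add: bits_add)
qed

lemma bval_append: "bval (\<sigma> @ \<tau>) = bval \<sigma> * 2 ^ length \<tau> + bval \<tau>"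
proof (induction \<tau> rule: rev_induct)
  case (snoc b \<tau>)
  have "bval (\<sigma> @ \<tau> @ [b]) = 2 * bval (\<sigma> @ \<tau>) + of_bool b"
    using bval_snoc[of "\<sigma> @ \<tau>" b] by simp
  with snoc show ?case by simp
qed simp

text \<open>Flipping all bits reflects the cells of level n about 1/2; this gives the mirror image
  in \<open>maximal_martingale\<close>.\<close>

lemma map_Not_bits: "map Not (bits n k) = bits n (2 ^ n - 1 - k mod 2 ^ n)"
proof (induction n arbitrary: k)
  case (Suc n)
  have *: "k mod 2 ^ Suc n = 2 * (k div 2 mod 2 ^ n) + k mod 2"
    by (simp add: mod_mult2_eq)
  have l: "k div 2 mod 2 ^ n < 2 ^ n" by simp
  have k: "2 ^ Suc n - 1 - k mod 2 ^ Suc n = 2 * (2 ^ n - 1 - k div 2 mod 2 ^ n) + (1 - k mod 2)"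
  proof -
    have "2 * N - 1 - (2 * a + b) = 2 * (N - 1 - a) + (1 - b)" if "a < N" "b < 2" for a b N :: nat
      using that by arith
    from this[OF l, of "k mod 2"] show ?thesis unfolding * by simp
  qed
  have "(2 ^ Suc n - 1 - k mod 2 ^ Suc n) div 2 = 2 ^ n - 1 - k div 2 mod 2 ^ n"
    unfolding k by (cases "odd k") (simp_all add: mod_2_eq_odd)
  moreover have "odd (2 ^ Suc n - 1 - k mod 2 ^ Suc n) \<longleftrightarrow> even k"
    unfolding k by (cases "odd k") (simp_all add: mod_2_eq_odd)
  ultimately show ?case by (simp add: Suc)
qed simp

lemma bits_Suc_Cons: "bits (Suc n) k = odd (k div 2 ^ n) # bits n k"
  using bits_add[of 1 n k] by simp

lemma computable_string_encode_bits [cpt]: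
  assumes "computable f" "computable g"
  shows "computable (\<lambda>x. string_encode (bits (f x) (g x)))"
proof -
  have "computable (\<lambda>x. rec_nat 0 (\<lambda>i c. Suc (pr ((g x div 2 ^ i) mod 2) c)) (f x))"
    by (intro cpt assms computable_comp[OF assms(2)])
  moreover have "rec_nat 0 (\<lambda>i c. Suc (pr ((k div 2 ^ i) mod 2) c)) n = string_encode (bits n k)" for n k
  proof (induction n)
    case (Suc n)
    then show ?case unfolding bits_Suc_Cons by (simp add: string_encode_def mod_2_eq_odd)
  qed (simp add: string_encode_def)
  ultimately show ?thesis by simp
qed

text \<open>\<open>computable_martingale\<close> presents strings by \<open>string_encode\<close>.
  This and \<open>code_bval\<close> recover length and binary value, the coordinates used for
  strings elsewhere.\<close>

definition code_length :: "nat \<Rightarrow> nat" where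
  "code_length c = (LEAST j. cdrop j c = 0)"

definition code_bval :: "nat \<Rightarrow> nat" where
  "code_bval c = rec_nat 0 (\<lambda>i v. 2 * v + chd (cdrop i c)) (code_length c)"

lemma computable_code_length [cpt]: "computable f \<Longrightarrow> computable (\<lambda>x. code_length (f x))"
proof (rule computable_comp[of code_length])
  have "\<exists>j. cdrop j c = 0" for c
    using cdrop_list_encode[of "length (list_decode c)" "list_decode c"] by auto
  then show "computable code_length"
    unfolding code_length_def by (intro computable_Least cpt) 
qed

lemma computable_code_bval [cpt]: "computable f \<Longrightarrow> computable (\<lambda>x. code_bval (f x))"
proof (rule computable_comp[of code_bval])
  show "computable code_bval" unfolding code_bval_def by (intro cpt) 
qed

lemma code_length_string [simp]: "code_length (string_encode \<sigma>) = length \<sigma>"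
  unfolding code_length_def string_encode_def by (rule Least_equality) auto

lemma code_bval_string [simp]: "code_bval (string_encode \<sigma>) = bval \<sigma>"
proof -
  have "rec_nat 0 (\<lambda>i v. 2 * v + chd (cdrop i (string_encode \<sigma>))) j = bval (take j \<sigma>)"
    if "j \<le> length \<sigma>" for j
    using that
  proof (induction j)
    case (Suc j)
    then have "take (Suc j) \<sigma> = take j \<sigma> @ [\<sigma> ! j]" by (simp add: take_Suc_conv_app_nth)
    moreover have "chd (cdrop j (string_encode \<sigma>)) = of_bool (\<sigma> ! j)"
      using Suc by (simp add: string_encode_def chd_list_encode hd_drop_conv_nth drop_map hd_map)
    ultimately show ?case using Suc by simp
  qed simp
  from this[of "length \<sigma>"] show ?thesis by (simp add: code_bval_def)
qed

section \<open>Computable martingales\<close>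

lemma computable_rat_seq_I:
  assumes "computable A" "computable B" "computable D"
  shows "computable_rat_seq (\<lambda>z. (of_nat (A z) - of_nat (B z)) / of_nat (Suc (D z)))"
proof -
  \<comment> \<open>\<open>int_decode\<close> sends 2k to k and 2k + 1 to -k - 1.\<close>
  define num where "num z = (if B z \<le> A z then 2 * (A z - B z) else Suc (2 * (B z - A z - 1)))" for z
  have "computable num" unfolding num_def by (intro cpt assms)
  moreover have "int_decode (num z) = int (A z) - int (B z)" for z
    by (auto simp: num_def int_decode_def sum_decode_def of_nat_diff)
  ultimately show ?thesis
    unfolding computable_rat_seq_def using assms(3) by (intro exI[of _ num] exI[of _ D]) simp
qed

lemma computable_rat_seq_creal:
  assumes "computable_rat_seq q" "\<And>x n. \<bar>r x - of_rat (q (pr x n))\<bar> \<le> (1 / 2) ^ n"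
  shows "creal r"
proof -
  obtain num den where nd: "computable num" "computable den"
    "\<And>n. q n = of_int (int_decode (num n)) / of_nat (Suc (den n))"
    using assms(1) unfolding computable_rat_seq_def by auto
  let ?f = "\<lambda>z. pr (p1 z) (Suc (Suc (p2 z)))"
  define P where "P m = (if even m then m div 2 else 0)" for m :: nat
  define N where "N m = (if even m then 0 else m div 2 + 1)" for m :: nat
  define A where "A z = P (num (?f z)) * 2 ^ Suc (Suc (p2 z)) div Suc (den (?f z))" for z
  define B where "B z = N (num (?f z)) * 2 ^ Suc (Suc (p2 z)) div Suc (den (?f z))" for z
  have dec: "int_decode m = int (P m) - int (N m)" for m
    by (auto simp: P_def N_def int_decode_def sum_decode_def)
  have fl: "\<bar>real (a div Suc b) - real a / real (Suc b)\<bar> \<le> 1" for a b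
  proof -
    have "real a = real (a div Suc b) * real (Suc b) + real (a mod Suc b)"
      by (metis div_mult_mod_eq of_nat_add of_nat_mult)
    then have "real a / real (Suc b) = real (a div Suc b) + real (a mod Suc b) / real (Suc b)"
      by (simp add: add_divide_distrib del: of_nat_Suc)
    moreover have "real (a mod Suc b) / real (Suc b) \<le> 1"
      using less_imp_le[OF mod_less_divisor[of "Suc b" a], THEN of_nat_mono[where 'a = real]] by simp
    ultimately show ?thesis by simp
  qed
  show ?thesis
  proof (rule creal_I[of A B "\<lambda>_. 1"])
    fix x n
    let ?z = "pr x (Suc (Suc n))"
    define D where "D = real (Suc (den ?z))"
    define M :: real where "M = 2 ^ Suc (Suc n)"
    have M: "M > 0" by (simp add: M_def)
    have q: "of_rat (q ?z) = (real (P (num ?z)) - real (N (num ?z))) / D"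
      unfolding nd(3) dec by (simp add: of_rat_divide of_rat_diff D_def of_rat_add)
    have "\<bar>(real (A (pr x n)) - real (B (pr x n))) - (real (P (num ?z)) - real (N (num ?z))) * M / D\<bar> \<le> 1"
    proof -
      have 1: "\<bar>real (A (pr x n)) - real (P (num ?z)) * M / D\<bar> \<le> 1" "\<bar>real (B (pr x n)) - real (N (num ?z)) * M / D\<bar> \<le> 1"
        using fl[of "P (num ?z) * 2 ^ Suc (Suc n)" "den ?z"] fl[of "N (num ?z) * 2 ^ Suc (Suc n)" "den ?z"]
        by (simp_all add: A_def B_def M_def D_def)
      \<comment> \<open>One of the two quotients is exactly 0, so only one of the two floor errors
        counts.\<close>
      have "P (num ?z) = 0 \<or> N (num ?z) = 0" by (simp add: P_def N_def)
      then show ?thesis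
      proof
        assume "P (num ?z) = 0"
        then show ?thesis using 1(2) by (simp add: A_def)
      next
        assume "N (num ?z) = 0"
        then show ?thesis using 1(1) by (simp add: B_def)
      qed
    qed
    then have "\<bar>(real (A (pr x n)) - real (B (pr x n))) - of_rat (q ?z) * M\<bar> / M \<le> 1 / M"
      using M by (intro divide_right_mono) (simp_all add: q)
    moreover have "\<bar>(real (A (pr x n)) - real (B (pr x n))) - of_rat (q ?z) * M\<bar> / M
       = \<bar>(real (A (pr x n)) - real (B (pr x n))) / M - of_rat (q ?z)\<bar>"
      using M by (simp add: abs_if field_simps)
    ultimately show "\<bar>r x - (real (A (pr x n)) - real (B (pr x n))) / 2 ^ (Suc n + 1)\<bar> \<le> 1 / 2 ^ Suc n"
      using assms(2)[of x "Suc (Suc n)"] by (simp add: M_def power_one_over)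
  qed (unfold A_def B_def P_def N_def, (intro cpt computable_comp[OF nd(1)] computable_comp[OF nd(2)])+)
qed

text \<open>Trades rational approximations indexed by string codes for uniformly computable reals
  indexed by length and value, to which the rules \<open>crl\<close> apply.\<close>

lemma computable_martingale_iff:
  "computable_martingale d \<longleftrightarrow> martingale d \<and> creal (\<lambda>z. d (bits (p1 z) (p2 z)))"
proof (intro iffI conjI)
  assume d: "computable_martingale d"
  then show "martingale d" by (simp add: computable_martingale_def)
  obtain q where q: "computable_rat_seq q"
    "\<And>\<sigma> n. \<bar>d \<sigma> - of_rat (q (pr (string_encode \<sigma>) n))\<bar> \<le> (1/2) ^ n"
    using d by (auto simp: computable_martingale_def)
  obtain num den where nd: "computable num" "computable den"
    "\<And>n. q n = of_int (int_decode (num n)) / of_nat (Suc (den n))"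
    using q(1) unfolding computable_rat_seq_def by auto
  let ?f = "\<lambda>z. pr (string_encode (bits (p1 (p1 z)) (p2 (p1 z)))) (p2 z)"
  have "computable_rat_seq (\<lambda>z. q (?f z))"
    unfolding computable_rat_seq_def
    by (intro exI[of _ "\<lambda>z. num (?f z)"] exI[of _ "\<lambda>z. den (?f z)"] conjI
        computable_comp[OF nd(1)] computable_comp[OF nd(2)] cpt) (simp add: nd(3))
  then show "creal (\<lambda>z. d (bits (p1 z) (p2 z)))"
    by (rule computable_rat_seq_creal) (simp add: q(2))
next
  assume d: "martingale d \<and> creal (\<lambda>z. d (bits (p1 z) (p2 z)))"
  then obtain A B where AB: "computable A" "computable B"
    "\<And>x n. \<bar>d (bits (p1 x) (p2 x)) - (real (A (pr x n)) - real (B (pr x n))) / 2 ^ n\<bar> \<le> 1 / 2 ^ n"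
    using creal_E[OF conjunct2[OF d]] by blast
  let ?f = "\<lambda>z. pr (pr (code_length (p1 z)) (code_bval (p1 z))) (p2 z)"
  define q :: "nat \<Rightarrow> rat"
    where "q z = (of_nat (A (?f z)) - of_nat (B (?f z))) / of_nat (Suc (2 ^ p2 z - 1))" for z
  have "computable_rat_seq q"
    unfolding q_def
    by (intro computable_rat_seq_I computable_comp[OF AB(1)] computable_comp[OF AB(2)] cpt)
  moreover have "\<bar>d \<sigma> - of_rat (q (pr (string_encode \<sigma>) n))\<bar> \<le> (1/2) ^ n" for \<sigma> n
    using AB(3)[of "pr (length \<sigma>) (bval \<sigma>)" n]
    by (simp add: q_def of_rat_divide of_rat_diff of_rat_power power_one_over)
  ultimately show "computable_martingale d"
    using d unfolding computable_martingale_def by blast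
qed

lemma martingale_nonneg: "martingale d \<Longrightarrow> 0 \<le> d \<sigma>"
  unfolding martingale_def by blast

lemma martingale_split:
  assumes "martingale d" shows "d (\<sigma> @ [False]) + d (\<sigma> @ [True]) = 2 * d \<sigma>"
proof -
  have "d \<sigma> = (d (\<sigma> @ [False]) + d (\<sigma> @ [True])) / 2" using assms unfolding martingale_def by blast
  moreover have "b + c = 2 * a" if "a = (b + c) / 2" for a b c :: real using that by simp
  ultimately show ?thesis by blast
qed

lemma martingaleI:
  assumes "\<And>\<sigma>. 0 \<le> d \<sigma>" "\<And>\<sigma>. d (\<sigma> @ [False]) + d (\<sigma> @ [True]) = 2 * d \<sigma>"
  shows "martingale d"
  unfolding martingale_def
proof (intro conjI allI)
  show "d \<sigma> = (d (\<sigma> @ [False]) + d (\<sigma> @ [True])) / 2" for \<sigma> by (simp only: assms(2))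
qed (rule assms(1))

lemma computable_martingaleD:
  assumes "computable_martingale d"
  shows "martingale d" "creal (\<lambda>z. d (bits (p1 z) (p2 z)))"
  using assms by (simp_all add: computable_martingale_iff)

lemma creal_martingale [crl]:
  assumes "computable_martingale d" "computable f" "computable g"
  shows "creal (\<lambda>x. d (bits (f x) (g x)))"
  using creal_comp[OF computable_martingaleD(2)[OF assms(1)] computable_pr[OF assms(2,3)]] by simp

lemma computable_martingale_add:
  assumes "computable_martingale d" "computable_martingale e"
  shows "computable_martingale (\<lambda>\<sigma>. d \<sigma> + e \<sigma>)"
  unfolding computable_martingale_iff
proof
  note [simp] = computable_martingaleD(1)[OF assms(1)] computable_martingaleD(1)[OF assms(2)]
  show "martingale (\<lambda>\<sigma>. d \<sigma> + e \<sigma>)"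
  proof (rule martingaleI)
    show "0 \<le> d \<sigma> + e \<sigma>" for \<sigma> by (simp add: martingale_nonneg)
    show "d (\<sigma> @ [False]) + e (\<sigma> @ [False]) + (d (\<sigma> @ [True]) + e (\<sigma> @ [True])) = 2 * (d \<sigma> + e \<sigma>)" for \<sigma>
      using martingale_split[of d \<sigma>] martingale_split[of e \<sigma>] by simp
  qed
  show "creal (\<lambda>z. d (bits (p1 z) (p2 z)) + e (bits (p1 z) (p2 z)))"
    by (intro crl cpt assms)
qed

lemma computable_martingale_scale:
  assumes "computable_martingale d"
  shows "computable_martingale (\<lambda>\<sigma>. 2 ^ m * d \<sigma>)" "computable_martingale (\<lambda>\<sigma>. d \<sigma> / 2 ^ m)"
proof -
  have d: "martingale d" using assms by (rule computable_martingaleD)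
  have "martingale (\<lambda>\<sigma>. c * d \<sigma>)" if "c \<ge> 0" for c
    using that martingale_nonneg[OF d] martingale_split[OF d]
    by (intro martingaleI) (simp_all add: distrib_left[symmetric])
  from this[of "2 ^ m"] this[of "1 / 2 ^ m"]
  have "martingale (\<lambda>\<sigma>. 2 ^ m * d \<sigma>)" "martingale (\<lambda>\<sigma>. d \<sigma> / 2 ^ m)" by simp_all
  moreover have "creal (\<lambda>z. 2 ^ m * d (bits (p1 z) (p2 z)))" "creal (\<lambda>z. d (bits (p1 z) (p2 z)) / 2 ^ m)"
    by (intro crl cpt assms)+
  ultimately show "computable_martingale (\<lambda>\<sigma>. 2 ^ m * d \<sigma>)" "computable_martingale (\<lambda>\<sigma>. d \<sigma> / 2 ^ m)"
    unfolding computable_martingale_iff by simp_all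
qed

lemma computable_martingale_shift:
  assumes "computable_martingale d" "\<And>\<sigma>. real a / 2 ^ m \<le> d \<sigma>"
  shows "computable_martingale (\<lambda>\<sigma>. d \<sigma> - real a / 2 ^ m)"
  unfolding computable_martingale_iff
proof
  have d: "martingale d" using assms(1) by (rule computable_martingaleD)
  show "martingale (\<lambda>\<sigma>. d \<sigma> - real a / 2 ^ m)"
    using assms(2) martingale_split[OF d] by (intro martingaleI) (simp_all add: algebra_simps)
  show "creal (\<lambda>z. d (bits (p1 z) (p2 z)) - real a / 2 ^ m)"
    by (intro crl cpt assms(1))
qed

lemma computable_martingale_const: "computable_martingale (\<lambda>\<sigma>. real a / 2 ^ m)"
  unfolding computable_martingale_iff
  by (intro conjI martingaleI crl cpt) simp_all

lemma computable_martingale_append: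
  assumes "computable_martingale d"
  shows "computable_martingale (\<lambda>\<pi>. d (\<tau> @ \<pi>))"
  unfolding computable_martingale_iff
proof
  have d: "martingale d" using assms by (rule computable_martingaleD)
  show "martingale (\<lambda>\<pi>. d (\<tau> @ \<pi>))"
    using martingale_nonneg[OF d] martingale_split[OF d, of "\<tau> @ _"] by (intro martingaleI) simp_all
  show "creal (\<lambda>z. d (\<tau> @ bits (p1 z) (p2 z)))"
    unfolding append_bits by (intro crl cpt assms)
qed

lemma computable_martingale_map_Not:
  assumes "computable_martingale d"
  shows "computable_martingale (\<lambda>\<pi>. d (map Not \<pi>))"
  unfolding computable_martingale_iff
proof
  have d: "martingale d" using assms by (rule computable_martingaleD)
  show "martingale (\<lambda>\<pi>. d (map Not \<pi>))"
    using martingale_nonneg[OF d] martingale_split[OF d, of "map Not _"]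
    by (intro martingaleI) (simp_all add: add.commute)
  show "creal (\<lambda>z. d (map Not (bits (p1 z) (p2 z))))"
    unfolding map_Not_bits by (intro crl cpt assms)
qed

subsection \<open>Stopping\<close>

text \<open>This is optional stopping at the first prefix in S; the disjunct
  \<open>length \<sigma> \<le> j\<close> makes the search end when there is none.\<close>

definition stop :: "(bool list \<Rightarrow> bool) \<Rightarrow> bool list \<Rightarrow> bool list" where
  "stop S \<sigma> = take (LEAST j. length \<sigma> \<le> j \<or> S (take j \<sigma>)) \<sigma>"

lemma stop_cases:
  obtains (unstopped) "stop S \<sigma> = \<sigma>" "\<And>j. j < length \<sigma> \<Longrightarrow> \<not> S (take j \<sigma>)"
  | (stopped) j where "j < length \<sigma>" "stop S \<sigma> = take j \<sigma>" "S (take j \<sigma>)"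
      "\<And>i. i < j \<Longrightarrow> \<not> S (take i \<sigma>)"
proof -
  define J where "J = (LEAST j. length \<sigma> \<le> j \<or> S (take j \<sigma>))"
  have J: "length \<sigma> \<le> J \<or> S (take J \<sigma>)" unfolding J_def by (rule LeastI[of _ "length \<sigma>"]) simp
  have l: "\<not> S (take i \<sigma>)" if "i < J" for i using that not_less_Least unfolding J_def by blast
  show thesis
  proof (cases "J < length \<sigma>")
    case True
    show ?thesis
    proof (rule stopped[of J])
      show "stop S \<sigma> = take J \<sigma>" by (simp add: stop_def J_def)
    qed (use J l True in auto)
  next
    case False
    show ?thesis
    proof (rule unstopped)
      show "stop S \<sigma> = \<sigma>" using False by (simp add: stop_def flip: J_def)
    qed (use l False in auto)
  qed
qed

lemma stop_eq_take:
  assumes "j \<le> length \<sigma>" "S (take j \<sigma>)" "\<And>i. i < j \<Longrightarrow> \<not> S (take i \<sigma>)"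
  shows "stop S \<sigma> = take j \<sigma>"
proof -
  have "(LEAST j. length \<sigma> \<le> j \<or> S (take j \<sigma>)) = j"
  proof (rule Least_equality)
    fix i assume "length \<sigma> \<le> i \<or> S (take i \<sigma>)"
    then show "j \<le> i" using assms by (metis le_trans not_le)
  qed (use assms in simp)
  then show ?thesis by (simp add: stop_def)
qed

lemma stop_eq_self:
  assumes "\<And>j. j < length \<sigma> \<Longrightarrow> \<not> S (take j \<sigma>)"
  shows "stop S \<sigma> = \<sigma>"
  using assms by (cases rule: stop_cases[of S \<sigma>]) auto

lemma stop_snoc:
  "stop S (\<sigma> @ [b]) = (if \<exists>j\<le>length \<sigma>. S (take j \<sigma>) then stop S \<sigma> else \<sigma> @ [b])"
proof (cases "\<exists>j\<le>length \<sigma>. S (take j \<sigma>)")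
  case True
  define j where "j = (LEAST j. j \<le> length \<sigma> \<and> S (take j \<sigma>))"
  have j: "j \<le> length \<sigma> \<and> S (take j \<sigma>)" unfolding j_def using True by (rule LeastI_ex)
  have l: "\<not> S (take i \<sigma>)" if "i < j" for i
    using that j not_less_Least[of i "\<lambda>j. j \<le> length \<sigma> \<and> S (take j \<sigma>)"] unfolding j_def by fastforce
  have "stop S \<sigma> = take j \<sigma>" using j l by (intro stop_eq_take) auto
  moreover have "stop S (\<sigma> @ [b]) = take j (\<sigma> @ [b])" using j l by (intro stop_eq_take) auto
  ultimately show ?thesis using True j by simp
next
  case False
  then have "stop S (\<sigma> @ [b]) = \<sigma> @ [b]" by (intro stop_eq_self) auto
  with False show ?thesis by auto
qed

text \<open>Once stopped, both children inherit the value of the parent. S has to be decidable so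
  that the stopping time \<open>J\<close> is computable.\<close>

lemma computable_martingale_stop:
  assumes d: "computable_martingale d" and S: "dec (\<lambda>z. S (bits (p1 z) (p2 z)))"
  shows "computable_martingale (\<lambda>\<sigma>. d (stop S \<sigma>))"
  unfolding computable_martingale_iff
proof
  have m: "martingale d" using d by (rule computable_martingaleD)
  show "martingale (\<lambda>\<sigma>. d (stop S \<sigma>))"
  proof (rule martingaleI)
    fix \<sigma>
    show "d (stop S (\<sigma> @ [False])) + d (stop S (\<sigma> @ [True])) = 2 * d (stop S \<sigma>)"
    proof (cases "\<exists>j\<le>length \<sigma>. S (take j \<sigma>)")
      case False
      then have "stop S \<sigma> = \<sigma>" by (intro stop_eq_self) auto
      with False show ?thesis using martingale_split[OF m, of \<sigma>] by (auto simp: stop_snoc)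
    qed (simp add: stop_snoc)
  qed (simp add: martingale_nonneg m)
  have S': "dec (\<lambda>z. S (bits (f z) (g z)))" if "computable f" "computable g" for f g
    using dec_comp[OF S computable_pr[OF that]] by simp
  define J where "J x = (LEAST j. p1 x \<le> j \<or> S (bits j (p2 x div 2 ^ (p1 x - j))))" for x
  have J: "computable J"
    unfolding J_def by (intro computable_Least cpt S') auto
  have Jle: "J x \<le> p1 x" for x unfolding J_def by (rule Least_le) simp
  have "stop S (bits (p1 x) (p2 x)) = bits (J x) (p2 x div 2 ^ (p1 x - J x))" for x
  proof -
    have "(LEAST j. p1 x \<le> j \<or> S (take j (bits (p1 x) (p2 x)))) = J x"
      unfolding J_def
    proof (rule arg_cong[of _ _ Least], rule ext)
      show "(p1 x \<le> j \<or> S (take j (bits (p1 x) (p2 x)))) = (p1 x \<le> j \<or> S (bits j (p2 x div 2 ^ (p1 x - j))))" for j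
        by (cases "p1 x \<le> j") (simp_all add: take_bits)
    qed
    with take_bits[OF Jle] show ?thesis by (simp add: stop_def)
  qed
  moreover have "creal (\<lambda>x. d (bits (J x) (p2 x div 2 ^ (p1 x - J x))))"
    by (intro crl cpt J d)
  ultimately show "creal (\<lambda>z. d (stop S (bits (p1 z) (p2 z))))" by simp
qed

subsection \<open>The distribution function of a martingale\<close>

text \<open>The distribution function, at dyadic points, of the measure that gives the cell of
  \<open>\<sigma>\<close> the mass \<open>f \<sigma> / 2 ^ length \<sigma>\<close>.\<close>

definition cdf :: "(bool list \<Rightarrow> real) \<Rightarrow> nat \<Rightarrow> nat \<Rightarrow> real" where
  "cdf f m j = (\<Sum>i<j. f (bits m i) / 2 ^ m)"

lemma bits_Suc_double: "bits (Suc m) (2 * i) = bits m i @ [False]" "bits (Suc m) (Suc (2 * i)) = bits m i @ [True]"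
  by simp_all

lemma cdf_Suc:
  assumes "martingale f" shows "cdf f (Suc m) (2 * j) = cdf f m j"
proof (induction j)
  case (Suc j)
  have "cdf f (Suc m) (2 * Suc j) = cdf f (Suc m) (2 * j) + (f (bits m j @ [False]) + f (bits m j @ [True])) / 2 ^ Suc m"
    unfolding cdf_def by (simp add: add_divide_distrib del: bits.simps(2) add: bits_Suc_double)
  also have "f (bits m j @ [False]) + f (bits m j @ [True]) = 2 * f (bits m j)"
    by (rule martingale_split[OF assms])
  finally show ?case using Suc by (simp add: cdf_def)
qed (simp add: cdf_def)

lemma cdf_refine:
  assumes "martingale f" shows "cdf f (m + t) (j * 2 ^ t) = cdf f m j"
proof (induction t)
  case (Suc t)
  then show ?case using cdf_Suc[OF assms, of "m + t" "j * 2 ^ t"] by (simp add: mult_ac)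
qed simp

lemma cdf_mono: "martingale f \<Longrightarrow> j \<le> k \<Longrightarrow> cdf f m j \<le> cdf f m k"
  unfolding cdf_def by (intro sum_mono2) (auto simp: martingale_nonneg)

lemma cdf_le:
  assumes f: "martingale f" and le: "real j / 2 ^ m \<le> real k / 2 ^ n"
  shows "cdf f m j \<le> cdf f n k"
proof -
  have "real (j * 2 ^ n) \<le> real (k * 2 ^ m)" using le by (simp add: field_simps)
  then have "j * 2 ^ n \<le> k * 2 ^ m" by (simp only: of_nat_le_iff)
  then have "cdf f (m + n) (j * 2 ^ n) \<le> cdf f (m + n) (k * 2 ^ m)" by (rule cdf_mono[OF f])
  then show ?thesis using cdf_refine[OF f, of m n j] cdf_refine[OF f, of n m k] by (simp add: add.commute)
qed

text \<open>The extension to real arguments lets the supremum in \<open>rising_sun\<close> range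
  over an interval instead of a grid; thus the transform does not depend on a level.\<close>

definition distr_fun :: "(bool list \<Rightarrow> real) \<Rightarrow> real \<Rightarrow> real" where
  "distr_fun f z = Sup {cdf f m j | m j. real j / 2 ^ m \<le> z}"

lemma distr_fun_dyadic:
  assumes "martingale f" shows "distr_fun f (real j / 2 ^ m) = cdf f m j"
  unfolding distr_fun_def by (rule cSup_eq_maximum) (use cdf_le[OF assms] in auto)

lemma distr_fun_mono:
  assumes f: "martingale f" and "0 \<le> x" "x \<le> y" "y \<le> 1"
  shows "distr_fun f x \<le> distr_fun f y"
  unfolding distr_fun_def
proof (rule cSup_subset_mono)
  show "{cdf f m j |m j. real j / 2 ^ m \<le> x} \<noteq> {}" using assms(2) by (auto intro!: exI[of _ "0::nat"])
  show "bdd_above {cdf f m j |m j. real j / 2 ^ m \<le> y}"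
  proof (rule bdd_aboveI)
    fix v assume "v \<in> {cdf f m j |m j. real j / 2 ^ m \<le> y}"
    then obtain m j where v: "v = cdf f m j" "real j / 2 ^ m \<le> y" by blast
    have "real j / 2 ^ m \<le> 1" using v(2) assms(4) by (rule order_trans)
    then have "real j / 2 ^ m \<le> real 1 / 2 ^ 0" by (simp only: of_nat_1 power_0 div_by_1)
    then show "v \<le> cdf f 0 1" unfolding v(1) by (rule cdf_le[OF f])
  qed
  show "{cdf f m j |m j. real j / 2 ^ m \<le> x} \<subseteq> {cdf f m j |m j. real j / 2 ^ m \<le> y}"
    using assms(3) by (blast intro: order_trans)
qed

subsection \<open>The rising sun transform\<close>

definition rising_sun :: "real \<Rightarrow> (real \<Rightarrow> real) \<Rightarrow> real \<Rightarrow> real" where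
  "rising_sun \<epsilon> F y = (SUP z\<in>{y..1}. F z - \<epsilon> * (z - y))"

context
  fixes \<epsilon> :: real and F :: "real \<Rightarrow> real"
  assumes eps: "\<epsilon> \<ge> 0"
    and mono: "\<And>x y. 0 \<le> x \<Longrightarrow> x \<le> y \<Longrightarrow> y \<le> 1 \<Longrightarrow> F x \<le> F y"
begin

lemma rising_sun_upper:
  assumes "0 \<le> y" "y \<le> z" "z \<le> 1"
  shows "F z - \<epsilon> * (z - y) \<le> rising_sun \<epsilon> F y"
  unfolding rising_sun_def
proof (rule cSUP_upper)
  show "bdd_above ((\<lambda>z. F z - \<epsilon> * (z - y)) ` {y..1})"
  proof (rule bdd_aboveI2)
    fix z assume "z \<in> {y..1}"
    then have "0 \<le> \<epsilon> * (z - y)" "F z \<le> F 1" using mono[of z 1] assms eps by simp_all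
    then show "F z - \<epsilon> * (z - y) \<le> F 1" by linarith
  qed
qed (use assms in auto)

lemma rising_sun_least:
  assumes "y \<le> 1" "\<And>z. y \<le> z \<Longrightarrow> z \<le> 1 \<Longrightarrow> F z - \<epsilon> * (z - y) \<le> c"
  shows "rising_sun \<epsilon> F y \<le> c"
  unfolding rising_sun_def by (rule cSUP_least) (use assms in auto)

lemma rising_sun_ge: "0 \<le> y \<Longrightarrow> y \<le> 1 \<Longrightarrow> F y \<le> rising_sun \<epsilon> F y"
  using rising_sun_upper[of y y] by simp

lemma rising_sun_mono:
  assumes "0 \<le> x" "x \<le> y" "y \<le> 1"
  shows "rising_sun \<epsilon> F x \<le> rising_sun \<epsilon> F y"
proof (rule rising_sun_least)
  fix z assume z: "x \<le> z" "z \<le> 1"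
  show "F z - \<epsilon> * (z - x) \<le> rising_sun \<epsilon> F y"
  proof (cases "y \<le> z")
    case True
    have "F z - \<epsilon> * (z - x) \<le> F z - \<epsilon> * (z - y)" using assms eps by (simp add: mult_left_mono)
    also have "\<dots> \<le> rising_sun \<epsilon> F y" using True z assms by (intro rising_sun_upper) auto
    finally show ?thesis .
  next
    case False
    have "F z - \<epsilon> * (z - x) \<le> F z" using z eps by simp
    also have "\<dots> \<le> F y" using False z assms by (intro mono) auto
    also have "\<dots> \<le> rising_sun \<epsilon> F y" using assms by (intro rising_sun_ge) auto
    finally show ?thesis .
  qed
qed (use assms in auto)

text \<open>
  A slope below \<open>\<epsilon>\<close> of the transform over \<open>[l, r]\<close> means that its value at \<open>l\<close> is not attained
  beyond \<open>r\<close>.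
\<close>

lemma rising_sun_slope_less:
  assumes lr: "0 \<le> l" "l < r" "r \<le> 1"
    and less: "rising_sun \<epsilon> F r - rising_sun \<epsilon> F l < \<epsilon> * (r - l)"
    and z: "r \<le> z" "z \<le> 1"
  shows "F z - F r \<le> \<epsilon> * (z - l)"
proof -
  have *: "rising_sun \<epsilon> F l \<le> max (F r) (rising_sun \<epsilon> F r - \<epsilon> * (r - l))"
  proof (rule rising_sun_least)
    fix z assume z: "l \<le> z" "z \<le> 1"
    show "F z - \<epsilon> * (z - l) \<le> max (F r) (rising_sun \<epsilon> F r - \<epsilon> * (r - l))"
    proof (cases "r \<le> z")
      case True
      then have "F z - \<epsilon> * (z - r) \<le> rising_sun \<epsilon> F r" using lr z by (intro rising_sun_upper) auto
      then show ?thesis by (simp add: algebra_simps)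
    next
      case False
      have "F z - \<epsilon> * (z - l) \<le> F z" using z eps by simp
      also have "\<dots> \<le> F r" using False z lr by (intro mono) auto
      finally show ?thesis by simp
    qed
  qed (use lr in auto)
  \<comment> \<open>The second term of the maximum is excluded by \<open>less\<close>. Hence the
    transform at l is at most \<open>F r\<close>, and by \<open>less\<close> again it rises by less
    than \<open>\<epsilon> * (r - l)\<close> up to r.\<close>
  have "rising_sun \<epsilon> F r \<le> F r + \<epsilon> * (r - l)" using * less by (simp add: max_def split: if_splits)
  moreover have "F z - \<epsilon> * (z - r) \<le> rising_sun \<epsilon> F r" using lr z by (intro rising_sun_upper) auto
  ultimately show ?thesis by (simp add: algebra_simps)
qed

text \<open>Rounding z up to the grid does not decrease F and adds at most
  \<open>\<epsilon> / 2 ^ m\<close> to the linear penalty.\<close>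

lemma rising_sun_grid:
  fixes m k :: nat
  assumes k: "k \<le> 2 ^ m"
  defines "M \<equiv> Max ((\<lambda>i. F (real (k + i) / 2 ^ m) - \<epsilon> * (real i / 2 ^ m)) ` {..2 ^ m - k})"
  shows "\<bar>rising_sun \<epsilon> F (real k / 2 ^ m) - M\<bar> \<le> \<epsilon> / 2 ^ m"
proof -
  have k': "real k / 2 ^ m \<le> 1" using k by simp
  have 1: "M \<le> rising_sun \<epsilon> F (real k / 2 ^ m)"
    unfolding M_def
  proof (rule Max.boundedI)
    fix v assume "v \<in> (\<lambda>i. F (real (k + i) / 2 ^ m) - \<epsilon> * (real i / 2 ^ m)) ` {..2 ^ m - k}"
    then obtain i where i: "i \<le> 2 ^ m - k" and v: "v = F (real (k + i) / 2 ^ m) - \<epsilon> * (real i / 2 ^ m)" by auto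
    have "k + i \<le> 2 ^ m" using i k by simp
    then have "real (k + i) \<le> 2 ^ m" using of_nat_mono[of "k + i" "2 ^ m", where 'a = real] by simp
    then have "F (real (k + i) / 2 ^ m) - \<epsilon> * (real (k + i) / 2 ^ m - real k / 2 ^ m) \<le> rising_sun \<epsilon> F (real k / 2 ^ m)"
      by (intro rising_sun_upper) (auto simp: divide_right_mono)
    then show "v \<le> rising_sun \<epsilon> F (real k / 2 ^ m)"
      by (simp add: v add_divide_distrib)
  qed auto
  have 2: "rising_sun \<epsilon> F (real k / 2 ^ m) \<le> M + \<epsilon> / 2 ^ m"
  proof (rule rising_sun_least[OF k'])
    fix z assume z: "real k / 2 ^ m \<le> z" "z \<le> 1"
    define j where "j = nat \<lceil>z * 2 ^ m\<rceil>"
    have "0 \<le> z" using z(1) by (smt (verit) divide_nonneg_nonneg of_nat_0_le_iff zero_le_power)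
    then have "0 \<le> z * 2 ^ m" by simp
    then have j: "z * 2 ^ m \<le> real j" "real j \<le> z * 2 ^ m + 1" unfolding j_def by linarith+
    have "real k \<le> z * 2 ^ m" using z(1) by (simp add: field_simps)
    then have kj: "k \<le> j" using j(1) by linarith
    have "z * 2 ^ m \<le> real (2 ^ m)" using z(2) by simp
    then have "\<lceil>z * 2 ^ m\<rceil> \<le> int (2 ^ m)" by (metis ceiling_le_iff of_int_of_nat_eq)
    then have j2: "j \<le> 2 ^ m" unfolding j_def by linarith
    have zj: "z \<le> real j / 2 ^ m" "real j / 2 ^ m \<le> z + 1 / 2 ^ m" "real j / 2 ^ m \<le> 1"
      using j j2 of_nat_mono[OF j2, where 'a = real] by (simp_all add: field_simps)
    have "F z - \<epsilon> * (z - real k / 2 ^ m) \<le> F (real j / 2 ^ m) - \<epsilon> * (real j / 2 ^ m - 1 / 2 ^ m - real k / 2 ^ m)"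
      using zj \<open>0 \<le> z\<close> eps by (intro diff_mono mono mult_left_mono) auto
    also have "\<dots> = (F (real (k + (j - k)) / 2 ^ m) - \<epsilon> * (real (j - k) / 2 ^ m)) + \<epsilon> / 2 ^ m"
      using kj by (simp add: of_nat_diff diff_divide_distrib algebra_simps)
    also have "F (real (k + (j - k)) / 2 ^ m) - \<epsilon> * (real (j - k) / 2 ^ m) \<le> M"
      unfolding M_def using j2 by (intro Max_ge imageI) auto
    finally show "F z - \<epsilon> * (z - real k / 2 ^ m) \<le> M + \<epsilon> / 2 ^ m" by simp
  qed
  from 1 2 show ?thesis by simp
qed

end

definition sun_slope :: "nat \<Rightarrow> (bool list \<Rightarrow> real) \<Rightarrow> bool list \<Rightarrow> real" where
  "sun_slope s f \<sigma> = 2 ^ length \<sigma> *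
     (rising_sun (1 / 2 ^ s) (distr_fun f) (real (bval \<sigma> + 1) / 2 ^ length \<sigma>)
      - rising_sun (1 / 2 ^ s) (distr_fun f) (real (bval \<sigma>) / 2 ^ length \<sigma>))"

text \<open>The increments of one function over the two halves of a cell add up to that over the
  cell, and they are nonnegative since the transform of a monotone function is monotone.\<close>

lemma martingale_sun_slope:
  assumes "martingale f" shows "martingale (sun_slope s f)"
proof (rule martingaleI)
  let ?G = "rising_sun (1 / 2 ^ s) (distr_fun f)"
  fix \<sigma>
  have "real (bval \<sigma> + 1) \<le> real (2 ^ length \<sigma>)" using bval_less[of \<sigma>] by (intro of_nat_mono) simp
  then have "?G (real (bval \<sigma>) / 2 ^ length \<sigma>) \<le> ?G (real (bval \<sigma> + 1) / 2 ^ length \<sigma>)"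
    by (intro rising_sun_mono distr_fun_mono[OF assms]) (auto simp: divide_right_mono)
  then show "0 \<le> sun_slope s f \<sigma>" unfolding sun_slope_def by simp
  have "real (2 * bval \<sigma> + 2) / 2 ^ Suc (length \<sigma>) = real (bval \<sigma> + 1) / 2 ^ length \<sigma>"
    "real (2 * bval \<sigma>) / 2 ^ Suc (length \<sigma>) = real (bval \<sigma>) / 2 ^ length \<sigma>"
    by (simp_all add: field_simps)
  then show "sun_slope s f (\<sigma> @ [False]) + sun_slope s f (\<sigma> @ [True]) = 2 * sun_slope s f \<sigma>"
    unfolding sun_slope_def by (simp add: algebra_simps)
qed

text \<open>The transform agrees with F at 1 and is at least F at 0, so its total rise is no
  larger.\<close>

lemma sun_slope_Nil_le:
  assumes f: "martingale f" shows "sun_slope s f [] \<le> f []"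
proof -
  have "distr_fun f 0 = 0" using distr_fun_dyadic[OF f, of 0 0] by (simp add: cdf_def)
  moreover have "distr_fun f 1 = f []" using distr_fun_dyadic[OF f, of 1 0] by (simp add: cdf_def)
  moreover have "distr_fun f 0 \<le> rising_sun (1 / 2 ^ s) (distr_fun f) 0"
    by (rule rising_sun_ge) (auto intro: distr_fun_mono[OF f])
  moreover have "rising_sun (1 / 2 ^ s) (distr_fun f) 1 = distr_fun f 1"
    by (simp add: rising_sun_def)
  ultimately show ?thesis by (simp add: sun_slope_def)
qed

lemma computable_martingale_sun_slope:
  assumes f: "computable_martingale f" shows "computable_martingale (sun_slope s f)"
  unfolding computable_martingale_iff
proof
  have m: "martingale f" using f by (rule computable_martingaleD)
  then show "martingale (sun_slope s f)" by (rule martingale_sun_slope)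
  let ?G = "rising_sun (1 / 2 ^ s) (distr_fun f)"
  \<comment> \<open>\<open>creal\<close> speaks about all inputs, while the transform is controlled
    only on [0,1]; numerators that leave the interval are replaced by 0. The right end point 1
    itself is kept.\<close>
  define kk where "kk x = (if p2 x \<le> 2 ^ p1 x then p2 x else 0)" for x
  have kk: "computable kk" unfolding kk_def by (intro cpt)
  have kk_le: "kk x \<le> 2 ^ p1 x" for x by (simp add: kk_def)
  \<comment> \<open>The maximum over the grid that is finer by \<open>p2 z\<close> levels; by
    \<open>rising_sun_grid\<close> its error is at most the required 2^-t for
    \<open>t = p2 z\<close>.\<close>
  define M where "M z = Max ((\<lambda>i. cdf f (p1 (p1 z) + p2 z) (kk (p1 z) * 2 ^ p2 z + i)
      - real i / 2 ^ (p1 (p1 z) + p2 z) / 2 ^ s) ` {..2 ^ (p1 (p1 z) + p2 z) - kk (p1 z) * 2 ^ p2 z})" for z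
  have M: "creal M"
    unfolding M_def cdf_def by (intro crl cpt f computable_comp[OF kk])
  have G: "creal (\<lambda>x. ?G (real (kk x) / 2 ^ p1 x))"
  proof (rule creal_limit[OF M])
    fix x t
    let ?m = "p1 x + t" and ?k = "kk x * 2 ^ t"
    have k: "?k \<le> 2 ^ ?m" using kk_le[of x] by (simp add: power_add)
    have e: "real (kk x) / 2 ^ p1 x = real ?k / 2 ^ ?m" by (simp add: power_add)
    have "M (pr x t) = Max ((\<lambda>i. distr_fun f (real (?k + i) / 2 ^ ?m) - 1 / 2 ^ s * (real i / 2 ^ ?m)) ` {..2 ^ ?m - ?k})"
      unfolding M_def distr_fun_dyadic[OF m] by (simp add: mult.commute)
    then have "\<bar>?G (real (kk x) / 2 ^ p1 x) - M (pr x t)\<bar> \<le> (1 / 2 ^ s) / 2 ^ ?m"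
      unfolding e using rising_sun_grid[OF _ distr_fun_mono[OF m] k, of "1 / 2 ^ s"] by simp
    also have "\<dots> = 1 / 2 ^ (s + p1 x + t)" by (simp add: power_add)
    also have "\<dots> \<le> 1 / 2 ^ t" by (intro divide_left_mono power_increasing) auto
    finally show "\<bar>?G (real (kk x) / 2 ^ p1 x) - M (pr x t)\<bar> \<le> 1 / 2 ^ t" .
  qed
  have "creal (\<lambda>z. 2 ^ p1 z *
     (?G (real (kk (pr (p1 z) (p2 z mod 2 ^ p1 z + 1))) / 2 ^ p1 (pr (p1 z) (p2 z mod 2 ^ p1 z + 1)))
      - ?G (real (kk (pr (p1 z) (p2 z mod 2 ^ p1 z))) / 2 ^ p1 (pr (p1 z) (p2 z mod 2 ^ p1 z)))))"
    by (intro crl creal_comp[OF G] cpt)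
  moreover have "kk (pr n (k mod 2 ^ n + 1)) = k mod 2 ^ n + 1" "kk (pr n (k mod 2 ^ n)) = k mod 2 ^ n" for n k
    using mod_less_divisor[of "2 ^ n" k] by (simp_all add: kk_def less_imp_le Suc_le_eq del: mod_less_divisor)
  ultimately show "creal (\<lambda>z. sun_slope s f (bits (p1 z) (p2 z)))"
    unfolding sun_slope_def by simp
qed

text \<open>\<open>rising_sun_slope_less\<close> for a single cell: the increment of the
  distribution function from its right end to a grid point is the mass of the cells in between. The
  linear term starts at the left end, hence \<open>j - k\<close> cells in the bound.\<close>

lemma sun_slope_less_right:
  assumes f: "martingale f" and k: "k < 2 ^ N" and less: "sun_slope s f (bits N k) < 1 / 2 ^ s"
    and j: "k < j" "j \<le> 2 ^ N"
  shows "(\<Sum>i\<in>{Suc k..<j}. f (bits N i)) \<le> real (j - k) / 2 ^ s"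
proof -
  let ?G = "rising_sun (1 / 2 ^ s) (distr_fun f)"
  let ?l = "real k / 2 ^ N" and ?r = "real (k + 1) / 2 ^ N" and ?z = "real j / 2 ^ N"
  have k1: "real (k + 1) \<le> 2 ^ N" "real j \<le> 2 ^ N" 
    using k of_nat_mono[of "k + 1" "2 ^ N", where 'a = real] of_nat_mono[OF j(2), where 'a = real] by simp_all
  have rl: "?r - ?l = 1 / 2 ^ N" by (simp add: add_divide_distrib)
  have "2 ^ N * (?G ?r - ?G ?l) < 1 / 2 ^ s"
    using less k by (simp add: sun_slope_def)
  then have less': "?G ?r - ?G ?l < 1 / 2 ^ s * (?r - ?l)" unfolding rl by (simp add: field_simps)
  have "distr_fun f ?z - distr_fun f ?r \<le> 1 / 2 ^ s * (?z - ?l)"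
  proof (rule rising_sun_slope_less[OF _ distr_fun_mono[OF f] _ _ _ less'])
    show "?l < ?r" by (simp add: divide_strict_right_mono)
    show "?r \<le> ?z" using j(1) by (intro divide_right_mono) auto
  qed (use k1 in auto)
  then have *: "cdf f N j - cdf f N (k + 1) \<le> real (j - k) / 2 ^ s / 2 ^ N"
    unfolding distr_fun_dyadic[OF f] using j(1) by (simp add: of_nat_diff diff_divide_distrib mult_ac)
  have "{..<j} = {..<Suc k} \<union> {Suc k..<j}" using j(1) by auto
  then have "(\<Sum>i<j. f (bits N i) / 2 ^ N) = (\<Sum>i<Suc k. f (bits N i) / 2 ^ N) + (\<Sum>i\<in>{Suc k..<j}. f (bits N i) / 2 ^ N)"
    by (simp only: sum.union_disjoint finite_lessThan finite_atLeastLessThan ivl_disj_int_one)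
  then have "(\<Sum>i\<in>{Suc k..<j}. f (bits N i)) / 2 ^ N = cdf f N j - cdf f N (k + 1)"
    unfolding cdf_def by (simp add: sum_divide_distrib)
  with * have "(\<Sum>i\<in>{Suc k..<j}. f (bits N i)) / 2 ^ N \<le> real (j - k) / 2 ^ s / 2 ^ N" by simp
  from mult_right_mono[OF this, of "2 ^ N"] show ?thesis by simp
qed

text \<open>A maximal inequality in martingale form. The factor \<open>2 ^ s\<close> turns slopes
  below \<open>1 / 2 ^ s\<close> into capital below 1, and the factor 2 is for the two directions.
  Cell k is left out because the transform says nothing about the mass of f inside it.\<close>

lemma maximal_martingale:
  assumes f: "computable_martingale f"
  obtains e where "computable_martingale e" "e [] \<le> 2 * 2 ^ s * f []"
    and "\<And>N k a b. k < 2 ^ N \<Longrightarrow> e (bits N k) < 1 \<Longrightarrow> a \<le> k \<Longrightarrow> k < b \<Longrightarrow> b \<le> 2 ^ N \<Longrightarrow>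
      (\<Sum>i\<in>{a..<b} - {k}. f (bits N i)) \<le> real (b - a + 1) / 2 ^ s"
proof -
  define f' where "f' = (\<lambda>\<sigma>. f (map Not \<sigma>))"
  have f': "computable_martingale f'" unfolding f'_def by (rule computable_martingale_map_Not[OF f])
  note m = computable_martingaleD(1)[OF f] and m' = computable_martingaleD(1)[OF f']
  define e where "e \<sigma> = 2 ^ s * sun_slope s f \<sigma> + 2 ^ s * sun_slope s f' (map Not \<sigma>)" for \<sigma>
  have ce: "computable_martingale e"
    unfolding e_def
    by (intro computable_martingale_add computable_martingale_scale(1) computable_martingale_sun_slope f
        computable_martingale_map_Not f')
  have "sun_slope s f [] \<le> f []" "sun_slope s f' [] \<le> f []"
    using sun_slope_Nil_le[OF m] sun_slope_Nil_le[OF m'] by (simp_all add: f'_def)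
  then have "2 ^ s * sun_slope s f [] \<le> 2 ^ s * f []" "2 ^ s * sun_slope s f' [] \<le> 2 ^ s * f []"
    by (intro mult_left_mono; simp)+
  moreover have "e [] = 2 ^ s * sun_slope s f [] + 2 ^ s * sun_slope s f' []" by (simp add: e_def)
  moreover have "2 * 2 ^ s * f [] = 2 ^ s * f [] + 2 ^ s * f []" by simp
  ultimately have eN: "e [] \<le> 2 * 2 ^ s * f []" by linarith
  show thesis
  proof (rule that[OF ce eN])
    fix N k a b :: nat
    assume k: "k < 2 ^ N" and e: "e (bits N k) < 1" and ab: "a \<le> k" "k < b" "b \<le> 2 ^ N"
    \<comment> \<open>The index of the mirror image of cell i; sums to the left of k become sums to
      the right of \<open>R k\<close>.\<close>
    define R where "R i = 2 ^ N - 1 - i" for i :: nat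
    have nn: "0 \<le> sun_slope s f (bits N k)" "0 \<le> sun_slope s f' (bits N (R k))"
      by (intro martingale_nonneg martingale_sun_slope m m')+
    have Rk: "map Not (bits N k) = bits N (R k)" using k by (simp add: map_Not_bits R_def)
    have "2 ^ s * sun_slope s f (bits N k) < 1" "2 ^ s * sun_slope s f' (bits N (R k)) < 1"
      using e nn unfolding e_def Rk by (smt (verit) mult_nonneg_nonneg zero_le_power)+
    then have less: "sun_slope s f (bits N k) < 1 / 2 ^ s" "sun_slope s f' (bits N (R k)) < 1 / 2 ^ s"
      by (simp_all add: field_simps)
    have 1: "(\<Sum>i\<in>{Suc k..<b}. f (bits N i)) \<le> real (b - k) / 2 ^ s"
      using sun_slope_less_right[OF m k less(1) ab(2,3)] .
    have "(\<Sum>i\<in>{Suc (R k)..<2 ^ N - a}. f' (bits N i)) \<le> real (2 ^ N - a - R k) / 2 ^ s"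
      by (rule sun_slope_less_right[OF m' _ less(2)]) (use k ab in \<open>auto simp: R_def\<close>)
    also have "(\<Sum>i\<in>{Suc (R k)..<2 ^ N - a}. f' (bits N i)) = (\<Sum>i\<in>{a..<k}. f (bits N i))"
    proof (rule sum.reindex_bij_witness[of _ R R])
      fix i assume i: "i \<in> {Suc (R k)..<2 ^ N - a}"
      show "R (R i) = i" "R i \<in> {a..<k}" using i k unfolding R_def by auto
      have "i < 2 ^ N" using i by auto
      then show "f (bits N (R i)) = f' (bits N i)" by (simp add: f'_def map_Not_bits R_def)
    next
      fix i assume i: "i \<in> {a..<k}"
      show "R (R i) = i" "R i \<in> {Suc (R k)..<2 ^ N - a}" using i k unfolding R_def by auto
    qed
    also have "2 ^ N - a - R k = k + 1 - a" using k ab by (simp add: R_def)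
    finally have 2: "(\<Sum>i\<in>{a..<k}. f (bits N i)) \<le> real (k + 1 - a) / 2 ^ s" .
    have "{a..<b} - {k} = {a..<k} \<union> {Suc k..<b}" using ab by auto
    then have "(\<Sum>i\<in>{a..<b} - {k}. f (bits N i)) = (\<Sum>i\<in>{a..<k}. f (bits N i)) + (\<Sum>i\<in>{Suc k..<b}. f (bits N i))"
      by (simp add: sum.union_disjoint)
    also have "\<dots> \<le> real (k + 1 - a) / 2 ^ s + real (b - k) / 2 ^ s" using 1 2 by simp
    \<comment> \<open>Cell k is counted from both sides, hence the additional 1.\<close>
    also have "\<dots> = real (b - a + 1) / 2 ^ s" using ab by (simp add: of_nat_diff add_divide_distrib[symmetric])
    finally show "(\<Sum>i\<in>{a..<b} - {k}. f (bits N i)) \<le> real (b - a + 1) / 2 ^ s" .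
  qed
qed

section \<open>Dyadic intervals\<close>

definition dint :: "bool list \<Rightarrow> real set" where
  "dint \<sigma> = {real (bval \<sigma>) / 2 ^ length \<sigma> .. real (bval \<sigma> + 1) / 2 ^ length \<sigma>}"

lemma dint_append:
  "dint (\<tau> @ \<rho>) = {real (bval \<tau>) / 2 ^ length \<tau> + real (bval \<rho>) / 2 ^ (length \<tau> + length \<rho>) ..
     real (bval \<tau>) / 2 ^ length \<tau> + real (bval \<rho> + 1) / 2 ^ (length \<tau> + length \<rho>)}"
  by (simp add: dint_def bval_append power_add add_divide_distrib)

lemma bval_bounds: "0 \<le> real (bval \<rho>) / 2 ^ length \<rho>" "real (bval \<rho> + 1) / 2 ^ length \<rho> \<le> 1"
proof -
  have "real (bval \<rho> + 1) \<le> real (2 ^ length \<rho>)" using bval_less[of \<rho>] by (intro of_nat_mono) simp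
  then show "real (bval \<rho> + 1) / 2 ^ length \<rho> \<le> 1" by simp
qed simp

lemma dint_append_subset: "dint (\<tau> @ \<rho>) \<subseteq> dint \<tau>"
proof -
  have "real (bval \<rho> + 1) / 2 ^ (length \<tau> + length \<rho>) \<le> 1 / 2 ^ length \<tau>"
    using divide_right_mono[OF bval_bounds(2)[of \<rho>], of "2 ^ length \<tau>"] by (simp add: power_add mult.commute)
  then show ?thesis unfolding dint_append unfolding dint_def by (auto simp: add_divide_distrib)
qed

lemma bval_pos: "True \<in> set \<rho> \<Longrightarrow> 0 < bval \<rho>"
  by (induction \<rho> rule: rev_induct) auto

lemma bval_less_pred: "False \<in> set \<rho> \<Longrightarrow> bval \<rho> + 1 < 2 ^ length \<rho>"
proof (induction \<rho> rule: rev_induct)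
  case (snoc b \<rho>)
  then show ?case using bval_less[of \<rho>] by (cases b) auto
qed simp

text \<open>A bit 1 moves the left end point inwards and a bit 0 the right one. Extending every
  condition by both bits puts the generic point strictly inside the interval of each condition, so
  that small neighbourhoods stay there.\<close>

lemma dint_append_interior:
  assumes "True \<in> set \<rho>" "False \<in> set \<rho>"
  shows "dint (\<tau> @ \<rho>) \<subseteq> {real (bval \<tau>) / 2 ^ length \<tau> <..< real (bval \<tau> + 1) / 2 ^ length \<tau>}"
proof -
  have "real (bval \<rho> + 1) < real (2 ^ length \<rho>)" using bval_less_pred[OF assms(2)] by (simp only: of_nat_less_iff)
  then have "real (bval \<rho> + 1) / 2 ^ (length \<tau> + length \<rho>) < 2 ^ length \<rho> / 2 ^ (length \<tau> + length \<rho>)"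
    by (intro divide_strict_right_mono) simp_all
  then have "real (bval \<rho> + 1) / 2 ^ (length \<tau> + length \<rho>) < 1 / 2 ^ length \<tau>"
    by (simp add: power_add)
  moreover have "0 < real (bval \<rho>) / 2 ^ (length \<tau> + length \<rho>)"
    using bval_pos[OF assms(1)] by simp
  ultimately show ?thesis unfolding dint_append by (auto simp: add_divide_distrib)
qed

lemma closed_dint: "closed (dint \<sigma>)"
  by (simp add: dint_def)

section \<open>Conditions\<close>

definition adm :: "(bool list \<Rightarrow> real) \<Rightarrow> bool list \<Rightarrow> bool" where
  "adm d \<pi> \<longleftrightarrow> (\<forall>i\<le>length \<pi>. d (take i \<pi>) < 1)"

text \<open>
  In a condition \<open>(\<tau>, d)\<close> the martingale \<open>d\<close> bets on the bits after \<open>\<tau>\<close>. The condition stands for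
  the set of all sequences that extend \<open>\<tau>\<close> and on which \<open>d\<close> stays below \<open>1\<close>.
\<close>

type_synonym condition = "bool list \<times> (bool list \<Rightarrow> real)"

definition valid_cond :: "condition \<Rightarrow> bool" where
  "valid_cond c \<longleftrightarrow> computable_martingale (snd c) \<and> snd c [] < 1"

definition cond_set :: "condition \<Rightarrow> bool list set" where
  "cond_set c = {fst c @ \<pi> | \<pi>. adm (snd c) \<pi>}"

text \<open>Only the sets of allowed strings are compared, because in \<open>avoid_or_dense\<close>
  the new martingale need not dominate the old one.\<close>

definition stronger :: "condition \<Rightarrow> condition \<Rightarrow> bool" where
  "stronger c' c \<longleftrightarrow> valid_cond c' \<and> cond_set c' \<subseteq> cond_set c"

lemma stronger_trans: "stronger c'' c' \<Longrightarrow> stronger c' c \<Longrightarrow> stronger c'' c"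
  unfolding stronger_def by blast

lemma stronger_refl: "valid_cond c \<Longrightarrow> stronger c c"
  unfolding stronger_def by blast

lemma adm_less: "adm d \<pi> \<Longrightarrow> d \<pi> < 1"
  unfolding adm_def by (metis le_refl take_all)

lemma adm_Nil [simp]: "adm d [] \<longleftrightarrow> d [] < 1"
  by (simp add: adm_def)

lemma adm_take: "adm d \<pi> \<Longrightarrow> adm d (take j \<pi>)"
  unfolding adm_def by (auto simp: min_def)

lemma adm_append: "adm d (\<pi> @ \<rho>) \<longleftrightarrow> adm d \<pi> \<and> adm (\<lambda>\<rho>. d (\<pi> @ \<rho>)) \<rho>"
proof (intro iffI conjI)
  assume a: "adm d (\<pi> @ \<rho>)"
  show "adm d \<pi>" using adm_take[OF a, of "length \<pi>"] by simp
  show "adm (\<lambda>\<rho>. d (\<pi> @ \<rho>)) \<rho>" unfolding adm_def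
  proof (intro allI impI)
    fix i assume "i \<le> length \<rho>"
    then show "d (\<pi> @ take i \<rho>) < 1" using a[unfolded adm_def, rule_format, of "length \<pi> + i"] by simp
  qed
next
  assume a: "adm d \<pi> \<and> adm (\<lambda>\<rho>. d (\<pi> @ \<rho>)) \<rho>"
  show "adm d (\<pi> @ \<rho>)" unfolding adm_def
  proof (intro allI impI)
    fix i assume i: "i \<le> length (\<pi> @ \<rho>)"
    show "d (take i (\<pi> @ \<rho>)) < 1"
    proof (cases "i \<le> length \<pi>")
      case True
      then show ?thesis using a by (simp add: adm_def)
    next
      case False
      then show ?thesis using a i by (auto simp: adm_def)
    qed
  qed
qed

lemma adm_snoc: "adm d (\<pi> @ [b]) \<longleftrightarrow> adm d \<pi> \<and> d (\<pi> @ [b]) < 1"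
  unfolding adm_append by (auto simp: adm_def le_Suc_eq dest: spec[of _ "length \<pi>"])

text \<open>By fairness one of the two children has no more capital than its parent.\<close>

lemma adm_extend:
  assumes "martingale d" "d [] < 1"
  shows "\<exists>\<pi>. length \<pi> = n \<and> adm d \<pi>"
proof (induction n)
  case 0
  then show ?case using assms(2) by simp
next
  case (Suc n)
  then obtain \<pi> where \<pi>: "length \<pi> = n" "adm d \<pi>" by blast
  have "d (\<pi> @ [False]) < 1 \<or> d (\<pi> @ [True]) < 1"
    using martingale_split[OF assms(1), of \<pi>] adm_less[OF \<pi>(2)] by linarith
  with \<pi> show ?case by (metis adm_snoc length_append_singleton)
qed

lemma reroot:
  assumes "valid_cond (\<tau>, d)" "adm d \<pi>"
  shows "stronger (\<tau> @ \<pi>, \<lambda>\<rho>. d (\<pi> @ \<rho>)) (\<tau>, d)"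
proof -
  have "valid_cond (\<tau> @ \<pi>, \<lambda>\<rho>. d (\<pi> @ \<rho>))"
    using assms adm_less[OF assms(2)] by (simp add: valid_cond_def computable_martingale_append)
  moreover have "cond_set (\<tau> @ \<pi>, \<lambda>\<rho>. d (\<pi> @ \<rho>)) \<subseteq> cond_set (\<tau>, d)"
  proof
    fix \<sigma> assume "\<sigma> \<in> cond_set (\<tau> @ \<pi>, \<lambda>\<rho>. d (\<pi> @ \<rho>))"
    then obtain \<rho> where "\<sigma> = \<tau> @ (\<pi> @ \<rho>)" "adm (\<lambda>\<rho>. d (\<pi> @ \<rho>)) \<rho>" by (auto simp: cond_set_def)
    with assms(2) show "\<sigma> \<in> cond_set (\<tau>, d)" unfolding cond_set_def fst_conv snd_conv
      using adm_append by blast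
  qed
  ultimately show ?thesis by (simp add: stronger_def)
qed

lemma power2_ge_ex: "\<exists>m. (x::real) < 2 ^ m"
  using real_arch_pow[of 2 x] by simp

lemma bound_martingale:
  assumes c: "valid_cond (\<tau>, d)" and e: "computable_martingale e"
  shows "\<exists>c'. stronger c' (\<tau>, d) \<and> (\<exists>m. \<forall>\<sigma>\<in>cond_set c'. e \<sigma> < 2 ^ m)"
proof -
  have d: "computable_martingale d" "d [] < 1" using c by (simp_all add: valid_cond_def)
  have e0: "0 \<le> e \<sigma>" and d0: "0 \<le> d \<sigma>" for \<sigma>
    using martingale_nonneg computable_martingaleD(1) e d(1) by blast+
  \<comment> \<open>m makes the added initial capital smaller than the room
    \<open>1 - d []\<close>.\<close>
  obtain m where "e \<tau> / (1 - d []) < 2 ^ m" using power2_ge_ex by blast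
  then have m: "d [] + e \<tau> / 2 ^ m < 1" using d(2) by (simp add: field_simps)
  define d' where "d' \<pi> = d \<pi> + e (\<tau> @ \<pi>) / 2 ^ m" for \<pi>
  have "computable_martingale d'"
    unfolding d'_def
    by (intro computable_martingale_add computable_martingale_scale(2)[of "\<lambda>\<pi>. e (\<tau> @ \<pi>)"]
        computable_martingale_append d(1) e)
  then have "valid_cond (\<tau>, d')" using m by (simp add: valid_cond_def d'_def)
  moreover have "adm d \<pi>" if "adm d' \<pi>" for \<pi>
    using that e0 unfolding adm_def d'_def
    by (meson add_less_cancel_left divide_nonneg_nonneg le_less_trans le_add_same_cancel1 zero_le_numeral zero_le_power)
  then have "cond_set (\<tau>, d') \<subseteq> cond_set (\<tau>, d)" by (auto simp: cond_set_def)
  moreover have "e \<sigma> < 2 ^ m" if "\<sigma> \<in> cond_set (\<tau>, d')" for \<sigma>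
  proof -
    obtain \<pi> where \<pi>: "\<sigma> = \<tau> @ \<pi>" "adm d' \<pi>" using \<open>\<sigma> \<in> cond_set (\<tau>, d')\<close> by (auto simp: cond_set_def)
    have "d \<pi> + e \<sigma> / 2 ^ m < 1" using adm_less[OF \<pi>(2)] by (simp add: d'_def \<pi>(1))
    then have "e \<sigma> / 2 ^ m < 1" using d0[of \<pi>] by linarith
    then show ?thesis by simp
  qed
  ultimately show ?thesis unfolding stronger_def by (intro exI[of _ "(\<tau>, d')"]) auto
qed

text \<open>
  If only repetitions of one bit were admissible, the deficit \<open>1 - d\<close> would double along them.
\<close>

lemma adm_contains_bit:
  assumes d: "martingale d" and "d [] < 1"
  shows "\<exists>\<pi>. adm d \<pi> \<and> b \<in> set \<pi>"
proof (rule ccontr)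
  assume "\<not> ?thesis"
  then have no: "\<not> adm d \<pi>" if "b \<in> set \<pi>" for \<pi> using that by blast
  have "adm d (replicate n (\<not> b)) \<and> 2 ^ n * (1 - d []) \<le> 1 - d (replicate n (\<not> b))" for n
  proof (induction n)
    case 0
    then show ?case using assms(2) by simp
  next
    case (Suc n)
    let ?\<pi> = "replicate n (\<not> b)"
    have r: "replicate (Suc n) (\<not> b) = ?\<pi> @ [\<not> b]" by (simp add: replicate_append_same)
    have "1 \<le> d (?\<pi> @ [b])" using no[of "?\<pi> @ [b]"] Suc by (auto simp: adm_snoc)
    moreover have "d (?\<pi> @ [b]) + d (?\<pi> @ [\<not> b]) = 2 * d ?\<pi>"
      using martingale_split[OF d, of ?\<pi>] by (cases b) simp_all
    ultimately have *: "2 * (1 - d ?\<pi>) \<le> 1 - d (?\<pi> @ [\<not> b])" by simp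
    have "d ?\<pi> < 1" using Suc adm_less by blast
    moreover have "q < 1" if "2 * (1 - p) \<le> 1 - q" "p < 1" for p q :: real using that by argo
    ultimately have "d (?\<pi> @ [\<not> b]) < 1" using * by blast
    moreover have "2 ^ Suc n * (1 - d []) \<le> 1 - d (?\<pi> @ [\<not> b])" using * Suc by simp
    ultimately show ?case unfolding r using Suc by (simp add: adm_snoc)
  qed
  then have "2 ^ n * (1 - d []) \<le> 1" for n
    using martingale_nonneg[OF d, of "replicate n (\<not> b)"] by (smt (verit))
  moreover obtain n where "1 / (1 - d []) < 2 ^ n" using power2_ge_ex by blast
  then have "1 < 2 ^ n * (1 - d [])" using assms(2) by (simp add: field_simps)
  ultimately show False by (simp add: not_less[symmetric])
qed

lemma both_bits:
  assumes c: "valid_cond (\<tau>, d)"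
  shows "\<exists>\<rho> d'. stronger (\<tau> @ \<rho>, d') (\<tau>, d) \<and> True \<in> set \<rho> \<and> False \<in> set \<rho>"
proof -
  have one: "\<exists>\<rho> d'. stronger (\<tau> @ \<rho>, d') (\<tau>, d) \<and> b \<in> set \<rho>" if "valid_cond (\<tau>, d)" for \<tau> d b
  proof -
    have "martingale d" "d [] < 1" using that computable_martingaleD(1) by (auto simp: valid_cond_def)
    then obtain \<pi> where "adm d \<pi>" "b \<in> set \<pi>" using adm_contains_bit by blast
    then show ?thesis using reroot[OF that] by blast
  qed
  obtain \<rho> d' where 1: "stronger (\<tau> @ \<rho>, d') (\<tau>, d)" "True \<in> set \<rho>" using one[OF c] by blast
  then have "valid_cond (\<tau> @ \<rho>, d')" by (simp add: stronger_def)
  then obtain \<rho>' d'' where 2: "stronger ((\<tau> @ \<rho>) @ \<rho>', d'') (\<tau> @ \<rho>, d')" "False \<in> set \<rho>'" using one by blast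
  have "stronger (\<tau> @ (\<rho> @ \<rho>'), d'') (\<tau>, d)" using stronger_trans[OF 2(1) 1(1)] by simp
  with 1 2 show ?thesis by (intro exI[of _ "\<rho> @ \<rho>'"] exI[of _ d'']) simp
qed

section \<open>A test that captures a point of every condition\<close>

text \<open>Being below 1 is not decidable but can be certified by an approximation, so an allowed
  string of each length is found by search. The strings for different N need not extend one another;
  the test uses one length at a time. Below the length of \<open>\<tau>\<close> the string is a
  prefix of \<open>\<tau>\<close>.\<close>

lemma computable_member:
  assumes c: "valid_cond (\<tau>, d)"
  shows "\<exists>h. computable h \<and> (\<forall>N. \<exists>\<sigma>. length \<sigma> = N \<and> h N = bval \<sigma> \<and>
     (if length \<tau> \<le> N then \<exists>\<pi>. adm d \<pi> \<and> \<sigma> = \<tau> @ \<pi> else \<sigma> = take N \<tau>))"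
proof -
  have d: "computable_martingale d" "d [] < 1" using c by (simp_all add: valid_cond_def)
  note m = computable_martingaleD(1)[OF d(1)]
  obtain A B where AB: "computable A" "computable B"
    "\<And>x n. \<bar>d (bits (p1 x) (p2 x)) - (real (A (pr x n)) - real (B (pr x n))) / 2 ^ n\<bar> \<le> 1 / 2 ^ n"
    using creal_E[OF computable_martingaleD(2)[OF d(1)]] by blast
  \<comment> \<open>z pairs a string with a precision p; the inequality says that the approximation
    at every prefix is below 1 - 2^-p, which certifies a value below 1.\<close>
  define P where "P M z \<longleftrightarrow> p1 z < 2 ^ M \<and> (\<forall>j<Suc M.
      A (pr (pr j (p1 z div 2 ^ (M - j))) (p2 z)) + 1 < 2 ^ p2 z + B (pr (pr j (p1 z div 2 ^ (M - j))) (p2 z)))" for M z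
  have ex: "\<exists>z. P M z" for M
  proof -
    obtain \<pi> where \<pi>: "length \<pi> = M" "adm d \<pi>" using adm_extend[OF m d(2)] by blast
    define D where "D = Max ((\<lambda>j. d (take j \<pi>)) ` {..M})"
    have D1: "D < 1" unfolding D_def using \<pi> by (subst Max_less_iff) (auto simp: adm_def)
    have D2: "d (take j \<pi>) \<le> D" if "j \<le> M" for j unfolding D_def using that by (intro Max_ge) auto
    \<comment> \<open>This leaves room for two terms 2^-p between D and 1: the approximation error
      and the margin demanded by \<open>P\<close>.\<close>
    obtain p where "2 / (1 - D) < 2 ^ p" using power2_ge_ex by blast
    then have p: "D * 2 ^ p + 2 < 2 ^ p" using D1 by (simp add: field_simps)
    have "P M (pr (bval \<pi>) p)" unfolding P_def p1_pr p2_pr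
    proof (intro conjI allI impI)
      show "bval \<pi> < 2 ^ M" using bval_less[of \<pi>] \<pi> by simp
      fix j assume "j < Suc M"
      then have j: "j \<le> M" by simp
      let ?x = "pr j (bval \<pi> div 2 ^ (M - j))"
      have "bits j (bval \<pi> div 2 ^ (M - j)) = take j \<pi>"
        using take_bits[OF j, of "bval \<pi>"] \<pi>(1) bits_bval[of \<pi>] by simp
      then have "\<bar>d (take j \<pi>) - (real (A (pr ?x p)) - real (B (pr ?x p))) / 2 ^ p\<bar> \<le> 1 / 2 ^ p"
        using AB(3)[of ?x p] by simp
      then have "(real (A (pr ?x p)) - real (B (pr ?x p))) / 2 ^ p \<le> D + 1 / 2 ^ p"
        using D2[OF j] by linarith
      then have "real (A (pr ?x p)) - real (B (pr ?x p)) \<le> D * 2 ^ p + 1"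
        by (simp add: pos_divide_le_eq distrib_right)
      then have "real (A (pr ?x p)) + 1 < 2 ^ p + real (B (pr ?x p))" using p by linarith
      then have "real (A (pr ?x p) + 1) < real (2 ^ p + B (pr ?x p))" by simp
      then show "A (pr ?x p) + 1 < 2 ^ p + B (pr ?x p)" by (simp only: of_nat_less_iff)
    qed
    then show ?thesis by blast
  qed
  have sound: "adm d (bits M (p1 z))" if "P M z" for M z
    unfolding adm_def
  proof (intro allI impI)
    fix j assume j: "j \<le> length (bits M (p1 z))"
    let ?x = "pr j (p1 z div 2 ^ (M - j))"
    have "A (pr ?x (p2 z)) + 1 < 2 ^ p2 z + B (pr ?x (p2 z))" using that j by (simp add: P_def)
    then have "real (A (pr ?x (p2 z)) + 1) < real (2 ^ p2 z + B (pr ?x (p2 z)))" by (simp only: of_nat_less_iff)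
    then have "(real (A (pr ?x (p2 z))) - real (B (pr ?x (p2 z)))) / 2 ^ p2 z < (2 ^ p2 z - 1) / 2 ^ p2 z"
      by (intro divide_strict_right_mono) simp_all
    then have "(real (A (pr ?x (p2 z))) - real (B (pr ?x (p2 z)))) / 2 ^ p2 z < 1 - 1 / 2 ^ p2 z"
      by (simp add: diff_divide_distrib)
    moreover have "take j (bits M (p1 z)) = bits j (p1 z div 2 ^ (M - j))" using j by (simp add: take_bits)
    ultimately show "d (take j (bits M (p1 z))) < 1" using AB(3)[of ?x "p2 z"] by (simp add: abs_le_iff)
  qed
  define k where "k M = p1 (LEAST z. P M z)" for M
  have kP: "k M < 2 ^ M" "adm d (bits M (k M))" for M
    using LeastI_ex[OF ex[of M]] sound by (auto simp: k_def P_def)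
  have ck: "computable k"
    unfolding k_def P_def
    by (intro cpt computable_Least computable_comp[OF AB(1)] computable_comp[OF AB(2)] ex[unfolded P_def])
  define h where "h N = (if length \<tau> \<le> N then bval \<tau> * 2 ^ (N - length \<tau>) + k (N - length \<tau>)
    else bval \<tau> div 2 ^ (length \<tau> - N))" for N
  have "computable h" unfolding h_def by (intro cpt computable_comp[OF ck])
  moreover have "\<exists>\<sigma>. length \<sigma> = N \<and> h N = bval \<sigma> \<and>
     (if length \<tau> \<le> N then \<exists>\<pi>. adm d \<pi> \<and> \<sigma> = \<tau> @ \<pi> else \<sigma> = take N \<tau>)" for N
  proof (cases "length \<tau> \<le> N")
    case True
    then show ?thesis using kP[of "N - length \<tau>"]
      by (intro exI[of _ "\<tau> @ bits (N - length \<tau>) (k (N - length \<tau>))"]) (auto simp: h_def bval_append)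
  next
    case False
    then have "take N \<tau> = bits N (bval \<tau> div 2 ^ (length \<tau> - N))"
      using take_bits[of N "length \<tau>" "bval \<tau>"] by simp
    moreover have "bval \<tau> div 2 ^ (length \<tau> - N) < 2 ^ N"
    proof (rule less_mult_imp_div_less)
      show "bval \<tau> < 2 ^ N * 2 ^ (length \<tau> - N)" using False bval_less[of \<tau>] by (simp flip: power_add)
    qed
    ultimately show ?thesis using False
      by (intro exI[of _ "take N \<tau>"]) (simp add: h_def)
  qed
  ultimately show ?thesis by blast
qed

text \<open>Every condition allows strings computed by some program e. Component n guards against e
  by an interval at level n + e + 3 around the value of e there, so the measures sum to at most 3/4
  of 2^-n over all e.\<close>

lemma capturing_test:
  obtains U where "uniformly_ce_open U" "\<And>n. emeasure lborel (U n) \<le> ennreal ((1/2) ^ n)"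
    and "\<And>c n. valid_cond c \<Longrightarrow> \<exists>c'. stronger c' c \<and> dint (fst c') \<subseteq> U n"
proof -
  obtain Q where Q: "dec Q"
    "\<And>e n y w y' w'. Q (pr e (pr n (pr y w))) \<Longrightarrow> Q (pr e (pr n (pr y' w'))) \<Longrightarrow> y = y'"
    "\<And>h. computable h \<Longrightarrow> \<exists>e. \<forall>n. \<exists>w. Q (pr e (pr n (pr (h n) w)))"
    by (rule universal_computable) blast
  \<comment> \<open>Indices have the form \<open>z = pr n (pr e (pr y w))\<close>: in component n, w
    certifies that program e has the value y at the argument \<open>N z\<close>.\<close>
  define N where "N z = p1 z + p1 (p2 z) + 3" for z
  define T where "T z \<longleftrightarrow> Q (pr (p1 (p2 z)) (pr (N z) (p2 (p2 z))))" for z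
  define y where "y z = p1 (p2 (p2 z))" for z
  have N: "computable N" unfolding N_def by (intro cpt)
  have T: "dec T" unfolding T_def by (intro dec_comp[OF Q(1)] cpt N)
  \<comment> \<open>Without a certificate both end points are 0 and the interval is empty.\<close>
  define a :: "nat \<Rightarrow> rat" where "a z = (of_nat (if T z then y z else 0) - of_nat (if T z then 1 else 0)) / of_nat (Suc (2 ^ N z - 1))" for z
  define b :: "nat \<Rightarrow> rat" where "b z = (of_nat (if T z then y z + 2 else 0) - of_nat 0) / of_nat (Suc (2 ^ N z - 1))" for z
  have ab: "computable_rat_seq a" "computable_rat_seq b"
    unfolding a_def b_def y_def by (intro computable_rat_seq_I cpt N T)+
  \<comment> \<open>Three cells instead of one: an open interval has to contain the closed cell in
    the middle.\<close>
  define I :: "nat \<Rightarrow> nat \<Rightarrow> real set" where "I m j = {(real j - 1) / 2 ^ m <..< (real j + 2) / 2 ^ m}" for m j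
  have int: "{of_rat (a z) <..< of_rat (b z)} = (if T z then I (N z) (y z) else {})" for z
    by (auto simp: a_def b_def I_def of_rat_divide of_rat_diff of_rat_add of_rat_power add.commute)
  define U where "U n = (\<Union>k. {of_rat (a (pr n k)) <..< of_rat (b (pr n k))} :: real set)" for n
  have U: "U n = (\<Union>k. if T (pr n k) then I (N (pr n k)) (y (pr n k)) else {})" for n
    unfolding U_def int by (rule refl)
  show thesis
  proof (rule that[of U])
    show "uniformly_ce_open U"
      unfolding uniformly_ce_open_def using ab by (intro exI[of _ a] exI[of _ b]) (simp add: U_def)
  next
    fix n
    \<comment> \<open>Many witnesses w may certify the same value; since the value is unique, they
      all give the one interval \<open>V e\<close>.\<close>
    define V where "V e = (if \<exists>y w. Q (pr e (pr (n + e + 3) (pr y w)))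
      then I (n + e + 3) (SOME y. \<exists>w. Q (pr e (pr (n + e + 3) (pr y w)))) else {})" for e
    have "U n \<subseteq> (\<Union>e. V e)"
    proof
      fix x assume "x \<in> U n"
      then obtain k where k: "T (pr n k)" "x \<in> I (N (pr n k)) (y (pr n k))" unfolding U by (auto split: if_splits)
      obtain e j w where kk: "k = pr e (pr j w)" by (metis pr_p1_p2)
      have q: "Q (pr e (pr (n + e + 3) (pr j w)))" and x: "x \<in> I (n + e + 3) j"
        using k by (simp_all add: T_def N_def y_def kk)
      have "(SOME y. \<exists>w. Q (pr e (pr (n + e + 3) (pr y w)))) = j"
        using q Q(2) by (intro some_equality) blast+
      with q x have "x \<in> V e" by (auto simp: V_def)
      then show "x \<in> (\<Union>e. V e)" by blast
    qed
    then have "emeasure lborel (U n) \<le> emeasure lborel (\<Union>e. V e)"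
      by (rule emeasure_mono) (auto simp: V_def I_def)
    also have "\<dots> \<le> (\<Sum>e. emeasure lborel (V e))"
      by (rule emeasure_subadditive_countably) (auto simp: V_def I_def)
    also have "\<dots> \<le> (\<Sum>e. ennreal (3 / 2 ^ (n + 3) * (1 / 2) ^ e))"
    proof (rule suminf_le)
      fix e
      have "emeasure lborel (I (n + e + 3) j) = ennreal (3 / 2 ^ (n + 3) * (1 / 2) ^ e)" for j
        by (simp add: I_def divide_right_mono power_add power_one_over field_simps)
      then show "emeasure lborel (V e) \<le> ennreal (3 / 2 ^ (n + 3) * (1 / 2) ^ e)" by (simp add: V_def)
    qed auto
    also have "\<dots> = ennreal (3 / 2 ^ (n + 3) * 2)"
    proof (rule suminf_ennreal_eq)
      have "(\<lambda>e. (1 / 2 :: real) ^ e) sums 2" using geometric_sums[of "1 / 2 :: real"] by simp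
      then show "(\<lambda>e. 3 / 2 ^ (n + 3) * (1 / 2) ^ e) sums (3 / 2 ^ (n + 3) * 2 :: real)" by (rule sums_mult)
    qed simp
    also have "\<dots> \<le> ennreal ((1/2) ^ n)"
      by (intro ennreal_leI) (simp add: power_add power_one_over field_simps)
    finally show "emeasure lborel (U n) \<le> ennreal ((1/2) ^ n)" .
  next
    fix c n assume "valid_cond c"
    then obtain \<tau> d where c: "c = (\<tau>, d)" "valid_cond (\<tau>, d)" by (cases c) auto
    obtain h where h: "computable h" "\<And>N. \<exists>\<sigma>. length \<sigma> = N \<and> h N = bval \<sigma> \<and>
       (if length \<tau> \<le> N then \<exists>\<pi>. adm d \<pi> \<and> \<sigma> = \<tau> @ \<pi> else \<sigma> = take N \<tau>)"
      using computable_member[OF c(2)] by blast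
    obtain e where e: "\<And>n. \<exists>w. Q (pr e (pr n (pr (h n) w)))" using Q(3)[OF h(1)] by blast
    define m where "m = n + e + 3"
    obtain w where w: "Q (pr e (pr m (pr (h m) w)))" using e by blast
    define k where "k = pr e (pr (h m) w)"
    have "T (pr n k)" "N (pr n k) = m" "y (pr n k) = h m"
      using w by (simp_all add: T_def N_def y_def k_def m_def)
    then have IU: "I m (h m) \<subseteq> U n" unfolding U by force
    obtain \<sigma> where \<sigma>: "length \<sigma> = m" "h m = bval \<sigma>"
       "if length \<tau> \<le> m then \<exists>\<pi>. adm d \<pi> \<and> \<sigma> = \<tau> @ \<pi> else \<sigma> = take m \<tau>"
      using h(2) by blast
    have "(real (bval \<sigma>) - 1) / 2 ^ m < real (bval \<sigma>) / 2 ^ m"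
      "real (bval \<sigma> + 1) / 2 ^ m < (real (bval \<sigma>) + 2) / 2 ^ m"
      by (intro divide_strict_right_mono; simp)+
    then have "dint \<sigma> \<subseteq> I m (h m)"
      unfolding dint_def I_def \<sigma>(1) \<sigma>(2) by auto
    with IU have dU: "dint \<sigma> \<subseteq> U n" by blast
    show "\<exists>c'. stronger c' c \<and> dint (fst c') \<subseteq> U n"
    proof (cases "length \<tau> \<le> m")
      case True
      then obtain \<pi> where \<pi>: "adm d \<pi>" "\<sigma> = \<tau> @ \<pi>" using \<sigma>(3) by auto
      show ?thesis using reroot[OF c(2) \<pi>(1)] dU unfolding c(1) \<pi>(2) by (metis fst_conv)
    next
      case False
      \<comment> \<open>The condition is already finer than the guess, so it lies in the component
        as it stands.\<close>
      then have "dint \<tau> \<subseteq> dint \<sigma>" using \<sigma>(3) dint_append_subset[of "take m \<tau>" "drop m \<tau>"] by simp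
      then show ?thesis using dU stronger_refl[OF c(2)] unfolding c(1) by (intro exI[of _ "(\<tau>, d)"]) auto
    qed
  qed
qed

section \<open>Density\<close>

text \<open>
  \<open>T\<close> marks the strings that have been stopped. The bound on the sums of \<open>f\<close> makes stopped cells
  rare around \<open>x\<close>, and a point that lies in a cell that is not stopped at every level is in \<open>C\<close>.
\<close>

lemma unstopped_density:
  fixes u v x :: real
  assumes C: "closed C"
    and T: "\<And>\<sigma> b. T \<sigma> \<Longrightarrow> T (\<sigma> @ [b])"
    and hit: "\<And>\<sigma>. \<not> T \<sigma> \<Longrightarrow> dint (\<tau> @ \<sigma>) \<inter> C \<noteq> {}"
    and ge: "\<And>\<sigma>. T \<sigma> \<Longrightarrow> 1 \<le> f \<sigma>" and nonneg: "\<And>\<sigma>. 0 \<le> (f \<sigma> :: real)"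
    and branch: "\<And>N. \<exists>k<2^N. x \<in> dint (\<tau> @ bits N k) \<and> \<not> T (bits N k) \<and>
       (\<forall>a b. a \<le> k \<longrightarrow> k < b \<longrightarrow> b \<le> 2 ^ N \<longrightarrow> (\<Sum>i\<in>{a..<b} - {k}. f (bits N i)) \<le> real (b - a + 1) / 2 ^ s)"
    and uv: "u < x" "x < v" "{u..v} \<subseteq> dint \<tau>"
  shows "(1 - 1 / 2 ^ s) * (v - u) \<le> measure lborel ({u..v} \<inter> C)"
proof -
  define base where "base = real (bval \<tau>) / 2 ^ length \<tau>"
  define w :: "nat \<Rightarrow> real" where "w N = 1 / 2 ^ (length \<tau> + N)" for N
  have w: "0 < w N" for N by (simp add: w_def)
  have w2: "2 ^ N * w N = 1 / 2 ^ length \<tau>" for N by (simp add: w_def power_add)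
  have cell: "dint (\<tau> @ bits N i) = {base + real i * w N .. base + real (i + 1) * w N}" if "i < 2 ^ N" for N i
    using that by (simp add: dint_append base_def w_def)
  have cell_iff: "y \<in> dint (\<tau> @ bits N i) \<longleftrightarrow> real i \<le> (y - base) / w N \<and> (y - base) / w N \<le> real i + 1"
    if "i < 2 ^ N" for N i y
    using w[of N] by (auto simp: cell[OF that] field_simps)
  \<comment> \<open>The part of [u, v] outside the unstopped cells of level N. It is covered by
    stopped cells and grows with N, because stopped strings stay stopped.\<close>
  define W where "W N = {u..v} - (\<Union>i\<in>{i. i < 2 ^ N \<and> \<not> T (bits N i)}. dint (\<tau> @ bits N i))" for N
  have W_sets [measurable]: "W N \<in> sets borel" for N
    unfolding W_def by (intro sets.Diff borel_closed closed_UN) (auto simp: dint_def)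
  have "u \<in> dint \<tau>" "v \<in> dint \<tau>" using uv by auto
  then have u: "base \<le> u" and v: "v \<le> base + 1 / 2 ^ length \<tau>"
    by (simp_all add: dint_def base_def add_divide_distrib)
  have W_le: "measure lborel (W N) \<le> ((v - u) + 3 * w N) / 2 ^ s" for N
  proof -
    define t where "t y = (y - base) / w N" for y
    obtain k where k: "k < 2 ^ N" "x \<in> dint (\<tau> @ bits N k)" "\<not> T (bits N k)"
      "\<And>a b. a \<le> k \<Longrightarrow> k < b \<Longrightarrow> b \<le> 2 ^ N \<Longrightarrow> (\<Sum>i\<in>{a..<b} - {k}. f (bits N i)) \<le> real (b - a + 1) / 2 ^ s"
      using branch by blast
    have tx: "real k \<le> t x" "t x \<le> real k + 1" using k(2) cell_iff[OF k(1)] by (auto simp: t_def)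
    have t_mono: "t y \<le> t z" if "y \<le> z" for y z
      using that w[of N] by (simp add: t_def divide_right_mono)
    have tux: "t u < t x" "t x < t v" using uv w[of N] by (simp_all add: t_def divide_strict_right_mono)
    have tu: "0 \<le> t u" using u w[of N] by (simp add: t_def)
    have "t v \<le> (2 ^ N * w N) / w N" unfolding t_def w2 using v w[of N] by (intro divide_right_mono) auto
    then have tv: "t v \<le> real (2 ^ N)" using w[of N] by simp
    define a where "a = nat \<lfloor>t u\<rfloor>"
    define b where "b = nat \<lceil>t v\<rceil>"
    have a: "real a \<le> t u" "t u < real a + 1" using tu unfolding a_def by linarith+
    have b: "t v \<le> real b" "real b < t v + 1" using tu tux unfolding b_def by linarith+
    have ak: "a \<le> k" using a tux tx by linarith
    have kb: "k < b" using b tux tx by linarith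
    have "\<lceil>t v\<rceil> \<le> int (2 ^ N)" using tv by (metis ceiling_le_iff of_int_of_nat_eq)
    then have b2: "b \<le> 2 ^ N" unfolding b_def by linarith
    define J where "J = {i \<in> {a..<b} - {k}. T (bits N i)}"
    have J: "finite J" by (simp add: J_def)
    have sub: "W N \<subseteq> (\<Union>i\<in>J. dint (\<tau> @ bits N i))"
    proof
      fix y assume y: "y \<in> W N"
      then have ty: "t u \<le> t y" "t y \<le> t v" by (auto simp: W_def intro: t_mono)
      \<comment> \<open>Cells are closed: a point at the right end of the range, where
        \<open>t y = b\<close>, is assigned to cell \<open>b - 1\<close>.\<close>
      define i where "i = (if nat \<lfloor>t y\<rfloor> < b then nat \<lfloor>t y\<rfloor> else b - 1)"
      have fl: "real (nat \<lfloor>t y\<rfloor>) \<le> t y" "t y < real (nat \<lfloor>t y\<rfloor>) + 1" using ty tu by linarith+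
      have i: "real i \<le> t y \<and> t y \<le> real i + 1 \<and> a \<le> i \<and> i < b"
      proof (cases "nat \<lfloor>t y\<rfloor> < b")
        case True
        then have "real a < real (nat \<lfloor>t y\<rfloor>) + 1" using fl ty a by linarith
        with True fl show ?thesis by (simp add: i_def)
      next
        case False
        then have "real b \<le> t y" using fl by linarith
        with False kb ak b ty show ?thesis by (simp add: i_def of_nat_diff)
      qed
      then have i2: "i < 2 ^ N" using b2 by simp
      then have yi: "y \<in> dint (\<tau> @ bits N i)" using cell_iff i by (simp add: t_def)
      then have "T (bits N i)" using y i2 by (auto simp: W_def)
      with i k(3) have "i \<in> J" by (auto simp: J_def)
      with yi show "y \<in> (\<Union>i\<in>J. dint (\<tau> @ bits N i))" by blast
    qed
    have "real (card J) = (\<Sum>i\<in>J. 1)" by simp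
    also have "\<dots> \<le> (\<Sum>i\<in>J. f (bits N i))" using ge by (intro sum_mono) (auto simp: J_def)
    also have "\<dots> \<le> (\<Sum>i\<in>{a..<b} - {k}. f (bits N i))" using nonneg by (intro sum_mono2) (auto simp: J_def)
    also have "\<dots> \<le> real (b - a + 1) / 2 ^ s" using k(4)[OF ak kb b2] .
    \<comment> \<open>Rounding u and v outwards costs at most one cell each, and the bound on the
      sum has one more; these three cells disappear in the limit over N.\<close>
    also have "\<dots> \<le> ((t v - t u) + 3) / 2 ^ s"
      using a b ak kb by (intro divide_right_mono) (simp_all add: of_nat_diff)
    finally have "real (card J) * w N \<le> ((t v - t u) + 3) / 2 ^ s * w N" using w[of N] by (intro mult_right_mono) simp_all
    also have "\<dots> = ((v - u) + 3 * w N) / 2 ^ s"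
      using w[of N] by (simp add: t_def field_simps)
    finally have card: "real (card J) * w N \<le> ((v - u) + 3 * w N) / 2 ^ s" .
    have "emeasure lborel (W N) \<le> emeasure lborel (\<Union>i\<in>J. dint (\<tau> @ bits N i))"
      by (rule emeasure_mono[OF sub]) (use J in \<open>auto simp: dint_def\<close>)
    also have "\<dots> \<le> (\<Sum>i\<in>J. emeasure lborel (dint (\<tau> @ bits N i)))"
      using J by (intro emeasure_subadditive_finite) (auto simp: dint_def)
    also have "\<dots> = (\<Sum>i\<in>J. ennreal (w N))"
    proof (rule sum.cong)
      fix i assume "i \<in> J"
      then have "i < 2 ^ N" using b2 by (simp add: J_def)
      then show "emeasure lborel (dint (\<tau> @ bits N i)) = ennreal (w N)"
        using w[of N] by (simp add: cell algebra_simps)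
    qed simp
    also have "\<dots> = ennreal (real (card J) * w N)"
      using w[of N] by (subst sum_ennreal) (simp_all add: less_imp_le)
    also have "\<dots> \<le> ennreal (((v - u) + 3 * w N) / 2 ^ s)" using card by (rule ennreal_leI)
    finally show ?thesis
      unfolding measure_def using uv w[of N] by (intro enn2real_leI) (simp_all add: less_imp_le add_nonneg_nonneg)
  qed
  have "W N \<subseteq> W (Suc N)" for N
  proof -
    have "dint (\<tau> @ bits (Suc N) i) \<subseteq> (\<Union>i\<in>{i. i < 2 ^ N \<and> \<not> T (bits N i)}. dint (\<tau> @ bits N i))"
      if "i < 2 ^ Suc N" "\<not> T (bits (Suc N) i)" for i
    proof -
      have "i div 2 < 2 ^ N" using that(1) by (intro less_mult_imp_div_less) (simp add: mult.commute)
      moreover have "\<not> T (bits N (i div 2))" using that(2) T by auto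
      moreover have "dint (\<tau> @ bits (Suc N) i) \<subseteq> dint (\<tau> @ bits N (i div 2))"
        using dint_append_subset[of "\<tau> @ bits N (i div 2)" "[odd i]"] by simp
      ultimately show ?thesis by blast
    qed
    then show ?thesis unfolding W_def by blast
  qed
  then have inc: "incseq W" by (rule incseq_SucI)
  have fin: "emeasure lborel A \<noteq> \<infinity>" if "A \<subseteq> {u..v}" for A
  proof -
    have "emeasure lborel A \<le> emeasure lborel {u..v}" using that by (rule emeasure_mono) simp
    then show ?thesis using uv by (auto simp: top_unique)
  qed
  have "(\<lambda>N. measure lborel (W N)) \<longlonglongrightarrow> measure lborel (\<Union>N. W N)"
  proof (rule Lim_measure_incseq[OF _ inc fin])
    show "range W \<subseteq> sets lborel" using W_sets by auto
  qed (auto simp: W_def)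
  moreover have "(\<lambda>N. ((v - u) + 3 * w N) / 2 ^ s) \<longlonglongrightarrow> ((v - u) + 3 * 0) / 2 ^ s"
  proof -
    have "(\<lambda>N. (1 / 2 ^ length \<tau>) * (1 / 2) ^ N :: real) \<longlonglongrightarrow> (1 / 2 ^ length \<tau>) * 0"
      by (intro tendsto_mult tendsto_const LIMSEQ_power_zero) simp
    then have "w \<longlonglongrightarrow> 0" by (simp add: w_def[abs_def] power_add power_one_over)
    then show ?thesis by (intro tendsto_intros) auto
  qed
  ultimately have W_lim: "measure lborel (\<Union>N. W N) \<le> (v - u) / 2 ^ s"
    using LIMSEQ_le[of _ _ "\<lambda>N. ((v - u) + 3 * w N) / 2 ^ s"] W_le by fastforce
  have "{u..v} - C \<subseteq> (\<Union>N. W N)"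
  proof
    fix y assume y: "y \<in> {u..v} - C"
    show "y \<in> (\<Union>N. W N)"
    proof (rule ccontr)
      assume n: "y \<notin> (\<Union>N. W N)"
      have "\<exists>c\<in>C. dist c y < e" if "e > 0" for e
      proof -
        obtain N where "1 / e < 2 ^ N" using power2_ge_ex by blast
        then have "1 / 2 ^ N < e" using that by (simp add: field_simps)
        moreover have "w N \<le> 1 / 2 ^ N" unfolding w_def by (intro divide_left_mono power_increasing) auto
        ultimately have we: "w N < e" by simp
        have "y \<notin> W N" using n by blast
        then obtain i where i: "i < 2 ^ N" "\<not> T (bits N i)" "y \<in> dint (\<tau> @ bits N i)"
          using y by (auto simp: W_def)
        obtain c where c: "c \<in> C" "c \<in> dint (\<tau> @ bits N i)" using hit[OF i(2)] by blast
        have "dist c y \<le> w N" using c(2) i(3) unfolding cell[OF i(1)] by (auto simp: dist_real_def distrib_right)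
        with we c(1) show ?thesis by (intro bexI[of _ c]) auto
      qed
      then have "y \<in> C" using closed_approachable[OF C] by blast
      with y show False by blast
    qed
  qed
  moreover have "(\<Union>N. W N) \<in> sets lborel" unfolding sets_lborel by measurable
  moreover have "emeasure lborel (\<Union>N. W N) \<noteq> \<infinity>" by (rule fin) (auto simp: W_def)
  ultimately have "measure lborel ({u..v} - C) \<le> measure lborel (\<Union>N. W N)"
    unfolding measure_def by (intro enn2real_mono emeasure_mono) (simp_all add: top.not_eq_extremum)
  moreover have "measure lborel ({u..v} - ({u..v} \<inter> C)) = measure lborel {u..v} - measure lborel ({u..v} \<inter> C)"
    using C fin[of "{u..v}"] by (intro measure_Diff) auto
  moreover have "{u..v} - ({u..v} \<inter> C) = {u..v} - C" by blast
  moreover have "measure lborel {u..v} = v - u" using uv by simp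
  ultimately show ?thesis using W_lim by (simp add: algebra_simps)
qed

text \<open>The bound is uniform in x because conditions are chosen before the generic point is
  known.\<close>

definition dense_along :: "condition \<Rightarrow> real set \<Rightarrow> nat \<Rightarrow> bool" where
  "dense_along c C s \<longleftrightarrow> (\<forall>x u v.
     (\<forall>N. \<exists>\<sigma>\<in>cond_set c. length \<sigma> = length (fst c) + N \<and> x \<in> dint \<sigma>) \<longrightarrow> u < x \<longrightarrow> x < v \<longrightarrow>
     {u..v} \<subseteq> dint (fst c) \<longrightarrow> (1 - 1 / 2 ^ s) * (v - u) \<le> measure lborel ({u..v} \<inter> C))"

text \<open>The two conclusions overlap between \<open>1 - 2 / 2 ^ p\<close> and 1, so a single
  approximation with error 2^-p decides S.\<close>

lemma decide_below_one:
  assumes "computable_martingale d"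
  obtains S where "dec (\<lambda>z. S (bits (p1 z) (p2 z)))"
    "\<And>\<sigma>. \<not> S \<sigma> \<Longrightarrow> d \<sigma> < 1" "\<And>\<sigma>. S \<sigma> \<Longrightarrow> 1 - 2 / 2 ^ p \<le> d \<sigma>"
proof -
  obtain A B where AB: "computable A" "computable B"
    "\<And>x n. \<bar>d (bits (p1 x) (p2 x)) - (real (A (pr x n)) - real (B (pr x n))) / 2 ^ n\<bar> \<le> 1 / 2 ^ n"
    using creal_E[OF computable_martingaleD(2)[OF assms]] by blast
  define S where "S \<sigma> \<longleftrightarrow> 2 ^ p + B (pr (pr (length \<sigma>) (bval \<sigma>)) p) \<le> A (pr (pr (length \<sigma>) (bval \<sigma>)) p) + 1" for \<sigma>
  have "\<not> S \<sigma> \<longrightarrow> d \<sigma> < 1" "S \<sigma> \<longrightarrow> 1 - 2 / 2 ^ p \<le> d \<sigma>" for \<sigma>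
  proof -
    let ?z = "pr (pr (length \<sigma>) (bval \<sigma>)) p"
    define q where "q = (real (A ?z) - real (B ?z)) / 2 ^ p"
    have q: "\<bar>d \<sigma> - q\<bar> \<le> 1 / 2 ^ p" using AB(3)[of "pr (length \<sigma>) (bval \<sigma>)" p] by (simp add: q_def)
    have "S \<sigma> \<longleftrightarrow> real (2 ^ p + B ?z) \<le> real (A ?z + 1)" unfolding S_def by (simp only: of_nat_le_iff)
    also have "\<dots> \<longleftrightarrow> 2 ^ p - 1 \<le> real (A ?z) - real (B ?z)" by auto
    also have "\<dots> \<longleftrightarrow> (2 ^ p - 1) / 2 ^ p \<le> q" by (simp add: q_def divide_le_cancel)
    also have "(2 ^ p - 1) / 2 ^ p = 1 - 1 / (2 ^ p :: real)" by (simp add: diff_divide_distrib)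
    finally have S: "S \<sigma> \<longleftrightarrow> 1 - 1 / 2 ^ p \<le> q" .
    show "\<not> S \<sigma> \<longrightarrow> d \<sigma> < 1" using q unfolding S by (auto simp: abs_le_iff)
    have "2 / 2 ^ p = 1 / 2 ^ p + 1 / (2 ^ p :: real)" by simp
    then show "S \<sigma> \<longrightarrow> 1 - 2 / 2 ^ p \<le> d \<sigma>" using q unfolding S by (auto simp: abs_le_iff)
  qed
  moreover have "dec (\<lambda>z. S (bits (p1 z) (p2 z)))"
    unfolding S_def length_bits bval_bits
    by (intro cpt computable_comp[OF AB(1)] computable_comp[OF AB(2)])
  ultimately show thesis using that by blast
qed

text \<open>
  The infimum \<open>L\<close> of the admissible capitals is nearly attained at some string. From there on the
  stopped martingale exceeds \<open>L\<close> by very little, while it exceeds \<open>L\<close> by a fixed amount on the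
  stopped strings, which therefore are scarce.
\<close>

lemma avoid_or_dense:
  assumes c: "valid_cond (\<tau>, d)" and C: "closed C"
  shows "\<exists>c'. stronger c' (\<tau>, d) \<and> (dint (fst c') \<inter> C = {} \<or> dense_along c' C s)"
proof (cases "\<exists>\<pi>. adm d \<pi> \<and> dint (\<tau> @ \<pi>) \<inter> C = {}")
  case True
  then show ?thesis using reroot[OF c] by (metis fst_conv)
next
  case False
  then have hit: "dint (\<tau> @ \<pi>) \<inter> C \<noteq> {}" if "adm d \<pi>" for \<pi> using that by blast
  have d: "computable_martingale d" "d [] < 1" using c by (simp_all add: valid_cond_def)
  note md = computable_martingaleD(1)[OF d(1)]
  define L where "L = Inf {d \<pi> | \<pi>. adm d \<pi>}"
  have bdd: "bdd_below {d \<pi> | \<pi>. adm d \<pi>}" by (rule bdd_belowI[of _ 0]) (use martingale_nonneg[OF md] in auto)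
  have ne: "{d \<pi> | \<pi>. adm d \<pi>} \<noteq> {}" using d(2) by (auto intro: exI[of _ "[]"])
  have L_le: "L \<le> d \<pi>" if "adm d \<pi>" for \<pi> unfolding L_def using that by (intro cInf_lower bdd) auto
  have L0: "0 \<le> L" unfolding L_def using ne martingale_nonneg[OF md] by (intro cInf_greatest) auto
  have L1: "L < 1" using L_le[of "[]"] d(2) by simp
  \<comment> \<open>M scales a gain of \<open>(1 - L) / 2\<close> to at least 1; p makes the
    stopping tolerance at most \<open>(1 - L) / 2\<close>; r makes the initial capital of
    \<open>f + e\<close> less than 1, where f starts below \<open>2 ^ M * 2 / 2 ^ r\<close> and e
    costs at most \<open>2 * 2 ^ s\<close> times as much.\<close>
  obtain M where M: "2 / (1 - L) < 2 ^ M" using power2_ge_ex by blast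
  obtain p where p: "4 / (1 - L) < 2 ^ p" using power2_ge_ex by blast
  obtain r where r: "2 ^ M * 2 * (1 + 2 * 2 ^ s) < (2 ^ r :: real)" using power2_ge_ex by blast
  \<comment> \<open>L need not be a computable real. Rounding it down keeps the difference from the
    stopped martingale nonnegative.\<close>
  define a where "a = nat \<lfloor>L * 2 ^ r\<rfloor>"
  have "0 \<le> L * 2 ^ r" using L0 by simp
  then have "real a \<le> L * 2 ^ r" "L * 2 ^ r < real a + 1" unfolding a_def by linarith+
  then have "real a / 2 ^ r \<le> L * 2 ^ r / 2 ^ r" "L * 2 ^ r / 2 ^ r < (real a + 1) / 2 ^ r"
    by (intro divide_right_mono divide_strict_right_mono; simp)+
  then have a: "real a / 2 ^ r \<le> L" "L - 1 / 2 ^ r < real a / 2 ^ r" by (simp_all add: add_divide_distrib)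
  have "\<exists>y\<in>{d \<pi> | \<pi>. adm d \<pi>}. y < L + 1 / 2 ^ r" unfolding L_def by (rule cInf_lessD[OF ne]) simp
  then obtain \<pi>0 where \<pi>0: "adm d \<pi>0" "d \<pi>0 < L + 1 / 2 ^ r" by blast
  define \<tau>1 where "\<tau>1 = \<tau> @ \<pi>0"
  define d1 where "d1 = (\<lambda>\<rho>. d (\<pi>0 @ \<rho>))"
  have st1: "stronger (\<tau>1, d1) (\<tau>, d)" unfolding \<tau>1_def d1_def by (rule reroot[OF c \<pi>0(1)])
  then have d1: "computable_martingale d1" "d1 [] < 1" by (simp_all add: stronger_def valid_cond_def)
  have adm1: "adm d (\<pi>0 @ \<rho>)" if "adm d1 \<rho>" for \<rho> using that \<pi>0(1) by (simp add: adm_append d1_def)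
  obtain S where S: "dec (\<lambda>z. S (bits (p1 z) (p2 z)))"
    "\<And>\<sigma>. \<not> S \<sigma> \<Longrightarrow> d1 \<sigma> < 1" "\<And>\<sigma>. S \<sigma> \<Longrightarrow> 1 - 2 / 2 ^ p \<le> d1 \<sigma>"
    using decide_below_one[OF d1(1)] by blast
  have p2: "2 / 2 ^ p \<le> (1 - L) / 2" using p L1 by (simp add: field_simps)
  have S_ge: "L + (1 - L) / 2 \<le> d1 \<sigma>" if "S \<sigma>" for \<sigma>
  proof -
    have "L + (1 - L) / 2 \<le> y" if "q \<le> (1 - L) / 2" "1 - q \<le> y" for q y :: real
      using that by argo
    from this[OF p2 S(3)[OF that]] show ?thesis .
  qed
  define T where "T \<sigma> \<longleftrightarrow> (\<exists>j\<le>length \<sigma>. S (take j \<sigma>))" for \<sigma>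
  have T_snoc: "T (\<sigma> @ [b])" if "T \<sigma>" for \<sigma> b
    using that unfolding T_def by (metis le_SucI length_append_singleton take_append append_Nil2 diff_is_0_eq take_0)
  have not_T: "adm d1 \<sigma>" if "\<not> T \<sigma>" for \<sigma> using that S(2) by (auto simp: T_def adm_def)
  have T_ge: "L + (1 - L) / 2 \<le> d1 (stop S \<sigma>)" if "T \<sigma>" for \<sigma>
  proof (cases rule: stop_cases[of S \<sigma>])
    case unstopped
    then have "S \<sigma>" using that unfolding T_def by (metis le_neq_implies_less take_all_iff order_refl)
    with unstopped S_ge show ?thesis by simp
  next
    case (stopped j)
    with S_ge show ?thesis by simp
  qed
  \<comment> \<open>An unstopped string is allowed by the original condition, so L bounds its
    capital from below; where the martingale has been stopped it exceeds L anyway.\<close>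
  have stop_ge: "L \<le> d1 (stop S \<sigma>)" for \<sigma>
  proof (cases "T \<sigma>")
    case True
    have "L \<le> y" if "L + (1 - L) / 2 \<le> y" for y using that L1 by argo
    from this[OF T_ge[OF True]] show ?thesis .
  next
    case False
    then have "stop S \<sigma> = \<sigma>" unfolding T_def by (intro stop_eq_self) auto
    with L_le[OF adm1[OF not_T[OF False]]] show ?thesis by (simp add: d1_def)
  qed
  define f where "f \<sigma> = 2 ^ M * (d1 (stop S \<sigma>) - real a / 2 ^ r)" for \<sigma>
  have f: "computable_martingale f"
    unfolding f_def
    by (intro computable_martingale_scale(1) computable_martingale_shift computable_martingale_stop d1(1) S(1)
        order_trans[OF a(1) stop_ge])
  have f_nonneg: "0 \<le> f \<sigma>" for \<sigma> using computable_martingaleD(1)[OF f] by (rule martingale_nonneg)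
  have f_ge: "1 \<le> f \<sigma>" if "T \<sigma>" for \<sigma>
  proof -
    have "1 \<le> 2 ^ M * ((1 - L) / 2)" using M L1 by (simp add: field_simps)
    also have "\<dots> \<le> f \<sigma>" unfolding f_def
    proof (rule mult_left_mono)
      have "(1 - L) / 2 \<le> y - q" if "L + (1 - L) / 2 \<le> y" "q \<le> L" for y q
        using that by argo
      from this[OF T_ge[OF that] a(1)] show "(1 - L) / 2 \<le> d1 (stop S \<sigma>) - real a / 2 ^ r" .
    qed simp
    finally show ?thesis .
  qed
  obtain e where e: "computable_martingale e" "e [] \<le> 2 * 2 ^ s * f []"
    "\<And>N k a b. k < 2 ^ N \<Longrightarrow> e (bits N k) < 1 \<Longrightarrow> a \<le> k \<Longrightarrow> k < b \<Longrightarrow> b \<le> 2 ^ N \<Longrightarrow>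
      (\<Sum>i\<in>{a..<b} - {k}. f (bits N i)) \<le> real (b - a + 1) / 2 ^ s"
    using maximal_martingale[OF f] by blast
  have e_nonneg: "0 \<le> e \<sigma>" for \<sigma> using computable_martingaleD(1)[OF e(1)] by (rule martingale_nonneg)
  \<comment> \<open>Capital of f below 1 keeps allowed strings unstopped, and capital of e below 1
    makes stopped cells rare around them.\<close>
  define d2 where "d2 \<sigma> = f \<sigma> + e \<sigma>" for \<sigma>
  have "f [] < 2 ^ M * (2 / 2 ^ r)"
  proof -
    have "d1 (stop S []) - real a / 2 ^ r < 2 / 2 ^ r"
      using \<pi>0(2) a(2) by (simp add: d1_def stop_def)
    then show ?thesis unfolding f_def by (intro mult_strict_left_mono) auto
  qed
  then have "f [] * (1 + 2 * 2 ^ s) < 2 ^ M * (2 / 2 ^ r) * (1 + 2 * 2 ^ s)"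
    by (intro mult_strict_right_mono) (auto simp: add_pos_pos)
  also have "\<dots> = 2 ^ M * 2 * (1 + 2 * 2 ^ s) / 2 ^ r" by simp
  also have "\<dots> < 1" using r by simp
  finally have "d2 [] < 1" using e(2) by (simp add: d2_def algebra_simps)
  then have v2: "valid_cond (\<tau>1, d2)"
    using computable_martingale_add[OF f e(1)] by (simp add: valid_cond_def d2_def[abs_def])
  have adm2: "\<not> T \<sigma>" "e \<sigma> < 1" if "adm d2 \<sigma>" for \<sigma>
  proof -
    have "f \<sigma> + e \<sigma> < 1" using adm_less[OF that] by (simp add: d2_def)
    then show "\<not> T \<sigma>" "e \<sigma> < 1" using f_ge[of \<sigma>] f_nonneg[of \<sigma>] e_nonneg[of \<sigma>] by linarith+
  qed
  have "cond_set (\<tau>1, d2) \<subseteq> cond_set (\<tau>1, d1)"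
    using adm2(1) not_T by (auto simp: cond_set_def)
  then have "stronger (\<tau>1, d2) (\<tau>, d)" using st1 v2 by (auto simp: stronger_def)
  moreover have "dense_along (\<tau>1, d2) C s"
    unfolding dense_along_def
  proof (intro allI impI)
    fix x u v
    assume x: "\<forall>N. \<exists>\<sigma>\<in>cond_set (\<tau>1, d2). length \<sigma> = length (fst (\<tau>1, d2)) + N \<and> x \<in> dint \<sigma>"
      and uv: "u < x" "x < v" "{u..v} \<subseteq> dint (fst (\<tau>1, d2))"
    show "(1 - 1 / 2 ^ s) * (v - u) \<le> measure lborel ({u..v} \<inter> C)"
    proof (rule unstopped_density[where T = T and f = f, OF C T_snoc _ f_ge f_nonneg])
      show "dint (\<tau>1 @ \<sigma>) \<inter> C \<noteq> {}" if "\<not> T \<sigma>" for \<sigma>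
        using hit[OF adm1[OF not_T[OF that]]] by (simp add: \<tau>1_def)
    next
      fix N
      obtain \<pi> where \<pi>: "adm d2 \<pi>" "length \<pi> = N" "x \<in> dint (\<tau>1 @ \<pi>)"
        using x[rule_format, of N] by (auto simp: cond_set_def)
      have b: "bits N (bval \<pi>) = \<pi>" "bval \<pi> < 2 ^ N" using bits_bval[of \<pi>] bval_less[of \<pi>] \<pi>(2) by simp_all
      show "\<exists>k<2 ^ N. x \<in> dint (\<tau>1 @ bits N k) \<and> \<not> T (bits N k) \<and>
         (\<forall>a b. a \<le> k \<longrightarrow> k < b \<longrightarrow> b \<le> 2 ^ N \<longrightarrow> (\<Sum>i\<in>{a..<b} - {k}. f (bits N i)) \<le> real (b - a + 1) / 2 ^ s)"
      proof (rule exI[of _ "bval \<pi>"], intro conjI allI impI)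
        show "(\<Sum>i\<in>{a..<b} - {bval \<pi>}. f (bits N i)) \<le> real (b - a + 1) / 2 ^ s"
          if "a \<le> bval \<pi>" "bval \<pi> < b" "b \<le> 2 ^ N" for a b
          using e(3)[OF b(2) _ that] adm2(2)[OF \<pi>(1)] b(1) by simp
      qed (use b \<pi> adm2(1)[OF \<pi>(1)] in simp_all)
    qed (use uv in simp_all)
  qed
  ultimately show ?thesis by blast
qed

section \<open>The generic sequence\<close>

text \<open>The universal function enumerates the computable functions. Countability of the
  requirements lets one sequence of conditions meet all of them.\<close>

lemma countable_computable: "countable {h. computable h}"
proof -
  obtain Q where Q:
    "\<And>e n y w y' w'. Q (pr e (pr n (pr y w))) \<Longrightarrow> Q (pr e (pr n (pr y' w'))) \<Longrightarrow> y = y'"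
    "\<And>h. computable h \<Longrightarrow> \<exists>e. \<forall>n. \<exists>w. Q (pr e (pr n (pr (h n) w)))"
    by (rule universal_computable) blast
  have "{h. computable h} \<subseteq> range (\<lambda>e n. THE y. \<exists>w. Q (pr e (pr n (pr y w))))"
  proof
    fix h assume "h \<in> {h. computable h}"
    then obtain e where e: "\<And>n. \<exists>w. Q (pr e (pr n (pr (h n) w)))" using Q(2) by blast
    have "h = (\<lambda>n. THE y. \<exists>w. Q (pr e (pr n (pr y w))))"
      using e Q(1) by (intro ext the_equality[symmetric]) blast+
    then show "h \<in> range (\<lambda>e n. THE y. \<exists>w. Q (pr e (pr n (pr y w))))" by blast
  qed
  then show ?thesis by (rule countable_subset) simp
qed

lemma countable_computable_rat_seq: "countable {q. computable_rat_seq q}"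
proof (rule countable_subset)
  show "{q. computable_rat_seq q} \<subseteq>
      (\<lambda>(num, den) n. of_int (int_decode (num n)) / of_nat (Suc (den n))) ` ({h. computable h} \<times> {h. computable h})"
    unfolding computable_rat_seq_def by (force simp: fun_eq_iff)
qed (intro countable_image countable_SIGMA countable_computable)

lemma countable_computable_martingale: "countable {d. computable_martingale d}"
proof (rule countable_subset)
  show "{d. computable_martingale d} \<subseteq>
      (\<lambda>q \<sigma>. lim (\<lambda>n. of_rat (q (pr (string_encode \<sigma>) n)))) ` {q. computable_rat_seq q}"
  proof
    fix d assume "d \<in> {d. computable_martingale d}"
    then obtain q where q: "computable_rat_seq q"
      "\<And>\<sigma> n. \<bar>d \<sigma> - of_rat (q (pr (string_encode \<sigma>) n))\<bar> \<le> (1/2) ^ n"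
      by (auto simp: computable_martingale_def)
    have "d \<sigma> = lim (\<lambda>n. of_rat (q (pr (string_encode \<sigma>) n)))" for \<sigma>
    proof (rule limI[symmetric], rule LIM_zero_cancel, rule Lim_null_comparison)
      show "\<forall>\<^sub>F n in sequentially. norm (of_rat (q (pr (string_encode \<sigma>) n)) - d \<sigma>) \<le> (1/2) ^ n"
        using q(2)[of \<sigma>] by (simp add: abs_minus_commute)
      show "(\<lambda>n. (1/2) ^ n :: real) \<longlonglongrightarrow> 0" by (intro LIMSEQ_power_zero) simp
    qed
    then show "d \<in> (\<lambda>q \<sigma>. lim (\<lambda>n. of_rat (q (pr (string_encode \<sigma>) n)))) ` {q. computable_rat_seq q}"
      using q(1) by blast
  qed
qed (intro countable_image countable_computable_rat_seq)

lemma countable_effectively_closed: "countable {C. effectively_closed C}"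
proof (rule countable_subset)
  show "{C. effectively_closed C} \<subseteq> (\<lambda>(a, b). - (\<Union>k. {of_rat (a k) <..< of_rat (b k)})) `
      ({q. computable_rat_seq q} \<times> {q. computable_rat_seq q})"
  proof
    fix C assume "C \<in> {C. effectively_closed C}"
    then obtain a b where ab: "computable_rat_seq a" "computable_rat_seq b"
      "- C = (\<Union>k. {of_rat (a k) <..< of_rat (b k)})" by (auto simp: effectively_closed_def)
    then have "C = - (\<Union>k. {of_rat (a k) <..< of_rat (b k)})" by (metis double_complement)
    with ab show "C \<in> (\<lambda>(a, b). - (\<Union>k. {of_rat (a k) <..< of_rat (b k)})) `
      ({q. computable_rat_seq q} \<times> {q. computable_rat_seq q})" by (intro image_eqI[of _ _ "(a, b)"]) auto
  qed
qed (intro countable_image countable_SIGMA countable_computable_rat_seq)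

lemma closed_effectively_closed: "effectively_closed C \<Longrightarrow> closed C"
  unfolding effectively_closed_def closed_def by (elim exE conjE) (auto intro!: open_UN)

text \<open>The Rasiowa-Sikorski construction for countably many dense requirements, with an
  extension by both bits in every step for the sake of \<open>dint_append_interior\<close>.\<close>

lemma generic_sequence:
  fixes R :: "nat \<Rightarrow> condition \<Rightarrow> bool"
  assumes dense: "\<And>n c. valid_cond c \<Longrightarrow> \<exists>c'. stronger c' c \<and> R n c'"
  obtains c where "\<And>n. stronger (c (Suc n)) (c n)" "\<And>n. R n (c (Suc n))"
    "\<And>n. \<exists>\<rho>. fst (c (Suc n)) = fst (c n) @ \<rho> \<and> True \<in> set \<rho> \<and> False \<in> set \<rho>"
proof -
  have fst_ext: "\<exists>\<rho>. fst c' = fst c @ \<rho>" if "stronger c' c" for c c'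
  proof -
    have "fst c' @ [] \<in> cond_set c'" unfolding cond_set_def
      using that by (auto simp: stronger_def valid_cond_def)
    then have "fst c' \<in> cond_set c" using that by (auto simp: stronger_def)
    then show ?thesis by (auto simp: cond_set_def)
  qed
  let ?P = "\<lambda>n c c'. stronger c' c \<and> R n c' \<and> (\<exists>\<rho>. fst c' = fst c @ \<rho> \<and> True \<in> set \<rho> \<and> False \<in> set \<rho>)"
  have "\<exists>c. \<forall>n. valid_cond (c n) \<and> ?P n (c n) (c (Suc n))"
  proof (rule dependent_nat_choice)
    show "\<exists>c. valid_cond c"
      using computable_martingale_const[of 0 0]
      by (intro exI[of _ "([], \<lambda>_. 0)"]) (simp add: valid_cond_def)
  next
    fix c n assume c: "valid_cond c"
    \<comment> \<open>The bits are appended first, since \<open>R n\<close> has to hold for the last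
      condition of the step.\<close>
    obtain \<rho> d' where 1: "stronger (fst c @ \<rho>, d') c" "True \<in> set \<rho>" "False \<in> set \<rho>"
      using both_bits[of "fst c" "snd c"] c by auto
    then have "valid_cond (fst c @ \<rho>, d')" by (simp add: stronger_def)
    then obtain c' where 2: "stronger c' (fst c @ \<rho>, d')" "R n c'" using dense by blast
    obtain \<rho>' where "fst c' = (fst c @ \<rho>) @ \<rho>'" using fst_ext[OF 2(1)] by auto
    then have "\<exists>\<rho>. fst c' = fst c @ \<rho> \<and> True \<in> set \<rho> \<and> False \<in> set \<rho>"
      using 1 by (intro exI[of _ "\<rho> @ \<rho>'"]) simp
    moreover have "stronger c' c" using 2(1) 1(1) by (rule stronger_trans)
    ultimately show "\<exists>c'. valid_cond c' \<and> ?P n c c'" using 2(2) by (intro exI[of _ c']) (simp add: stronger_def)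
  qed
  then show thesis using that by blast
qed

lemma lower_density_eq_1:
  assumes C: "closed C"
    and dense: "\<And>s. \<exists>l r. l < x \<and> x < r \<and> (\<forall>u v. u < x \<longrightarrow> x < v \<longrightarrow> {u..v} \<subseteq> {l<..<r} \<longrightarrow>
        (1 - 1 / 2 ^ s) * (v - u) \<le> measure lborel ({u..v} \<inter> C))"
  shows "lower_density C x = 1"
proof -
  let ?F = "at_right 0 \<times>\<^sub>F at_right (0::real)"
  let ?q = "\<lambda>(\<gamma>, \<delta>). ereal (measure lborel ({x - \<gamma> .. x + \<delta>} \<inter> C) / (\<gamma> + \<delta>))"
  have F: "eventually (\<lambda>p. 0 < fst p \<and> fst p < e \<and> 0 < snd p \<and> snd p < e) ?F" if "0 < e" for e :: real
  proof -
    have "eventually (\<lambda>\<gamma>. \<gamma> \<in> {0<..<e}) (at_right 0)" using that by (rule eventually_at_right_real)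
    from eventually_prodI[OF this this] show ?thesis by (rule eventually_mono) auto
  qed
  have "?q p \<le> 1" if "0 < fst p" "0 < snd p" for p
  proof -
    obtain \<gamma> \<delta> where p: "p = (\<gamma>, \<delta>)" by (cases p)
    have "emeasure lborel ({x - \<gamma> .. x + \<delta>} \<inter> C) \<le> emeasure lborel {x - \<gamma> .. x + \<delta>}" by (rule emeasure_mono) auto
    also have "\<dots> = ennreal (\<gamma> + \<delta>)" using that p by simp
    finally have "measure lborel ({x - \<gamma> .. x + \<delta>} \<inter> C) \<le> \<gamma> + \<delta>"
      unfolding measure_def using that p by (intro enn2real_leI) auto
    then show ?thesis using that p by simp
  qed
  then have "eventually (\<lambda>p. ?q p \<le> 1) ?F" using F[of 1] by (auto elim: eventually_mono)
  then have "Limsup ?F ?q \<le> 1" by (rule Limsup_bounded)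
  moreover have "Liminf ?F ?q \<le> Limsup ?F ?q"
    by (rule Liminf_le_Limsup) (simp add: prod_filter_eq_bot)
  moreover have "ereal (1 - 1 / 2 ^ s) \<le> Liminf ?F ?q" for s
  proof (rule Liminf_bounded)
    obtain l r where lr: "l < x" "x < r" "\<And>u v. u < x \<Longrightarrow> x < v \<Longrightarrow> {u..v} \<subseteq> {l<..<r} \<Longrightarrow>
        (1 - 1 / 2 ^ s) * (v - u) \<le> measure lborel ({u..v} \<inter> C)" using dense[of s] by blast
    define e where "e = min (x - l) (r - x)"
    have "0 < e" using lr by (simp add: e_def)
    from F[OF this] show "eventually (\<lambda>p. ereal (1 - 1 / 2 ^ s) \<le> ?q p) ?F"
    proof (rule eventually_mono)
      fix p assume p: "0 < fst p \<and> fst p < e \<and> 0 < snd p \<and> snd p < e"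
      obtain \<gamma> \<delta> where g: "p = (\<gamma>, \<delta>)" by (cases p)
      have "{x - \<gamma>..x + \<delta>} \<subseteq> {l<..<r}" using p g by (auto simp: e_def)
      then have "(1 - 1 / 2 ^ s) * ((x + \<delta>) - (x - \<gamma>)) \<le> measure lborel ({x - \<gamma> .. x + \<delta>} \<inter> C)"
        using p g by (intro lr(3)) auto
      then show "ereal (1 - 1 / 2 ^ s) \<le> ?q p" using p g by (simp add: pos_le_divide_eq add.commute)
    qed
  qed
  then have "ereal 1 \<le> Liminf ?F ?q"
  proof (intro LIMSEQ_le_const2[where a = "Liminf ?F ?q"])
    have "(\<lambda>s. 1 - (1 / 2) ^ s :: real) \<longlonglongrightarrow> 1 - 0" by (intro tendsto_diff tendsto_const LIMSEQ_power_zero) simp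
    then show "(\<lambda>s. ereal (1 - 1 / 2 ^ s)) \<longlonglongrightarrow> ereal 1"
      by (simp add: power_one_over)
  qed auto
  ultimately show ?thesis unfolding lower_density_def by (simp add: one_ereal_def) 
qed

text \<open>The partial sums are the left end points of the cells of Z; from level N on they stay in
  the closed cell of level N, and so does their limit.\<close>

lemma binary_expansion_dint:
  obtains x where "binary_expansion Z x" "\<And>N. x \<in> dint (map Z [0..<N])"
proof -
  define l where "l N = (\<Sum>i<N. of_bool (Z i) / 2 ^ Suc i :: real)" for N
  have l: "l N = real (bval (map Z [0..<N])) / 2 ^ N" for N
  proof (induction N)
    case (Suc N)
    then show ?case by (simp add: l_def add_divide_distrib)
  qed (simp add: l_def)
  have "summable (\<lambda>i. of_bool (Z i) / 2 ^ Suc i :: real)"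
  proof (rule summable_comparison_test)
    show "\<exists>N. \<forall>i\<ge>N. norm (of_bool (Z i) / 2 ^ Suc i :: real) \<le> (1 / 2) ^ i"
      by (intro exI[of _ 0]) (auto simp: power_one_over field_simps)
    show "summable (\<lambda>i. (1 / 2) ^ i :: real)" by (rule summable_geometric) simp
  qed
  then obtain x where x: "(\<lambda>i. of_bool (Z i) / 2 ^ Suc i :: real) sums x" by (auto simp: summable_def)
  then have lx: "l \<longlonglongrightarrow> x" by (simp add: sums_def l_def[abs_def])
  have "x \<in> dint (map Z [0..<N])" for N
  proof (rule Lim_in_closed_set[OF closed_dint _ _ lx])
    have "l M \<in> dint (map Z [0..<N])" if "N \<le> M" for M
    proof -
      have "map Z [0..<M] = map Z [0..<N] @ map Z [N..<M]"
        using upt_add_eq_append[of 0 N "M - N"] that by simp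
      moreover have "l M \<in> dint (map Z [0..<M])" unfolding l by (simp add: dint_def divide_right_mono)
      ultimately show ?thesis using dint_append_subset by fastforce
    qed
    then show "eventually (\<lambda>M. l M \<in> dint (map Z [0..<N])) sequentially"
      by (auto simp: eventually_sequentially)
  qed simp
  with x show thesis using that unfolding binary_expansion_def by blast
qed

theorem theorem5p7:
  shows "\<exists>x::real. x \<in> {0..1} \<and> computably_random x \<and> density_one_point x
           \<and> \<not> martin_loef_random x"
proof -
  obtain U where U: "uniformly_ce_open U" "\<And>n. emeasure lborel (U n) \<le> ennreal ((1/2) ^ n)"
    "\<And>c n. valid_cond c \<Longrightarrow> \<exists>c'. stronger c' c \<and> dint (fst c') \<subseteq> U n"
    using capturing_test by blast
  define Rb where "Rb e c \<longleftrightarrow> (\<exists>m. \<forall>\<sigma>\<in>cond_set c. e \<sigma> < (2::real) ^ m)" for e c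
  define Rd where "Rd p c \<longleftrightarrow> dint (fst c) \<inter> fst p = {} \<or> dense_along c (fst p) (snd p)" for p c
  define Ru where "Ru n c \<longleftrightarrow> dint (fst c) \<subseteq> U n" for n and c :: condition
  define RR where "RR = range Ru \<union> Rb ` {e. computable_martingale e} \<union> Rd ` ({C. effectively_closed C} \<times> UNIV)"
  have cRR: "countable RR"
    unfolding RR_def
    by (intro countable_Un countable_image countable_SIGMA countable_computable_martingale countable_effectively_closed) simp_all
  have dense: "\<exists>c'. stronger c' c \<and> R c'" if "R \<in> RR" "valid_cond c" for R c
  proof -
    have c: "valid_cond (fst c, snd c)" using that(2) by simp
    from that(1) consider n where "R = Ru n" | e where "computable_martingale e" "R = Rb e"
      | C s where "effectively_closed C" "R = Rd (C, s)" by (auto simp: RR_def)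
    then show ?thesis
    proof cases
      case 1
      then show ?thesis using U(3)[OF that(2)] by (simp add: Ru_def)
    next
      case 2
      then show ?thesis using bound_martingale[OF c] by (simp add: Rb_def)
    next
      case 3
      then show ?thesis using avoid_or_dense[OF c closed_effectively_closed] by (simp add: Rd_def)
    qed
  qed
  have ne: "RR \<noteq> {}" by (simp add: RR_def)
  obtain c where c: "\<And>n. stronger (c (Suc n)) (c n)" "\<And>n. from_nat_into RR n (c (Suc n))"
    "\<And>n. \<exists>\<rho>. fst (c (Suc n)) = fst (c n) @ \<rho> \<and> True \<in> set \<rho> \<and> False \<in> set \<rho>"
    by (rule generic_sequence[of "from_nat_into RR"]) (use dense from_nat_into[OF ne] in blast)+
  have meet: "\<exists>n. R (c (Suc n))" if "R \<in> RR" for R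
    using c(2) from_nat_into_surj[OF cRR that] by metis
  define \<tau> where "\<tau> n = fst (c n)" for n
  have len: "n \<le> length (\<tau> n)" for n
  proof (induction n)
    case (Suc n)
    obtain \<rho> where "\<tau> (Suc n) = \<tau> n @ \<rho>" "True \<in> set \<rho>" using c(3)[of n] by (auto simp: \<tau>_def)
    with Suc show ?case by (cases \<rho>) auto
  qed simp
  have mono: "stronger (c n) (c m)" if "m < n" for m n
    using that by (induction rule: strict_inc_induct) (auto intro: c(1) stronger_trans)
  have ext: "\<exists>\<rho>. \<tau> n = \<tau> m @ \<rho>" if "m \<le> n" for m n
    using that
  proof (induction rule: dec_induct)
    case (step n)
    then show ?case using c(3)[of n] by (auto simp: \<tau>_def)
  qed simp
  \<comment> \<open>\<open>\<tau> (Suc i)\<close> has length at least i + 1, and all the strings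
    agree where they are defined.\<close>
  define Z where "Z i = \<tau> (Suc i) ! i" for i
  have Z: "Z i = \<tau> n ! i" if "i < length (\<tau> n)" for i n
  proof (cases "n \<le> Suc i")
    case True
    then show ?thesis using ext[OF True] that by (auto simp: Z_def nth_append)
  next
    case False
    then obtain \<rho> where "\<tau> n = \<tau> (Suc i) @ \<rho>" using ext[of "Suc i" n] by auto
    then show ?thesis using len[of "Suc i"] by (auto simp: Z_def nth_append)
  qed
  have take: "map Z [0..<N] = take N (\<tau> n)" if "N \<le> length (\<tau> n)" for N n
    using that Z[of _ n] by (intro nth_equalityI) auto
  have in_set: "map Z [0..<N] \<in> cond_set (c m)" if "length (\<tau> m) \<le> N" for m N
  proof -
    \<comment> \<open>A condition that is stronger than \<open>c m\<close> and whose string has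
      length at least N; its prefixes from the length of \<open>\<tau> m\<close> on are allowed by
      \<open>c m\<close>.\<close>
    define n where "n = Suc (m + N)"
    have "\<tau> n \<in> cond_set (c n)"
      using c(1)[of "m + N"] unfolding n_def cond_set_def \<tau>_def stronger_def valid_cond_def
      by (auto intro!: exI[of _ "[]"])
    moreover have "cond_set (c n) \<subseteq> cond_set (c m)" using mono[of m n] by (simp add: n_def stronger_def)
    ultimately have "\<tau> n \<in> cond_set (c m)" by blast
    then obtain \<pi> where \<pi>: "\<tau> n = \<tau> m @ \<pi>" "adm (snd (c m)) \<pi>" by (auto simp: cond_set_def \<tau>_def)
    have "N \<le> length (\<tau> n)" using len[of n] by (simp add: n_def)
    from take[OF this] have "map Z [0..<N] = \<tau> m @ take (N - length (\<tau> m)) \<pi>" using \<pi>(1) that by simp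
    then show ?thesis using adm_take[OF \<pi>(2)] unfolding cond_set_def \<tau>_def by auto
  qed
  obtain x where x: "binary_expansion Z x" "\<And>N. x \<in> dint (map Z [0..<N])"
    using binary_expansion_dint[of Z] by blast
  have x_dint: "x \<in> dint (\<tau> n)" for n
    using x(2)[of "length (\<tau> n)"] take[of "length (\<tau> n)" n] by simp
  have "x \<in> {0..1}" using x(2)[of 0] by (simp add: dint_def)
  moreover have "computably_random x"
    unfolding computably_random_def
  proof (intro exI[of _ Z] conjI allI impI x(1))
    fix e assume "computable_martingale e"
    then obtain n where "Rb e (c (Suc n))" using meet[of "Rb e"] by (auto simp: RR_def)
    then obtain m where m: "\<And>\<sigma>. \<sigma> \<in> cond_set (c (Suc n)) \<Longrightarrow> e \<sigma> < 2 ^ m" by (auto simp: Rb_def)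
    have "limsup (\<lambda>N. ereal (e (map Z [0..<N]))) \<le> ereal (2 ^ m)"
      by (rule Limsup_bounded, rule eventually_sequentiallyI[of "length (\<tau> (Suc n))"])
        (simp add: less_imp_le m in_set)
    then show "limsup (\<lambda>N. ereal (e (map Z [0..<N]))) < \<infinity>" by (rule le_less_trans) simp
  qed
  moreover have "density_one_point x"
    unfolding density_one_point_def
  proof (intro allI impI)
    fix C assume C: "effectively_closed C \<and> x \<in> C"
    show "lower_density C x = 1"
    proof (rule lower_density_eq_1)
      show "closed C" using C closed_effectively_closed by blast
      fix s
      obtain n where n: "Rd (C, s) (c (Suc n))" using meet[of "Rd (C, s)"] C by (auto simp: RR_def)
      let ?\<tau> = "\<tau> (Suc n)"
      \<comment> \<open>x lies both in C and in the interval of the condition, which rules out the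
        other alternative of \<open>Rd\<close>.\<close>
      have "dense_along (c (Suc n)) C s" using n x_dint[of "Suc n"] C by (auto simp: Rd_def \<tau>_def)
      moreover have "\<exists>\<sigma>\<in>cond_set (c (Suc n)). length \<sigma> = length (fst (c (Suc n))) + N \<and> x \<in> dint \<sigma>" for N
        using in_set[of "Suc n" "length ?\<tau> + N"] x(2)[of "length ?\<tau> + N"]
        by (intro bexI[of _ "map Z [0..<length ?\<tau> + N]"]) (simp_all add: \<tau>_def)
      ultimately have dn: "(1 - 1 / 2 ^ s) * (v - u) \<le> measure lborel ({u..v} \<inter> C)"
        if "u < x" "x < v" "{u..v} \<subseteq> dint ?\<tau>" for u v
        using that unfolding dense_along_def \<tau>_def by blast
      \<comment> \<open>The next condition extends \<open>?\<tau>\<close> by both bits, so x is an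
        interior point of the interval of \<open>?\<tau>\<close>.\<close>
      obtain \<rho> where \<rho>: "\<tau> (Suc (Suc n)) = ?\<tau> @ \<rho>" "True \<in> set \<rho>" "False \<in> set \<rho>"
        using c(3)[of "Suc n"] by (auto simp: \<tau>_def)
      let ?l = "real (bval ?\<tau>) / 2 ^ length ?\<tau>" and ?r = "real (bval ?\<tau> + 1) / 2 ^ length ?\<tau>"
      have xi: "x \<in> {?l<..<?r}"
        using dint_append_interior[OF \<rho>(2,3), of ?\<tau>] x_dint[of "Suc (Suc n)"] unfolding \<rho>(1) by blast
      have sub: "{?l<..<?r} \<subseteq> dint ?\<tau>" by (auto simp: dint_def)
      show "\<exists>l r. l < x \<and> x < r \<and> (\<forall>u v. u < x \<longrightarrow> x < v \<longrightarrow> {u..v} \<subseteq> {l<..<r} \<longrightarrow>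
        (1 - 1 / 2 ^ s) * (v - u) \<le> measure lborel ({u..v} \<inter> C))"
      proof (rule exI[of _ ?l], rule exI[of _ ?r], intro conjI allI impI)
        show "?l < x" "x < ?r" using xi by simp_all
        show "(1 - 1 / 2 ^ s) * (v - u) \<le> measure lborel ({u..v} \<inter> C)"
          if "u < x" "x < v" "{u..v} \<subseteq> {?l<..<?r}" for u v
          using dn[OF that(1,2) subset_trans[OF that(3) sub]] .
      qed
    qed
  qed
  moreover have "x \<in> U n" for n
  proof -
    obtain k where "Ru n (c (Suc k))" using meet[of "Ru n"] by (auto simp: RR_def)
    then show ?thesis using x_dint[of "Suc k"] by (auto simp: Ru_def \<tau>_def)
  qed
  then have "\<not> martin_loef_random x"
    unfolding martin_loef_random_def using U(1,2) by blast
  ultimately show ?thesis by blast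
qed

end
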